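(* Let $1\le r<n$, $V=\mathbb{F}_q^n$, let $U$ be an $r$-dimensional subspace of $V$, let $u_1,\dots,u_r$ be a basis of $U$, extended to a basis $u_1,\dots,u_n$ of $V$, and let $U_0=\langle u_2,\dots,u_r\rangle$ and $V_0=\langle u_1,\dots,u_{n-1}\rangle$. For $\lambda\in\mathbb{F}_q^*$ let $\mathcal{T}_\lambda$ be the set of all $T\in \mathrm{GL}(V)_U$ such that $(t-\lambda)^3\nmid c_T(t)$, there exists $w_1\in u_1+U_0$ with $w_1T=\lambda w_1$, and there exists $w_2\in u_n+V_0$ with $w_2T=\lambda w_2$. Then $\bigcup_{\lambda\in\mathbb{F}_q^*}\mathcal{T}_\lambda$ is a set of noncyclic matrices in $\mathrm{GL}(V)_U$ whose limiting proportion $$\frac{\left|\bigcup_{\lambda\in\mathbb{F}_q^*}\mathcal{T}_\lambda\right|}{|\mathrm{GL}(V)_U|}$$ in $\mathrm{GL}(V)_U$, as $n$ tends to infinity (with $r$ fixed), is $q^{-2}+O(q^{-3})$.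
   Context: $\mathbb{F}_q$ is the field of order $q$; matrices act on row vectors of $V=\mathbb{F}_q^n$ by right multiplication. $\mathrm{GL}(V)_U$ is the subgroup of $\mathrm{GL}(V)=\mathrm{GL}(n,q)$ of all matrices fixing $U$ setwise. $c_T(t)$ is the characteristic polynomial of $T$. A matrix is cyclic if its characteristic polynomial equals its minimal polynomial, and noncyclic otherwise. $\langle\cdot\rangle$ denotes linear span, and $u+W$ denotes the coset $\{u+w : w\in W\}$. The $O(q^{-3})$ term refers to varying $q$. *)

theory Defs
  imports
    Complex_Main
    "HOL-Algebra.Polynomial_Divisibility"
    "HOL-Combinatorics.Permutations"
    "Jordan_Normal_Form.Matrix"
    "Jordan_Normal_Form.Missing_VectorSpace"
begin

text \<open>
  The constant in the error term $O(q^{-3})$ must not depend on the field, so the field has to be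
  quantified inside a formula. It is therefore a HOL-Algebra record \<open>F\<close> and not a type of class
  \<open>field\<close>. For an infinite type \<open>'a\<close>, such as \<open>nat\<close>, the records \<open>F :: 'a ring\<close> include finite
  fields of every prime power order. Vectors and matrices are the containers \<open>'a vec\<close> and \<open>'a mat\<close>, with entries in
  \<open>carrier F\<close>; the arithmetic that comes with these types needs type classes on \<open>'a\<close>, and so is
  restated below over \<open>F\<close>. Coordinates are numbered from 0, basis vectors from 1.
\<close>

definition row_space :: "'a ring \<Rightarrow> nat \<Rightarrow> ('a, 'a vec) module" where
  "row_space F n =
     \<lparr>carrier = {v \<in> carrier_vec n. \<forall>i<n. v $ i \<in> carrier F},
      mult = undefined,
      one = undefined,
      zero = vec n (\<lambda>_. \<zero>\<^bsub>F\<^esub>),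
      add = (\<lambda>v w. vec n (\<lambda>i. v $ i \<oplus>\<^bsub>F\<^esub> w $ i)),
      smult = (\<lambda>a v. vec n (\<lambda>i. a \<otimes>\<^bsub>F\<^esub> v $ i))\<rparr>"

definition scalar_matrix :: "('a, 'm) ring_scheme \<Rightarrow> nat \<Rightarrow> 'a \<Rightarrow> 'a mat" where
  "scalar_matrix R n a = mat n n (\<lambda>(i, j). if i = j then a else \<zero>\<^bsub>R\<^esub>)"

definition matrix_ring :: "'a ring \<Rightarrow> nat \<Rightarrow> 'a mat ring" where
  "matrix_ring F n =
     \<lparr>carrier = {A \<in> carrier_mat n n. \<forall>i<n. \<forall>j<n. A $$ (i, j) \<in> carrier F},
      mult = (\<lambda>A B. mat n n (\<lambda>(i, j). \<Oplus>\<^bsub>F\<^esub>k\<in>{0..<n}. A $$ (i, k) \<otimes>\<^bsub>F\<^esub> B $$ (k, j))),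
      one = scalar_matrix F n \<one>\<^bsub>F\<^esub>,
      zero = scalar_matrix F n \<zero>\<^bsub>F\<^esub>,
      add = (\<lambda>A B. mat n n (\<lambda>(i, j). A $$ (i, j) \<oplus>\<^bsub>F\<^esub> B $$ (i, j)))\<rparr>"

definition row_mult :: "'a ring \<Rightarrow> nat \<Rightarrow> 'a vec \<Rightarrow> 'a mat \<Rightarrow> 'a vec" where
  "row_mult F n v T = vec n (\<lambda>j. \<Oplus>\<^bsub>F\<^esub>i\<in>{0..<n}. v $ i \<otimes>\<^bsub>F\<^esub> T $$ (i, j))"

definition GL :: "'a ring \<Rightarrow> nat \<Rightarrow> 'a mat set" where
  "GL F n = Units (matrix_ring F n)"

definition GL_stabilizer :: "'a ring \<Rightarrow> nat \<Rightarrow> 'a vec set \<Rightarrow> 'a mat set" where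
  "GL_stabilizer F n U = {T \<in> GL F n. (\<lambda>v. row_mult F n v T) ` U = U}"

definition determinant :: "('a, 'm) ring_scheme \<Rightarrow> nat \<Rightarrow> 'a mat \<Rightarrow> 'a" where
  "determinant R n A =
     (\<Oplus>\<^bsub>R\<^esub>p\<in>{p. p permutes {0..<n}}.
        (if evenperm p then \<one>\<^bsub>R\<^esub> else \<ominus>\<^bsub>R\<^esub> \<one>\<^bsub>R\<^esub>) \<otimes>\<^bsub>R\<^esub> (\<Otimes>\<^bsub>R\<^esub>i\<in>{0..<n}. A $$ (i, p i)))"

text \<open>
  Elements of \<open>poly_ring F\<close> are coefficient lists, highest coefficient first, without leading
  zeros; \<open>[]\<close> is the zero polynomial and \<open>[\<one>, \<zero>]\<close> is the indeterminate.
  The characteristic polynomial is $\det(tI - T)$ over this ring.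
\<close>

definition char_polynomial :: "'a ring \<Rightarrow> nat \<Rightarrow> 'a mat \<Rightarrow> 'a list" where
  "char_polynomial F n T =
     determinant (poly_ring F) n
       (mat n n (\<lambda>(i, j). (if i = j then [\<one>\<^bsub>F\<^esub>, \<zero>\<^bsub>F\<^esub>] else [])
                           \<ominus>\<^bsub>poly_ring F\<^esub> ring.poly_of_const F (T $$ (i, j))))"

definition poly_at_matrix :: "'a ring \<Rightarrow> nat \<Rightarrow> 'a list \<Rightarrow> 'a mat \<Rightarrow> 'a mat" where
  "poly_at_matrix F n p T = ring.eval (matrix_ring F n) (map (scalar_matrix F n) p) T"

definition min_polynomial :: "'a ring \<Rightarrow> nat \<Rightarrow> 'a mat \<Rightarrow> 'a list" where
  "min_polynomial F n T =
     (THE m. m \<in> carrier (poly_ring F) \<and> m \<noteq> [] \<and> hd m = \<one>\<^bsub>F\<^esub> \<and>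
             poly_at_matrix F n m T = \<zero>\<^bsub>matrix_ring F n\<^esub> \<and>
             (\<forall>f\<in>carrier (poly_ring F).
                f \<noteq> [] \<and> poly_at_matrix F n f T = \<zero>\<^bsub>matrix_ring F n\<^esub> \<longrightarrow> length m \<le> length f))"

definition cyclic_matrix :: "'a ring \<Rightarrow> nat \<Rightarrow> 'a mat \<Rightarrow> bool" where
  "cyclic_matrix F n T \<longleftrightarrow> char_polynomial F n T = min_polynomial F n T"

text \<open>
  \<open>vectorspace.basis\<close> speaks about sets of vectors; injectivity makes \<open>u 1, \<dots>, u n\<close> an
  indexed basis.
\<close>

definition adapted_basis ::
  "'a ring \<Rightarrow> nat \<Rightarrow> nat \<Rightarrow> 'a vec set \<Rightarrow> (nat \<Rightarrow> 'a vec) \<Rightarrow> bool" where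
  "adapted_basis F r n U u \<longleftrightarrow>
     VectorSpace.subspace F U (row_space F n) \<and>
     vectorspace.dim F (row_space F n\<lparr>carrier := U\<rparr>) = r \<and>
     inj_on u {1..n} \<and>
     vectorspace.basis F (row_space F n\<lparr>carrier := U\<rparr>) (u ` {1..r}) \<and>
     vectorspace.basis F (row_space F n) (u ` {1..n})"

definition T_set ::
  "'a ring \<Rightarrow> nat \<Rightarrow> nat \<Rightarrow> 'a vec set \<Rightarrow> (nat \<Rightarrow> 'a vec) \<Rightarrow> 'a \<Rightarrow> 'a mat set" where
  "T_set F r n U u l =
     (let V = row_space F n;
          U0 = module.span F V (u ` {2..r});
          V0 = module.span F V (u ` {1..n - 1})
      in {T \<in> GL_stabilizer F n U.
            \<not> ([\<one>\<^bsub>F\<^esub>, \<ominus>\<^bsub>F\<^esub> l] [^]\<^bsub>poly_ring F\<^esub> (3::nat)) pdivides\<^bsub>F\<^esub> char_polynomial F n T \<and>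
            (\<exists>w1 \<in> u 1 <+\<^bsub>V\<^esub> U0. row_mult F n w1 T = l \<odot>\<^bsub>V\<^esub> w1) \<and>
            (\<exists>w2 \<in> u n <+\<^bsub>V\<^esub> V0. row_mult F n w2 T = l \<odot>\<^bsub>V\<^esub> w2)})"

definition T_union ::
  "'a ring \<Rightarrow> nat \<Rightarrow> nat \<Rightarrow> 'a vec set \<Rightarrow> (nat \<Rightarrow> 'a vec) \<Rightarrow> 'a mat set" where
  "T_union F r n U u = (\<Union>l\<in>carrier F - {\<zero>\<^bsub>F\<^esub>}. T_set F r n U u l)"

end

theory Submission
  imports Defs "Jordan_Normal_Form.Char_Poly" "HOL-Algebra.Multiplicative_Group"
begin

text \<open>
  In the given basis, the elements of the stabilizer are the block matrices with rows \<open>(A, 0)\<close> and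
  \<open>(B, C)\<close>. Since the characteristic polynomial is the product of those of \<open>A\<close> and \<open>C\<close>, such a
  matrix lies in \<open>\<T>\<^sub>\<lambda>\<close> iff \<open>\<lambda>\<close> is a simple root of both factors, the eigenvectors \<open>a\<close> of \<open>A\<close> and \<open>y\<close> of
  \<open>C\<close> can be normalized in the first and last coordinate, and \<open>y B\<close> lies in the image of \<open>\<lambda> - A\<close>. The two
  resulting eigenvectors span an eigenplane, so the matrix is noncyclic.

  For a set \<open>S\<close> of eigenvalues the conditions on \<open>B\<close> are independent, each of probability \<open>1/q\<close>. The
  conditions on \<open>C\<close> reduce, on dividing by the span of the eigenvectors, to the proportion of
  invertible matrices without eigenvalues in \<open>S\<close>. This proportion converges: the mean number of
  \<open>d\<close>-tuples of independent eigenvectors for one more eigenvalue is the proportion for dimension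
  lower by \<open>d\<close>, and a \<open>q\<close>-analogue of inclusion-exclusion expresses the next proportion as a
  convolution with an absolutely summable sequence. Inclusion-exclusion over \<open>\<lambda>\<close> then gives the limit,
  and Bonferroni's inequalities its distance from \<open>q\<^sup>-\<^sup>2\<close>: the \<open>q - 1\<close> events have
  probability about \<open>q\<^sup>-\<^sup>3\<close> each, and pairs of them \<open>O(q\<^sup>-\<^sup>6)\<close>.
\<close>

section \<open>Homomorphisms from ring types to ring records\<close>

text \<open>The uniform constant forces fields to be ring records, while determinants, adjugates and
  characteristic polynomials live on ring types. The bridge is a surjective homomorphism
  \<open>phi\<close> from \<open>int poly\<close> onto the field: a polynomial identity between
  matrices is proved over the type and mapped down. Inverses do not lift in this way, so ranks,
  inverses and complements are obtained inside the field, by counting vectors with powers of q.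

  Existence of the limit and its size are separate arguments. For one field the inclusion-exclusion
  expansion has finitely many terms, each of them convergent, but it does not show the size. The
  two-sided bound with constant 4 holds for every field and every codimension at least 1, and it
  survives the limit.

  Invertibility is treated as absence of the eigenvalue 0, so that the general linear group is the
  case S = {0} of the same counts. The parameter \<open>t\<close> of the later definitions is the
  coordinate at which an eigenvector is scaled to 1; it encodes the affine conditions on w_1 and
  w_2.\<close>

locale type_hom = cring S for S :: "('a, 'm) ring_scheme" (structure) +
  fixes h :: "'r::comm_ring_1 \<Rightarrow> 'a"
  assumes closed [simp, intro]: "h x \<in> carrier S"
    and hom_add: "h (x + y) = h x \<oplus> h y"
    and hom_mult: "h (x * y) = h x \<otimes> h y"
    and hom_one: "h 1 = \<one>"
begin

lemma hom_zero: "h 0 = \<zero>"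
proof -
  have "h 0 \<oplus> h 0 = h 0" using hom_add[of 0 0] by simp
  then show ?thesis by (metis add.r_cancel_one' closed)
qed

lemma hom_uminus: "h (- x) = \<ominus> h x"
proof -
  have "h (- x) \<oplus> h x = \<zero>" using hom_add[of "- x" x] hom_zero by simp
  then show ?thesis by (metis minus_equality closed)
qed

lemma hom_minus: "h (x - y) = h x \<ominus> h y"
  using hom_add[of x "- y"] by (simp add: hom_uminus a_minus_def)

lemma hom_sum: "finite A \<Longrightarrow> h (sum f A) = (\<Oplus>i\<in>A. h (f i))"
  by (induction A rule: finite_induct) (auto simp: hom_zero hom_add)

lemma hom_prod: "finite A \<Longrightarrow> h (prod f A) = (\<Otimes>i\<in>A. h (f i))"
  by (induction A rule: finite_induct) (auto simp: hom_one hom_mult)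

lemma hom_power: "h (x ^ n) = h x [^] n"
  by (induction n) (auto simp: hom_one hom_mult m_comm)

text \<open>Both determinants are Leibniz sums over permutations, so the homomorphism can be applied
  term by term; only the sign has to be translated.\<close>

lemma hom_det:
  assumes "A \<in> carrier_mat n n"
  shows "h (Determinant.det A) = determinant S n (map_mat h A)"
proof -
  have fin: "finite {p. p permutes {0..<n}}" by (simp add: finite_permutations)
  have s: "h (signof p) = (if evenperm p then \<one> else \<ominus> \<one>)" for p :: "nat \<Rightarrow> nat"
    by (simp add: sign_def hom_one hom_uminus)
  have "h (Determinant.det A) = (\<Oplus>p\<in>{p. p permutes {0..<n}}. h (signof p * (\<Prod>i = 0..<n. A $$ (i, p i))))"
    using det_def'[OF assms] hom_sum[OF fin] by simp
  also have "\<dots> = determinant S n (map_mat h A)"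
    unfolding determinant_def
  proof (rule finsum_cong')
    show "(\<lambda>p. (if evenperm p then \<one> else \<ominus> \<one>) \<otimes> (\<Otimes>i\<in>{0..<n}. map_mat h A $$ (i, p i)))
        \<in> {p. p permutes {0..<n}} \<rightarrow> carrier S"
    proof
      fix p assume p: "p \<in> {p. p permutes {0..<n}}"
      have "(\<lambda>i. map_mat h A $$ (i, p i)) \<in> {0..<n} \<rightarrow> carrier S"
        using assms p permutes_in_image[of p "{0..<n}"] by auto
      then show "(if evenperm p then \<one> else \<ominus> \<one>) \<otimes> (\<Otimes>i\<in>{0..<n}. map_mat h A $$ (i, p i)) \<in> carrier S"
        by (auto intro!: m_closed finprod_closed)
    qed
    fix p assume p: "p \<in> {p. p permutes {0..<n}}"
    have "(\<Otimes>i\<in>{0..<n}. h (A $$ (i, p i))) = (\<Otimes>i\<in>{0..<n}. map_mat h A $$ (i, p i))"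
      using assms p permutes_in_image[of p "{0..<n}"] by (intro finprod_cong') auto
    then show "h (signof p * (\<Prod>i = 0..<n. A $$ (i, p i)))
        = (if evenperm p then \<one> else \<ominus> \<one>) \<otimes> (\<Otimes>i\<in>{0..<n}. map_mat h A $$ (i, p i))"
      using s[of p] by (simp add: hom_mult hom_prod)
  qed auto
  finally show ?thesis .
qed

end

text \<open>Horner evaluation at \<open>x\<close> after applying \<open>h\<close> to the
  coefficients. It is used twice: with a generator of the multiplicative group, to reach a finite
  field from \<open>int poly\<close>, and with the indeterminate, to reach
  \<open>poly_ring F\<close> from \<open>int poly poly\<close>.\<close>

definition poly_lift :: "('a, 'm) ring_scheme \<Rightarrow> ('r::comm_ring_1 \<Rightarrow> 'a) \<Rightarrow> 'a \<Rightarrow> 'r poly \<Rightarrow> 'a" where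
  "poly_lift S h x p = fold_coeffs (\<lambda>a y. h a \<oplus>\<^bsub>S\<^esub> x \<otimes>\<^bsub>S\<^esub> y) p \<zero>\<^bsub>S\<^esub>"

context type_hom
begin

lemma poly_lift_0: "poly_lift S h x 0 = \<zero>"
  by (simp add: poly_lift_def)

lemma poly_lift_pCons:
  assumes "x \<in> carrier S"
  shows "poly_lift S h x (pCons a p) = h a \<oplus> x \<otimes> poly_lift S h x p"
\<comment> \<open>\<open>pCons 0 0\<close> is the zero polynomial, on which
  \<open>fold_coeffs\<close> takes no step, so the recursion holds there only because
  \<open>h 0\<close> is \<zero>.\<close>
proof (cases "p = 0 \<and> a = 0")
  case True
  then show ?thesis using assms by (simp add: poly_lift_def hom_zero)
next
  case False
  then show ?thesis unfolding poly_lift_def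
    by (cases "p = 0") (auto simp: fold_coeffs_pCons_not_0_0_eq fold_coeffs_pCons_coeff_not_0_eq)
qed

lemma type_hom_poly_lift:
  assumes x [simp]: "x \<in> carrier S"
  shows "type_hom S (poly_lift S h x)"
proof -
  let ?f = "poly_lift S h x"
  have cl: "?f p \<in> carrier S" for p
    by (induction p) (auto simp: poly_lift_0 poly_lift_pCons)
  note [simp] = cl
  have add: "?f (p + q) = ?f p \<oplus> ?f q" for p q
  proof (induction p q rule: poly_induct2)
    case 0
    then show ?case by (simp add: poly_lift_0)
  next
    case (pCons a p b q)
    have "h (a + b) \<oplus> x \<otimes> (?f p \<oplus> ?f q) = h a \<oplus> x \<otimes> ?f p \<oplus> (h b \<oplus> x \<otimes> ?f q)"
      by (simp add: hom_add r_distr a_ac)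
    then show ?case using pCons by (simp add: poly_lift_pCons)
  qed
  have smult: "?f (Polynomial.smult c p) = h c \<otimes> ?f p" for c p
  proof (induction p)
    case 0
    then show ?case by (simp add: poly_lift_0)
  next
    case (pCons a p)
    then show ?case by (simp add: poly_lift_pCons hom_mult r_distr m_lcomm)
  qed
  have mult: "?f (p * q) = ?f p \<otimes> ?f q" for p q
  proof (induction p)
    case 0
    then show ?case by (simp add: poly_lift_0)
  next
    case (pCons a p)
    have "?f (pCons a p * q) = h a \<otimes> ?f q \<oplus> (h 0 \<oplus> x \<otimes> ?f (p * q))"
      by (simp add: add smult poly_lift_pCons)
    then show ?case using pCons by (simp add: poly_lift_pCons hom_zero l_distr m_assoc)
  qed
  have one: "?f 1 = \<one>"
    by (simp add: one_pCons poly_lift_pCons poly_lift_0 hom_one)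
  show ?thesis
    by unfold_locales (auto simp: add mult one)
qed

lemma poly_lift_const: "x \<in> carrier S \<Longrightarrow> poly_lift S h x [:a:] = h a"
  by (simp add: poly_lift_pCons poly_lift_0)

lemma poly_lift_X: "x \<in> carrier S \<Longrightarrow> poly_lift S h x [:0, 1:] = x"
  by (simp add: poly_lift_pCons poly_lift_0 hom_one hom_zero)

end

lemma (in cring) type_hom_of_int: "type_hom R (\<lambda>k::int. [k] \<cdot> \<one>)"
proof
  fix x y :: int
  show "add_pow R x \<one> \<in> carrier R" by simp
  show "add_pow R (x + y) \<one> = add_pow R x \<one> \<oplus> add_pow R y \<one>"
    by (simp add: add.int_pow_mult)
  show "add_pow R (x * y) \<one> = add_pow R x \<one> \<otimes> add_pow R y \<one>"
    using add_pow_ldistr_int[of \<one> "add_pow R y \<one>" x] add.int_pow_pow[of \<one> x y]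
    by (simp add: mult.commute)
  show "add_pow R (1::int) \<one> = \<one>" by simp
qed

text \<open>Every finite field is a quotient of \<open>\<int>[x]\<close>, as its multiplicative group is cyclic. Polynomial
  identities between matrices over the field thus follow from the same identities over the type
  \<^typ>\<open>int poly\<close>.\<close>

lemma (in field) ex_surj_hom_int_poly:
  assumes "finite (carrier R)"
  shows "\<exists>f :: int poly \<Rightarrow> 'a. type_hom R f \<and> range f = carrier R"
proof -
  obtain g where g: "g \<in> carrier (Multiplicative_Group.mult_of R)"
    "carrier (Multiplicative_Group.mult_of R) = {g [^] i | i::nat. i \<in> UNIV}"
    using finite_field_mult_group_has_gen[OF assms] by (elim bexE)
  have gc: "g \<in> carrier R" using g(1) by (simp add: Multiplicative_Group.carrier_mult_of)
  interpret i: type_hom R "\<lambda>k::int. [k] \<cdot> \<one>" by (rule type_hom_of_int)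
  let ?f = "poly_lift R (\<lambda>k::int. [k] \<cdot> \<one>) g"
  interpret f: type_hom R ?f by (rule i.type_hom_poly_lift[OF gc])
  have "y \<in> range ?f" if y: "y \<in> carrier R" for y
  proof (cases "y = \<zero>")
    case True
    then show ?thesis using f.hom_zero by (metis rangeI)
  next
    case False
    then obtain i :: nat where "y = g [^] i"
      using y g(2) by (auto simp: Multiplicative_Group.carrier_mult_of)
    then have "?f ([:0, 1:] ^ i) = y"
      using f.hom_power[of "[:0, 1:]" i] i.poly_lift_X[OF gc] by simp
    then show ?thesis by (metis rangeI)
  qed
  then have "range ?f = carrier R" by auto
  then show ?thesis using f.type_hom_axioms by blast
qed

section \<open>Matrices over a ring record\<close>

definition M :: "('a, 'm) ring_scheme \<Rightarrow> nat \<Rightarrow> nat \<Rightarrow> 'a mat set" where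
  "M S k n = {A \<in> carrier_mat k n. \<forall>i<k. \<forall>j<n. A $$ (i, j) \<in> carrier S}"

definition mat_mul :: "('a, 'm) ring_scheme \<Rightarrow> 'a mat \<Rightarrow> 'a mat \<Rightarrow> 'a mat" where
  "mat_mul S A B = mat (dim_row A) (dim_col B)
     (\<lambda>(i, j). \<Oplus>\<^bsub>S\<^esub>k\<in>{0..<dim_row B}. A $$ (i, k) \<otimes>\<^bsub>S\<^esub> B $$ (k, j))"

definition mat_plus :: "('a, 'm) ring_scheme \<Rightarrow> 'a mat \<Rightarrow> 'a mat \<Rightarrow> 'a mat" where
  "mat_plus S A B = mat (dim_row A) (dim_col A) (\<lambda>ij. A $$ ij \<oplus>\<^bsub>S\<^esub> B $$ ij)"

definition mat_minus :: "('a, 'm) ring_scheme \<Rightarrow> 'a mat \<Rightarrow> 'a mat \<Rightarrow> 'a mat" where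
  "mat_minus S A B = mat (dim_row A) (dim_col A) (\<lambda>ij. A $$ ij \<ominus>\<^bsub>S\<^esub> B $$ ij)"

definition mat_scale :: "('a, 'm) ring_scheme \<Rightarrow> 'a \<Rightarrow> 'a mat \<Rightarrow> 'a mat" where
  "mat_scale S c A = mat (dim_row A) (dim_col A) (\<lambda>ij. c \<otimes>\<^bsub>S\<^esub> A $$ ij)"

definition mat_zero :: "('a, 'm) ring_scheme \<Rightarrow> nat \<Rightarrow> nat \<Rightarrow> 'a mat" where
  "mat_zero S k n = mat k n (\<lambda>_. \<zero>\<^bsub>S\<^esub>)"

abbreviation mat_one :: "('a, 'm) ring_scheme \<Rightarrow> nat \<Rightarrow> 'a mat" where
  "mat_one S n \<equiv> scalar_matrix S n \<one>\<^bsub>S\<^esub>"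

definition hcat :: "'a mat \<Rightarrow> 'a mat \<Rightarrow> 'a mat" where
  "hcat A B = mat (dim_row A) (dim_col A + dim_col B)
     (\<lambda>(i, j). if j < dim_col A then A $$ (i, j) else B $$ (i, j - dim_col A))"

definition vcat :: "'a mat \<Rightarrow> 'a mat \<Rightarrow> 'a mat" where
  "vcat A B = mat (dim_row A + dim_row B) (dim_col A)
     (\<lambda>(i, j). if i < dim_row A then A $$ (i, j) else B $$ (i - dim_row A, j))"

lemma M_I: "A \<in> carrier_mat k n \<Longrightarrow> (\<And>i j. i < k \<Longrightarrow> j < n \<Longrightarrow> A $$ (i, j) \<in> carrier S) \<Longrightarrow> A \<in> M S k n"
  by (simp add: M_def)

lemma M_dim: "A \<in> M S k n \<Longrightarrow> dim_row A = k" "A \<in> M S k n \<Longrightarrow> dim_col A = n"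
  by (auto simp: M_def)

lemma M_entry: "A \<in> M S k n \<Longrightarrow> i < k \<Longrightarrow> j < n \<Longrightarrow> A $$ (i, j) \<in> carrier S"
  by (auto simp: M_def)

lemma M_eqI:
  assumes "A \<in> M S k n" "B \<in> M S k n" "\<And>i j. i < k \<Longrightarrow> j < n \<Longrightarrow> A $$ (i, j) = B $$ (i, j)"
  shows "A = B"
  using assms by (intro eq_matI) (auto simp: M_dim)

lemma hcat_M [simp]: "A \<in> M S k a \<Longrightarrow> B \<in> M S k b \<Longrightarrow> hcat A B \<in> M S k (a + b)"
  by (intro M_I) (auto simp: hcat_def M_dim M_entry)

lemma vcat_M [simp]: "A \<in> M S a n \<Longrightarrow> B \<in> M S b n \<Longrightarrow> vcat A B \<in> M S (a + b) n"
  by (intro M_I) (auto simp: vcat_def M_dim M_entry)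

lemma hcat_inj:
  assumes "A \<in> M S k a" "B \<in> M S k b" "A' \<in> M S k a" "B' \<in> M S k b"
  shows "hcat A B = hcat A' B' \<longleftrightarrow> A = A' \<and> B = B'"
proof
  assume eq: "hcat A B = hcat A' B'"
  have "A $$ (i, j) = A' $$ (i, j)" if "i < k" "j < a" for i j
    using arg_cong[OF eq, of "\<lambda>Z. Z $$ (i, j)"] that assms by (simp add: hcat_def M_dim)
  moreover have "B $$ (i, j) = B' $$ (i, j)" if "i < k" "j < b" for i j
    using arg_cong[OF eq, of "\<lambda>Z. Z $$ (i, j + a)"] that assms by (simp add: hcat_def M_dim)
  ultimately show "A = A' \<and> B = B'" using assms by (meson M_eqI)
qed auto

lemma vcat_inj:
  assumes "A \<in> M S a n" "B \<in> M S b n" "A' \<in> M S a n" "B' \<in> M S b n"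
  shows "vcat A B = vcat A' B' \<longleftrightarrow> A = A' \<and> B = B'"
proof
  assume eq: "vcat A B = vcat A' B'"
  have "A $$ (i, j) = A' $$ (i, j)" if "i < a" "j < n" for i j
    using arg_cong[OF eq, of "\<lambda>Z. Z $$ (i, j)"] that assms by (simp add: vcat_def M_dim)
  moreover have "B $$ (i, j) = B' $$ (i, j)" if "i < b" "j < n" for i j
    using arg_cong[OF eq, of "\<lambda>Z. Z $$ (i + a, j)"] that assms by (simp add: vcat_def M_dim)
  ultimately show "A = A' \<and> B = B'" using assms by (meson M_eqI)
qed auto

lemma hcat_cases:
  assumes "A \<in> M S k (a + b)"
  obtains B C where "B \<in> M S k a" "C \<in> M S k b" "A = hcat B C"
proof
  show "mat k a (\<lambda>(i, j). A $$ (i, j)) \<in> M S k a" "mat k b (\<lambda>(i, j). A $$ (i, j + a)) \<in> M S k b"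
    using assms by (auto simp: M_def)
  show "A = hcat (mat k a (\<lambda>(i, j). A $$ (i, j))) (mat k b (\<lambda>(i, j). A $$ (i, j + a)))"
    using assms by (intro eq_matI) (auto simp: hcat_def M_dim)
qed

lemma vcat_cases:
  assumes "A \<in> M S (a + b) n"
  obtains B C where "B \<in> M S a n" "C \<in> M S b n" "A = vcat B C"
proof
  show "mat a n (\<lambda>(i, j). A $$ (i, j)) \<in> M S a n" "mat b n (\<lambda>(i, j). A $$ (i + a, j)) \<in> M S b n"
    using assms by (auto simp: M_def)
  show "A = vcat (mat a n (\<lambda>(i, j). A $$ (i, j))) (mat b n (\<lambda>(i, j). A $$ (i + a, j)))"
    using assms by (intro eq_matI) (auto simp: vcat_def M_dim)
qed

lemma map_mat_hcat:
  "A \<in> carrier_mat k a \<Longrightarrow> B \<in> carrier_mat k b \<Longrightarrow> map_mat f (hcat A B) = hcat (map_mat f A) (map_mat f B)"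
  by (intro eq_matI) (auto simp: hcat_def)

lemma map_mat_vcat:
  "A \<in> carrier_mat a n \<Longrightarrow> B \<in> carrier_mat b n \<Longrightarrow> map_mat f (vcat A B) = vcat (map_mat f A) (map_mat f B)"
  by (intro eq_matI) (auto simp: vcat_def)

context type_hom
begin

lemma map_mat_M: "A \<in> carrier_mat k n \<Longrightarrow> map_mat h A \<in> M S k n"
  by (auto simp: M_def)

lemma map_mat_mult:
  assumes "A \<in> carrier_mat k l" "B \<in> carrier_mat l n"
  shows "map_mat h (A * B) = mat_mul S (map_mat h A) (map_mat h B)"
proof (rule eq_matI)
  fix i j assume "i < dim_row (mat_mul S (map_mat h A) (map_mat h B))" "j < dim_col (mat_mul S (map_mat h A) (map_mat h B))"
  then have ij: "i < k" "j < n" using assms by (auto simp: mat_mul_def)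
  have "h ((A * B) $$ (i, j)) = (\<Oplus>m\<in>{0..<l}. h (A $$ (i, m)) \<otimes> h (B $$ (m, j)))"
    using assms ij by (simp add: scalar_prod_def hom_sum hom_mult)
  also have "\<dots> = (\<Oplus>m\<in>{0..<l}. map_mat h A $$ (i, m) \<otimes> map_mat h B $$ (m, j))"
    using assms ij by (intro finsum_cong') auto
  finally show "map_mat h (A * B) $$ (i, j) = mat_mul S (map_mat h A) (map_mat h B) $$ (i, j)"
    using assms ij by (simp add: mat_mul_def)
qed (use assms in \<open>auto simp: mat_mul_def\<close>)

lemma map_mat_add:
  "A \<in> carrier_mat k n \<Longrightarrow> B \<in> carrier_mat k n \<Longrightarrow> map_mat h (A + B) = mat_plus S (map_mat h A) (map_mat h B)"
  by (intro eq_matI) (auto simp: mat_plus_def hom_add)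

lemma map_mat_minus:
  "A \<in> carrier_mat k n \<Longrightarrow> B \<in> carrier_mat k n \<Longrightarrow> map_mat h (A - B) = mat_minus S (map_mat h A) (map_mat h B)"
  by (intro eq_matI) (auto simp: mat_minus_def hom_minus)

lemma map_mat_smult: "map_mat h (c \<cdot>\<^sub>m A) = mat_scale S (h c) (map_mat h A)"
  by (intro eq_matI) (auto simp: mat_scale_def hom_mult)

lemma map_mat_zero: "map_mat h (0\<^sub>m k n) = mat_zero S k n"
  by (intro eq_matI) (auto simp: mat_zero_def hom_zero)

lemma map_mat_scalar: "map_mat h (c \<cdot>\<^sub>m 1\<^sub>m n) = scalar_matrix S n (h c)"
  by (intro eq_matI) (auto simp: scalar_matrix_def hom_zero)

lemma map_mat_one: "map_mat h (1\<^sub>m n) = mat_one S n"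
  by (intro eq_matI) (auto simp: scalar_matrix_def hom_zero hom_one)

end

lemma hcat_carrier: "A \<in> carrier_mat k a \<Longrightarrow> B \<in> carrier_mat k b \<Longrightarrow> hcat A B \<in> carrier_mat k (a + b)"
  by (intro carrier_matI) (auto simp: hcat_def)

lemma vcat_carrier: "A \<in> carrier_mat a n \<Longrightarrow> B \<in> carrier_mat b n \<Longrightarrow> vcat A B \<in> carrier_mat (a + b) n"
  by (intro carrier_matI) (auto simp: vcat_def)

lemma sum_nat_add_split:
  fixes f :: "nat \<Rightarrow> 'b::comm_monoid_add"
  shows "(\<Sum>i = 0..<a + b. f i) = (\<Sum>i = 0..<a. f i) + (\<Sum>i = 0..<b. f (i + a))"
proof -
  have "(\<Sum>i = 0..<a + b. f i) = (\<Sum>i = 0..<a. f i) + (\<Sum>i = a..<a + b. f i)"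
    by (simp add: sum.atLeastLessThan_concat)
  then show ?thesis using sum.shift_bounds_nat_ivl[of f 0 a b] by (simp add: add.commute)
qed

lemma hcat_mult_vcat:
  fixes A :: "'b::comm_ring_1 mat"
  assumes "A \<in> carrier_mat k a" "B \<in> carrier_mat k b" "C \<in> carrier_mat a n" "D \<in> carrier_mat b n"
  shows "hcat A B * vcat C D = A * C + B * D"
proof (rule eq_matI)
  fix i j assume "i < dim_row (A * C + B * D)" "j < dim_col (A * C + B * D)"
  then have ij: "i < k" "j < n" using assms by auto
  show "(hcat A B * vcat C D) $$ (i, j) = (A * C + B * D) $$ (i, j)"
    using assms ij by (simp add: hcat_def vcat_def scalar_prod_def sum_nat_add_split)
qed (use assms in \<open>auto simp: hcat_def vcat_def\<close>)

text \<open>\<open>phi\<close> is a parameter and not a choice made inside each proof, so that all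
  lifts go through one homomorphism. Nothing is assumed about its kernel: a lift consists of
  arbitrary preimages of the entries.\<close>

locale finite_field = field F + phi: type_hom F phi
  for F :: "'a ring" (structure) and phi :: "int poly \<Rightarrow> 'a" +
  assumes range_phi: "range phi = carrier F"
    and fin: "finite (carrier F)"
begin

abbreviation mul (infixl "\<star>" 70) where "A \<star> B \<equiv> mat_mul F A B"
abbreviation plus' (infixl "\<boxplus>" 65) where "A \<boxplus> B \<equiv> mat_plus F A B"
abbreviation minus' (infixl "\<boxminus>" 65) where "A \<boxminus> B \<equiv> mat_minus F A B"
abbreviation K :: "nat \<Rightarrow> nat \<Rightarrow> 'a mat set" where "K \<equiv> M F"
abbreviation I :: "nat \<Rightarrow> 'a mat" where "I \<equiv> mat_one F"
abbreviation Z :: "nat \<Rightarrow> nat \<Rightarrow> 'a mat" where "Z \<equiv> mat_zero F"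
abbreviation sc :: "'a \<Rightarrow> 'a mat \<Rightarrow> 'a mat" where "sc \<equiv> mat_scale F"

lemma lift_elem: "c \<in> carrier F \<Longrightarrow> \<exists>p. c = phi p"
  using range_phi by auto

lemma lift:
  assumes "A \<in> K k n"
  obtains A' where "A' \<in> carrier_mat k n" "A = map_mat phi A'"
proof
  let ?g = "\<lambda>c. SOME p. c = phi p"
  have g: "c = phi (?g c)" if "c \<in> carrier F" for c using lift_elem[OF that] by (rule someI_ex)
  show "map_mat ?g A \<in> carrier_mat k n" using assms by (auto simp: M_def)
  show "A = map_mat phi (map_mat ?g A)"
    using assms by (intro eq_matI) (auto simp: M_dim intro!: g intro: M_entry)
qed

lemma mul_K [simp]: "A \<in> K k l \<Longrightarrow> B \<in> K l n \<Longrightarrow> A \<star> B \<in> K k n"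
  by (intro M_I) (auto simp: mat_mul_def M_dim intro!: finsum_closed M_entry)

lemma plus_K [simp]: "A \<in> K k n \<Longrightarrow> B \<in> K k n \<Longrightarrow> A \<boxplus> B \<in> K k n"
  by (intro M_I) (auto simp: mat_plus_def M_dim M_entry)

lemma minus_K [simp]: "A \<in> K k n \<Longrightarrow> B \<in> K k n \<Longrightarrow> A \<boxminus> B \<in> K k n"
  by (intro M_I) (auto simp: mat_minus_def M_dim M_entry)

lemma sc_K [simp]: "c \<in> carrier F \<Longrightarrow> A \<in> K k n \<Longrightarrow> sc c A \<in> K k n"
  by (intro M_I) (auto simp: mat_scale_def M_dim M_entry)

lemma Z_K [simp]: "Z k n \<in> K k n"
  by (intro M_I) (auto simp: mat_zero_def)

lemma scalar_K [simp]: "c \<in> carrier F \<Longrightarrow> scalar_matrix F n c \<in> K n n"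
  by (intro M_I) (auto simp: scalar_matrix_def)

text \<open>Model for the transport lemmas below: lift the entries, apply the law for matrices over
  the type \<open>int poly\<close>, and push it back along \<open>phi\<close>.\<close>

lemma mul_assoc:
  assumes "A \<in> K k l" "B \<in> K l m" "C \<in> K m n"
  shows "A \<star> B \<star> C = A \<star> (B \<star> C)"
proof -
  obtain A' B' C' where c: "A' \<in> carrier_mat k l" "B' \<in> carrier_mat l m" "C' \<in> carrier_mat m n"
    and e: "A = map_mat phi A'" "B = map_mat phi B'" "C = map_mat phi C'"
    using assms by (metis lift)
  show ?thesis
    using phi.map_mat_mult[OF c(1,2)] phi.map_mat_mult[OF c(2,3)]
      phi.map_mat_mult[OF mult_carrier_mat[OF c(1,2)] c(3)]
      phi.map_mat_mult[OF c(1) mult_carrier_mat[OF c(2,3)]] assoc_mult_mat[OF c] e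
    by simp
qed

lemma mul_plus:
  assumes "A \<in> K k l" "B \<in> K l n" "C \<in> K l n"
  shows "A \<star> (B \<boxplus> C) = A \<star> B \<boxplus> A \<star> C"
proof -
  obtain A' B' C' where c: "A' \<in> carrier_mat k l" "B' \<in> carrier_mat l n" "C' \<in> carrier_mat l n"
    and e: "A = map_mat phi A'" "B = map_mat phi B'" "C = map_mat phi C'"
    using assms by (metis lift)
  show ?thesis
    using phi.map_mat_mult[OF c(1,2)] phi.map_mat_mult[OF c(1,3)] phi.map_mat_add[OF c(2,3)]
      phi.map_mat_mult[OF c(1) add_carrier_mat[OF c(3), of B']] mult_add_distrib_mat[OF c]
      phi.map_mat_add[OF mult_carrier_mat[OF c(1,2)] mult_carrier_mat[OF c(1,3)]] e
    by simp
qed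

lemma plus_mul:
  assumes "B \<in> K k l" "C \<in> K k l" "A \<in> K l n"
  shows "(B \<boxplus> C) \<star> A = B \<star> A \<boxplus> C \<star> A"
proof -
  obtain A' B' C' where c: "A' \<in> carrier_mat l n" "B' \<in> carrier_mat k l" "C' \<in> carrier_mat k l"
    and e: "A = map_mat phi A'" "B = map_mat phi B'" "C = map_mat phi C'"
    using assms by (metis lift)
  show ?thesis
    using phi.map_mat_mult[OF c(2,1)] phi.map_mat_mult[OF c(3,1)] phi.map_mat_add[OF c(2,3)]
      phi.map_mat_mult[OF add_carrier_mat[OF c(3), of B'] c(1)] add_mult_distrib_mat[OF c(2,3,1)]
      phi.map_mat_add[OF mult_carrier_mat[OF c(2,1)] mult_carrier_mat[OF c(3,1)]] e
    by simp
qed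

lemma mul_minus:
  assumes "A \<in> K k l" "B \<in> K l n" "C \<in> K l n"
  shows "A \<star> (B \<boxminus> C) = A \<star> B \<boxminus> A \<star> C"
proof -
  obtain A' B' C' where c: "A' \<in> carrier_mat k l" "B' \<in> carrier_mat l n" "C' \<in> carrier_mat l n"
    and e: "A = map_mat phi A'" "B = map_mat phi B'" "C = map_mat phi C'"
    using assms by (metis lift)
  show ?thesis
    using phi.map_mat_mult[OF c(1,2)] phi.map_mat_mult[OF c(1,3)] phi.map_mat_minus[OF c(2,3)]
      phi.map_mat_mult[OF c(1) minus_carrier_mat[OF c(3), of B']] mult_minus_distrib_mat[OF c]
      phi.map_mat_minus[OF mult_carrier_mat[OF c(1,2)] mult_carrier_mat[OF c(1,3)]] e
    by simp
qed

lemma minus_mul: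
  assumes "B \<in> K k l" "C \<in> K k l" "A \<in> K l n"
  shows "(B \<boxminus> C) \<star> A = B \<star> A \<boxminus> C \<star> A"
proof -
  obtain A' B' C' where c: "A' \<in> carrier_mat l n" "B' \<in> carrier_mat k l" "C' \<in> carrier_mat k l"
    and e: "A = map_mat phi A'" "B = map_mat phi B'" "C = map_mat phi C'"
    using assms by (metis lift)
  show ?thesis
    using phi.map_mat_mult[OF c(2,1)] phi.map_mat_mult[OF c(3,1)] phi.map_mat_minus[OF c(2,3)]
      phi.map_mat_mult[OF minus_carrier_mat[OF c(3), of B'] c(1)] minus_mult_distrib_mat[OF c(2,3,1)]
      phi.map_mat_minus[OF mult_carrier_mat[OF c(2,1)] mult_carrier_mat[OF c(3,1)]] e
    by simp
qed

lemma mul_sc: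
  assumes "c \<in> carrier F" "A \<in> K k l" "B \<in> K l n"
  shows "A \<star> sc c B = sc c (A \<star> B)" "sc c A \<star> B = sc c (A \<star> B)"
proof -
  obtain c' A' B' where c: "A' \<in> carrier_mat k l" "B' \<in> carrier_mat l n"
    and e: "A = map_mat phi A'" "B = map_mat phi B'" "c = phi c'"
    using assms by (metis lift lift_elem)
  have c': "c' \<cdot>\<^sub>m A' \<in> carrier_mat k l" "c' \<cdot>\<^sub>m B' \<in> carrier_mat l n" using c by auto
  show "A \<star> sc c B = sc c (A \<star> B)"
    using phi.map_mat_mult[OF c] phi.map_mat_mult[OF c(1) c'(2)] mult_smult_distrib[OF c, of c'] e
    by (simp add: phi.map_mat_smult)
  show "sc c A \<star> B = sc c (A \<star> B)"
    using phi.map_mat_mult[OF c] phi.map_mat_mult[OF c'(1) c(2)] mult_smult_assoc_mat[OF c, of c'] e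
    by (simp add: phi.map_mat_smult)
qed

lemma scalar_mul:
  assumes "c \<in> carrier F" "A \<in> K k n"
  shows "scalar_matrix F k c \<star> A = sc c A" "A \<star> scalar_matrix F n c = sc c A"
proof -
  obtain c' A' where c: "A' \<in> carrier_mat k n" and e: "A = map_mat phi A'" "c = phi c'"
    using assms by (metis lift lift_elem)
  have i: "c' \<cdot>\<^sub>m 1\<^sub>m n \<in> carrier_mat n n" for n by simp
  show "scalar_matrix F k c \<star> A = sc c A"
    unfolding e phi.map_mat_scalar[symmetric] phi.map_mat_smult[symmetric] phi.map_mat_mult[OF i c, symmetric]
    using c mult_smult_assoc_mat[of "1\<^sub>m k" k k A' n c'] by simp
  show "A \<star> scalar_matrix F n c = sc c A"
    unfolding e phi.map_mat_scalar[symmetric] phi.map_mat_smult[symmetric] phi.map_mat_mult[OF c i, symmetric]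
    using c mult_smult_distrib[of A' k n "1\<^sub>m n" n c'] by simp
qed

lemma sc_one [simp]: "A \<in> K k n \<Longrightarrow> sc \<one> A = A"
  by (intro eq_matI) (auto simp: mat_scale_def M_dim M_entry)

lemma sc_zero [simp]: "A \<in> K k n \<Longrightarrow> sc \<zero> A = Z k n"
  by (intro eq_matI) (auto simp: mat_scale_def mat_zero_def M_dim M_entry)

lemma sc_sc: "c \<in> carrier F \<Longrightarrow> d \<in> carrier F \<Longrightarrow> A \<in> K k n \<Longrightarrow> sc c (sc d A) = sc (c \<otimes> d) A"
  by (intro eq_matI) (auto simp: mat_scale_def M_dim M_entry m_assoc)

lemma sc_Z [simp]: "c \<in> carrier F \<Longrightarrow> sc c (Z k n) = Z k n"
  by (intro eq_matI) (auto simp: mat_scale_def mat_zero_def)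

lemma sc_plus:
  "c \<in> carrier F \<Longrightarrow> A \<in> K k n \<Longrightarrow> B \<in> K k n \<Longrightarrow> sc c (A \<boxplus> B) = sc c A \<boxplus> sc c B"
  by (intro eq_matI) (auto simp: mat_scale_def mat_plus_def M_dim M_entry r_distr)

lemma I_mul [simp]: "A \<in> K k n \<Longrightarrow> I k \<star> A = A" "A \<in> K k n \<Longrightarrow> A \<star> I n = A"
  by (simp_all add: scalar_mul)

lemma Z_mul [simp]:
  assumes "A \<in> K k n"
  shows "Z l k \<star> A = Z l n" "A \<star> Z n l = Z k l"
proof -
  \<comment> \<open>The zero matrix is its own multiple by \<zero>, and a scalar can be pulled out
    of a product.\<close>
  have "Z l k \<star> A = sc \<zero> (Z l k \<star> A)" using assms mul_sc(2)[of \<zero> "Z l k" l k A n] by simp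
  then show "Z l k \<star> A = Z l n" using assms by (metis mul_K Z_K sc_zero)
  have "A \<star> Z n l = sc \<zero> (A \<star> Z n l)" using assms mul_sc(1)[of \<zero> A k n "Z n l" l] by simp
  then show "A \<star> Z n l = Z k l" using assms by (metis mul_K Z_K sc_zero)
qed

lemma plus_Z [simp]: "A \<in> K k n \<Longrightarrow> A \<boxplus> Z k n = A" "A \<in> K k n \<Longrightarrow> Z k n \<boxplus> A = A"
  by (intro eq_matI; auto simp: mat_plus_def mat_zero_def M_dim M_entry)+

lemma minus_Z [simp]: "A \<in> K k n \<Longrightarrow> A \<boxminus> Z k n = A"
  by (intro eq_matI) (auto simp: mat_minus_def mat_zero_def M_dim M_entry a_minus_def)

lemma minus_eq_Z_iff: "A \<in> K k n \<Longrightarrow> B \<in> K k n \<Longrightarrow> A \<boxminus> B = Z k n \<longleftrightarrow> A = B"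
proof
  assume AB: "A \<in> K k n" "B \<in> K k n" and eq: "A \<boxminus> B = Z k n"
  show "A = B"
  proof (rule M_eqI[OF AB])
    fix i j assume ij: "i < k" "j < n"
    have "(A \<boxminus> B) $$ (i, j) = \<zero>" using eq ij by (simp add: mat_zero_def)
    then show "A $$ (i, j) = B $$ (i, j)"
      using AB ij M_entry[OF AB(1) ij] M_entry[OF AB(2) ij] by (simp add: mat_minus_def M_dim)
  qed
next
  assume "A \<in> K k n" "B \<in> K k n" "A = B"
  then show "A \<boxminus> B = Z k n" by (intro eq_matI) (auto simp: mat_minus_def mat_zero_def M_dim M_entry)
qed

lemma minus_plus_cancel: "A \<in> K k n \<Longrightarrow> B \<in> K k n \<Longrightarrow> A \<boxminus> B \<boxplus> B = A"
  by (intro eq_matI) (auto simp: mat_minus_def mat_plus_def M_dim M_entry a_minus_def a_assoc l_neg)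

lemma plus_minus_cancel: "A \<in> K k n \<Longrightarrow> B \<in> K k n \<Longrightarrow> A \<boxplus> B \<boxminus> B = A"
  by (intro eq_matI) (auto simp: mat_minus_def mat_plus_def M_dim M_entry a_minus_def a_assoc r_neg)

lemma plus_comm: "A \<in> K k n \<Longrightarrow> B \<in> K k n \<Longrightarrow> A \<boxplus> B = B \<boxplus> A"
  by (intro eq_matI) (auto simp: mat_plus_def M_dim M_entry a_comm)

lemma plus_assoc: "A \<in> K k n \<Longrightarrow> B \<in> K k n \<Longrightarrow> C \<in> K k n \<Longrightarrow> A \<boxplus> B \<boxplus> C = A \<boxplus> (B \<boxplus> C)"
  by (intro eq_matI) (auto simp: mat_plus_def M_dim M_entry a_assoc)

lemma hcat_plus:
  "A \<in> K k a \<Longrightarrow> B \<in> K k b \<Longrightarrow> A' \<in> K k a \<Longrightarrow> B' \<in> K k b \<Longrightarrow>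
    hcat A B \<boxplus> hcat A' B' = hcat (A \<boxplus> A') (B \<boxplus> B')"
  by (intro eq_matI) (auto simp: mat_plus_def hcat_def M_dim)

lemma hcat_sc: "A \<in> K k a \<Longrightarrow> B \<in> K k b \<Longrightarrow> sc c (hcat A B) = hcat (sc c A) (sc c B)"
  by (intro eq_matI) (auto simp: mat_scale_def hcat_def M_dim)

lemma hcat_Z: "hcat (Z k a) (Z k b) = Z k (a + b)"
  by (intro eq_matI) (auto simp: mat_zero_def hcat_def)

lemma mul_hcat:
  assumes "A \<in> K k l" "B \<in> K l a" "C \<in> K l b"
  shows "A \<star> hcat B C = hcat (A \<star> B) (A \<star> C)"
proof (rule eq_matI)
  fix i j assume "i < dim_row (hcat (A \<star> B) (A \<star> C))" "j < dim_col (hcat (A \<star> B) (A \<star> C))"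
  then have ij: "i < k" "j < a + b" using assms by (auto simp: hcat_def mat_mul_def M_dim)
  show "(A \<star> hcat B C) $$ (i, j) = hcat (A \<star> B) (A \<star> C) $$ (i, j)"
    using assms ij M_entry[OF assms(1)] M_entry[OF assms(2)] M_entry[OF assms(3)]
    by (auto simp: hcat_def mat_mul_def M_dim intro!: finsum_cong')
qed (use assms in \<open>auto simp: hcat_def mat_mul_def M_dim\<close>)

lemma vcat_mul:
  assumes "A \<in> K a l" "B \<in> K b l" "C \<in> K l n"
  shows "vcat A B \<star> C = vcat (A \<star> C) (B \<star> C)"
proof (rule eq_matI)
  fix i j assume "i < dim_row (vcat (A \<star> C) (B \<star> C))" "j < dim_col (vcat (A \<star> C) (B \<star> C))"
  then have ij: "i < a + b" "j < n" using assms by (auto simp: vcat_def mat_mul_def M_dim)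
  show "(vcat A B \<star> C) $$ (i, j) = vcat (A \<star> C) (B \<star> C) $$ (i, j)"
    using assms ij M_entry[OF assms(1)] M_entry[OF assms(2)] M_entry[OF assms(3)]
    by (auto simp: vcat_def mat_mul_def M_dim intro!: finsum_cong')
qed (use assms in \<open>auto simp: vcat_def mat_mul_def M_dim\<close>)

lemma hcat_mul_vcat:
  assumes "A \<in> K k a" "B \<in> K k b" "C \<in> K a n" "D \<in> K b n"
  shows "hcat A B \<star> vcat C D = A \<star> C \<boxplus> B \<star> D"
proof -
  obtain A' B' C' D' where c: "A' \<in> carrier_mat k a" "B' \<in> carrier_mat k b"
      "C' \<in> carrier_mat a n" "D' \<in> carrier_mat b n"
    and e: "A = map_mat phi A'" "B = map_mat phi B'" "C = map_mat phi C'" "D = map_mat phi D'"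
    using assms by (metis lift)
  show ?thesis
    using hcat_mult_vcat[OF c] phi.map_mat_mult[OF hcat_carrier[OF c(1,2)] vcat_carrier[OF c(3,4)]]
      phi.map_mat_add[OF mult_carrier_mat[OF c(1,3)] mult_carrier_mat[OF c(2,4)]]
      phi.map_mat_mult[OF c(1,3)] phi.map_mat_mult[OF c(2,4)] e
    by (simp add: map_mat_hcat[OF c(1,2)] map_mat_vcat[OF c(3,4)])
qed

end

text \<open>Row vectors are matrices with \<open>1\<close> row; the simplifier must not turn this \<open>1\<close> into \<open>Suc 0\<close>.\<close>

declare One_nat_def [simp del]

context finite_field
begin

section \<open>Row rank and invertible matrices\<close>

abbreviation q :: nat where "q \<equiv> card (carrier F)"

lemma q_ge_2: "2 \<le> q"
proof -
  have "card {\<zero>, \<one>} \<le> q" using fin by (intro card_mono) auto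
  then show ?thesis using one_not_zero by auto
qed

lemma card_K: "finite (K k n)" "card (K k n) = q ^ (k * n)"
proof -
  let ?A = "{..<k} \<times> {..<n}"
  let ?f = "\<lambda>A. restrict (\<lambda>ij. A $$ ij) ?A"
  have bij: "bij_betw ?f (K k n) (?A \<rightarrow>\<^sub>E carrier F)"
  proof (rule bij_betw_byWitness[where f' = "\<lambda>g. mat k n g"])
    show "\<forall>A\<in>K k n. mat k n (?f A) = A" by (auto intro!: eq_matI simp: M_dim)
    show "\<forall>g\<in>?A \<rightarrow>\<^sub>E carrier F. ?f (mat k n g) = g"
    proof
      fix g assume g: "g \<in> ?A \<rightarrow>\<^sub>E carrier F"
      show "?f (mat k n g) = g"
      proof
        fix ij show "?f (mat k n g) ij = g ij"
          using PiE_arb[OF g, of ij] by (cases ij) (auto simp: restrict_def)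
      qed
    qed
    show "?f ` K k n \<subseteq> ?A \<rightarrow>\<^sub>E carrier F"
    proof (intro image_subsetI)
      fix A assume "A \<in> K k n"
      then show "?f A \<in> ?A \<rightarrow>\<^sub>E carrier F" unfolding restrict_PiE_iff using M_entry by fastforce
    qed
    show "(\<lambda>g. mat k n g) ` (?A \<rightarrow>\<^sub>E carrier F) \<subseteq> K k n" by (auto intro!: M_I)
  qed
  have "finite (?A \<rightarrow>\<^sub>E carrier F)" using fin by (intro finite_PiE) auto
  then show "finite (K k n)" using bij bij_betw_finite by blast
  show "card (K k n) = q ^ (k * n)"
    using bij_betw_same_card[OF bij] by (simp add: card_PiE)
qed

definition row_mat :: "'a mat \<Rightarrow> nat \<Rightarrow> 'a mat" where
  "row_mat A i = mat 1 (dim_col A) (\<lambda>(_, j). A $$ (i, j))"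

lemma row_mat_K: "A \<in> K k n \<Longrightarrow> i < k \<Longrightarrow> row_mat A i \<in> K 1 n"
  by (intro M_I) (auto simp: row_mat_def M_dim M_entry)

lemma row_mat_mul: "A \<in> K k l \<Longrightarrow> B \<in> K l n \<Longrightarrow> i < k \<Longrightarrow> row_mat (A \<star> B) i = row_mat A i \<star> B"
  by (intro eq_matI) (auto simp: row_mat_def mat_mul_def M_dim M_entry intro!: finsum_cong')

lemma row_mat_sc: "A \<in> K k n \<Longrightarrow> i < k \<Longrightarrow> row_mat (sc c A) i = sc c (row_mat A i)"
  by (intro eq_matI) (auto simp: row_mat_def mat_scale_def M_dim)

lemma row_mat_eqI:
  assumes "A \<in> K k n" "B \<in> K k n" "\<And>i. i < k \<Longrightarrow> row_mat A i = row_mat B i"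
  shows "A = B"
proof (rule M_eqI[OF assms(1,2)])
  fix i j assume ij: "i < k" "j < n"
  show "A $$ (i, j) = B $$ (i, j)"
    using arg_cong[OF assms(3)[OF ij(1)], of "\<lambda>Z. Z $$ (0, j)"] assms(1,2) ij by (simp add: row_mat_def M_dim)
qed

lemma row_mat_Z: "i < k \<Longrightarrow> row_mat (Z k n) i = Z 1 n"
  by (intro eq_matI) (auto simp: row_mat_def mat_zero_def)

lemma ex_of_rows:
  assumes "\<And>i. i < k \<Longrightarrow> f i \<in> K 1 n"
  obtains A where "A \<in> K k n" "\<And>i. i < k \<Longrightarrow> row_mat A i = f i"
proof
  let ?A = "mat k n (\<lambda>(i, j). f i $$ (0, j))"
  show "?A \<in> K k n" using M_entry[OF assms] by (intro M_I) auto
  show "row_mat ?A i = f i" if "i < k" for i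
    using M_dim[OF assms[OF that]] that by (intro eq_matI) (auto simp: row_mat_def)
qed

lemma K11: "d \<in> K 1 1 \<Longrightarrow> d = scalar_matrix F 1 (d $$ (0, 0))"
  by (intro eq_matI) (auto simp: scalar_matrix_def M_dim)

text \<open>Independence of the rows, phrased by the left kernel because vectors multiply from the
  left. For k = m these matrices form the general linear group (\<open>Units_MR\<close>).\<close>

definition full_rank :: "nat \<Rightarrow> nat \<Rightarrow> 'a mat set" where
  "full_rank k m = {A \<in> K k m. \<forall>c\<in>K 1 k. c \<star> A = Z 1 m \<longrightarrow> c = Z 1 k}"

definition row_span :: "'a mat \<Rightarrow> 'a mat set" where
  "row_span A = (\<lambda>c. c \<star> A) ` K 1 (dim_row A)"

lemma full_rank_K [simp]: "A \<in> full_rank k m \<Longrightarrow> A \<in> K k m"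
  by (simp add: full_rank_def)

lemma full_rank_I: "A \<in> K k m \<Longrightarrow> (\<And>c. c \<in> K 1 k \<Longrightarrow> c \<star> A = Z 1 m \<Longrightarrow> c = Z 1 k) \<Longrightarrow> A \<in> full_rank k m"
  unfolding full_rank_def by blast

lemma full_rank_D: "A \<in> full_rank k m \<Longrightarrow> c \<in> K 1 k \<Longrightarrow> c \<star> A = Z 1 m \<Longrightarrow> c = Z 1 k"
  unfolding full_rank_def by blast

lemma full_rank_cancel_Z:
  assumes "A \<in> full_rank k m" "B \<in> K l k" "B \<star> A = Z l m"
  shows "B = Z l k"
proof (rule row_mat_eqI[OF assms(2)])
  fix i assume i: "i < l"
  have "row_mat B i \<star> A = Z 1 m" using row_mat_mul[OF assms(2) full_rank_K[OF assms(1)] i] assms(3) row_mat_Z[OF i] by simp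
  then show "row_mat B i = row_mat (Z l k) i"
    using full_rank_D[OF assms(1) row_mat_K[OF assms(2) i]] row_mat_Z[OF i] by simp
qed simp

lemma full_rank_cancel:
  assumes "A \<in> full_rank k m" "B \<in> K l k" "C \<in> K l k" "B \<star> A = C \<star> A"
  shows "B = C"
proof -
  have "(B \<boxminus> C) \<star> A = Z l m"
    using assms minus_mul[of B l k C A m] minus_eq_Z_iff[of "B \<star> A" l m "C \<star> A"] by simp
  then have "B \<boxminus> C = Z l k" using full_rank_cancel_Z assms by (meson minus_K)
  then show ?thesis using assms minus_eq_Z_iff by simp
qed

lemma full_rank_of_right_inverse:
  assumes "A \<in> K k m" "B \<in> K m k" "A \<star> B = I k"
  shows "A \<in> full_rank k m"
proof -
  have "c = Z 1 k" if "c \<in> K 1 k" "c \<star> A = Z 1 m" for c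
    using that assms mul_assoc[of c 1 k A m B k] by simp
  then show ?thesis using assms(1) full_rank_I by blast
qed

lemma row_span_sub: "A \<in> K k m \<Longrightarrow> row_span A \<subseteq> K 1 m"
  by (auto simp: row_span_def M_dim)

lemma card_row_span: "A \<in> full_rank k m \<Longrightarrow> card (row_span A) = q ^ k"
proof -
  assume A: "A \<in> full_rank k m"
  have "inj_on (\<lambda>c. c \<star> A) (K 1 k)" using full_rank_cancel[OF A] by (auto intro!: inj_onI)
  then show ?thesis using A by (simp add: row_span_def M_dim[OF full_rank_K] card_image card_K)
qed

text \<open>The row space has q^k elements and lies in a set of q^m elements. Dimension is measured
  by counting here and below.\<close>

lemma full_rank_le: "A \<in> full_rank k m \<Longrightarrow> k \<le> m"
proof -
  assume A: "A \<in> full_rank k m"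
  have "q ^ k \<le> q ^ m" using card_row_span[OF A] card_mono[OF card_K(1) row_span_sub[OF full_rank_K[OF A]]] card_K(2)[of 1 m] by simp
  then show ?thesis using q_ge_2 by (simp add: power_le_imp_le_exp)
qed

text \<open>Multiplying rows by A is injective on a finite set, hence onto, which supplies the rows
  of a left inverse B. It is also a right inverse because A can be cancelled in (A B) A = A.\<close>

lemma full_rank_square_inverse:
  assumes A: "A \<in> full_rank n n"
  obtains B where "B \<in> full_rank n n" "B \<star> A = I n" "A \<star> B = I n"
proof -
  have "row_span A = K 1 n"
    using card_subset_eq[OF card_K(1) row_span_sub[OF full_rank_K[OF A]]] card_row_span[OF A] card_K(2)[of 1 n] by simp
  then have "\<forall>i<n. \<exists>y\<in>K 1 n. y \<star> A = row_mat (I n) i"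
    using row_mat_K[of "I n" n n] A by (auto simp: row_span_def M_dim[OF full_rank_K] image_iff) (metis (no_types, lifting) imageE one_closed scalar_K)
  then obtain f where f: "\<And>i. i < n \<Longrightarrow> f i \<in> K 1 n" "\<And>i. i < n \<Longrightarrow> f i \<star> A = row_mat (I n) i"
    by metis
  obtain B where B: "B \<in> K n n" "\<And>i. i < n \<Longrightarrow> row_mat B i = f i"
    using ex_of_rows[of n f n] f by metis
  have BA: "B \<star> A = I n"
  proof (rule row_mat_eqI[of _ n n])
    show "B \<star> A \<in> K n n" using mul_K[OF B(1) full_rank_K[OF A]] .
    fix i assume "i < n"
    then show "row_mat (B \<star> A) i = row_mat (I n) i"
      using B f row_mat_mul[OF B(1) full_rank_K[OF A]] by simp
  qed simp
  have "A \<star> B \<star> A = I n \<star> A" 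
    using A B BA mul_assoc[of A n n B n A n] I_mul[OF full_rank_K[OF A]] by simp
  then have AB: "A \<star> B = I n" using full_rank_cancel[OF A mul_K[OF full_rank_K[OF A] B(1)] scalar_K[of \<one> n]]
      I_mul[OF full_rank_K[OF A]] by simp
  have "B \<in> full_rank n n" using full_rank_of_right_inverse[OF B(1) full_rank_K[OF A] BA] .
  then show thesis using that BA AB by blast
qed

lemma full_rank_mul_left:
  assumes "A \<in> full_rank k k" "B \<in> full_rank k m"
  shows "A \<star> B \<in> full_rank k m"
proof -
  have "c = Z 1 k" if c: "c \<in> K 1 k" "c \<star> (A \<star> B) = Z 1 m" for c
  proof -
    have "(c \<star> A) \<star> B = Z 1 m" using c assms mul_assoc[of c 1 k A k B m] by simp
    then have "c \<star> A = Z 1 k" using c assms full_rank_cancel_Z[OF assms(2), of "c \<star> A" 1] by simp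
    then show ?thesis using c full_rank_cancel_Z[OF assms(1)] by simp
  qed
  then show ?thesis using mul_K[OF full_rank_K[OF assms(1)] full_rank_K[OF assms(2)]] full_rank_I by blast
qed

lemma full_rank_mul_right:
  assumes "B \<in> full_rank k m" "A \<in> full_rank m m"
  shows "B \<star> A \<in> full_rank k m"
proof -
  have "c = Z 1 k" if c: "c \<in> K 1 k" "c \<star> (B \<star> A) = Z 1 m" for c
  proof -
    have "(c \<star> B) \<star> A = Z 1 m" using c assms mul_assoc[of c 1 k B m A m] by simp
    then have "c \<star> B = Z 1 m" using c assms full_rank_cancel_Z[OF assms(2), of "c \<star> B" 1] by simp
    then show ?thesis using c full_rank_cancel_Z[OF assms(1)] by simp
  qed
  then show ?thesis using mul_K[OF full_rank_K[OF assms(1)] full_rank_K[OF assms(2)]] full_rank_I by blast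
qed

lemma full_rank_conj_iff:
  assumes P: "P \<in> full_rank n n" and T: "T \<in> K n n" and T': "T' \<in> K n n" and eq: "P \<star> T = T' \<star> P"
  shows "T \<in> full_rank n n \<longleftrightarrow> T' \<in> full_rank n n"
proof -
  obtain R where R: "R \<in> full_rank n n" "R \<star> P = I n" "P \<star> R = I n" using full_rank_square_inverse[OF P] .
  have 1: "R \<star> (T' \<star> P) = T"
    using mul_assoc[of R n n P n T n] R P T eq by simp
  have 2: "P \<star> T \<star> R = T'"
    using mul_assoc[of T' n n P n R n] R P T' eq by simp
  show ?thesis
    using 1 2 P R full_rank_mul_left full_rank_mul_right by metis
qed

lemma full_rank_scalar:
  assumes "c \<in> carrier F" "c \<noteq> \<zero>"
  shows "scalar_matrix F n c \<in> full_rank n n"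
proof (rule full_rank_of_right_inverse)
  have i: "inv c \<in> carrier F" "c \<otimes> inv c = \<one>" using assms by (auto simp: field_Units)
  show c: "scalar_matrix F n (inv c) \<in> K n n" "scalar_matrix F n c \<in> K n n"
    using i assms by auto
  show "scalar_matrix F n c \<star> scalar_matrix F n (inv c) = I n"
    unfolding scalar_mul(1)[OF assms(1) c(1)]
    using i assms by (intro eq_matI) (auto simp: mat_scale_def scalar_matrix_def)
qed

text \<open>A dependence in which the new row has a nonzero coefficient can be solved for that row.
  All recursive counts of independent rows rest on this step.\<close>

lemma full_rank_vcat_iff:
  assumes A: "A \<in> K k m" and v: "v \<in> K 1 m"
  shows "vcat A v \<in> full_rank (k + 1) m \<longleftrightarrow> A \<in> full_rank k m \<and> v \<notin> row_span A"
proof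
  assume fr: "vcat A v \<in> full_rank (k + 1) m"
  have "c = Z 1 k" if c: "c \<in> K 1 k" "c \<star> A = Z 1 m" for c
  proof -
    have "hcat c (Z 1 1) \<star> vcat A v = Z 1 m"
      using c A v by (simp add: hcat_mul_vcat[where k = 1 and a = k and b = 1 and n = m])
    then have "hcat c (Z 1 1) = hcat (Z 1 k) (Z 1 1)"
      using full_rank_cancel_Z[OF fr, of "hcat c (Z 1 1)" 1] c by (simp add: hcat_Z)
    then show ?thesis using c hcat_inj[of c F 1 k "Z 1 1" 1 "Z 1 k" "Z 1 1"] by simp
  qed
  moreover have "v \<notin> row_span A"
  proof
    assume "v \<in> row_span A"
    then obtain c where c: "c \<in> K 1 k" "v = c \<star> A" using A by (auto simp: row_span_def M_dim)
    have "hcat c (Z 1 1) \<star> vcat A v = hcat (Z 1 k) (I 1) \<star> vcat A v"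
      using c(1) c(2)[symmetric] A v by (simp add: hcat_mul_vcat[where k = 1 and a = k and b = 1 and n = m])
    then have "hcat c (Z 1 1) = hcat (Z 1 k) (I 1)"
      using full_rank_cancel[OF fr, of "hcat c (Z 1 1)" 1 "hcat (Z 1 k) (I 1)"] c by simp
    then have "Z 1 1 = I 1" using c hcat_inj[of c F 1 k "Z 1 1" 1 "Z 1 k" "I 1"] by simp
    then have "Z 1 1 $$ (0, 0) = I 1 $$ (0, 0)" by simp
    then show False by (simp add: mat_zero_def scalar_matrix_def)
  qed
  ultimately show "A \<in> full_rank k m \<and> v \<notin> row_span A" using A full_rank_I by blast
next
  assume as: "A \<in> full_rank k m \<and> v \<notin> row_span A"
  have "c = Z 1 (k + 1)" if c: "c \<in> K 1 (k + 1)" "c \<star> vcat A v = Z 1 m" for c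
  proof -
    obtain a b where ab: "a \<in> K 1 k" "b \<in> K 1 1" "c = hcat a b" using hcat_cases[OF c(1)] .
    define d where "d = b $$ (0, 0)"
    have d: "d \<in> carrier F" "b = scalar_matrix F 1 d" using ab M_entry[OF ab(2)] K11 by (auto simp: d_def)
    have eq: "a \<star> A \<boxplus> sc d v = Z 1 m"
      using c ab d A v by (simp add: hcat_mul_vcat[where k = 1 and a = k and b = 1 and n = m] scalar_mul)
    have d0: "d = \<zero>"
    proof (rule ccontr)
      assume "d \<noteq> \<zero>"
      then have i: "inv d \<in> carrier F" "inv d \<otimes> d = \<one>" using d by (auto simp: field_Units)
      have "sc d v = sc (\<ominus> \<one>) (a \<star> A)"
      proof (rule M_eqI[of _ F 1 m])
        fix i j assume ij: "i < (1::nat)" "j < m"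
        have "(a \<star> A \<boxplus> sc d v) $$ (i, j) = \<zero>" using eq ij by (simp add: mat_zero_def)
        then have "(a \<star> A) $$ (i, j) \<oplus> (sc d v) $$ (i, j) = \<zero>"
          using ij M_dim[OF mul_K[OF ab(1) A]] by (simp add: mat_plus_def)
        moreover have "(a \<star> A) $$ (i, j) \<in> carrier F" "(sc d v) $$ (i, j) \<in> carrier F"
          using ij M_entry[OF mul_K[OF ab(1) A]] M_entry[OF sc_K[OF d(1) v]] by auto
        ultimately show "sc d v $$ (i, j) = sc (\<ominus> \<one>) (a \<star> A) $$ (i, j)"
          using ij M_dim[OF mul_K[OF ab(1) A]] minus_equality a_comm
          by (simp add: mat_scale_def l_minus) (metis add.inv_equality)
      qed (use d v ab A in auto)
      then have "sc (inv d) (sc d v) = sc (inv d) (sc (\<ominus> \<one>) (a \<star> A))" by simp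
      then have "v = sc (inv d) (sc (\<ominus> \<one>) a \<star> A)"
        using i d v ab A by (simp add: sc_sc[where k = 1 and n = m] mul_sc[where k = 1 and l = k and n = m])
      then have "v = sc (inv d) (sc (\<ominus> \<one>) a) \<star> A"
        using i ab A by (simp add: mul_sc[where k = 1 and l = k and n = m])
      then show False using as ab A i by (auto simp: row_span_def M_dim)
    qed
    then have "a \<star> A = Z 1 m" using eq v ab A by simp
    then have "a = Z 1 k" using as ab full_rank_D by blast
    moreover have "b = Z 1 1" using d d0 by (auto intro!: eq_matI simp: scalar_matrix_def mat_zero_def)
    ultimately show ?thesis using ab by (simp add: hcat_Z)
  qed
  then show "vcat A v \<in> full_rank (k + 1) m" using vcat_M[OF A v] full_rank_I by blast
qed

lemma Z_0: "A \<in> K 0 m \<Longrightarrow> A = Z 0 m" "B \<in> K m 0 \<Longrightarrow> B = Z m 0"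
  by (intro eq_matI; auto simp: mat_zero_def M_dim)+

lemma full_rank_0: "full_rank 0 m = {Z 0 m}"
proof -
  have "Z 0 m \<in> full_rank 0 m" using Z_0(2) by (intro full_rank_I) auto
  then show ?thesis using Z_0(1) full_rank_K by blast
qed

lemma vcat_0: "A \<in> K k m \<Longrightarrow> B \<in> K 0 m \<Longrightarrow> vcat A B = A"
  by (intro eq_matI) (auto simp: vcat_def M_dim)

lemma vcat_assoc:
  "A \<in> K a m \<Longrightarrow> B \<in> K b m \<Longrightarrow> C \<in> K c m \<Longrightarrow> vcat (vcat A B) C = vcat A (vcat B C)"
  by (intro eq_matI) (auto simp: vcat_def M_dim)

text \<open>As long as k < m the row space has q^k < q^m elements, so some vector lies outside and
  can be added; the induction is on the number of missing rows.\<close>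

lemma full_rank_complete:
  assumes "A \<in> full_rank k m"
  shows "\<exists>B\<in>K (m - k) m. vcat A B \<in> full_rank m m"
  using assms
proof (induction "m - k" arbitrary: k A)
  case 0
  then have "k = m" using full_rank_le[of A k m] by simp
  then show ?case using 0 vcat_0[of A m m "Z 0 m"] by (intro bexI[of _ "Z 0 m"]) auto
next
  case (Suc l)
  then have k: "k < m" by simp
  have "card (row_span A) < card (K 1 m)"
    using card_row_span[OF Suc.prems] card_K(2)[of 1 m] k q_ge_2 by simp
  moreover have "row_span A \<subseteq> K 1 m" using row_span_sub[OF full_rank_K[OF Suc.prems]] .
  ultimately obtain v where v: "v \<in> K 1 m" "v \<notin> row_span A" by (metis less_irrefl subset_antisym subsetI)
  have "vcat A v \<in> full_rank (k + 1) m" using full_rank_vcat_iff[of A k m v] Suc.prems v by simp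
  then obtain B where B: "B \<in> K (m - (k + 1)) m" "vcat (vcat A v) B \<in> full_rank m m"
    using Suc.hyps(1)[of "k + 1" "vcat A v"] Suc.hyps(2) by (metis Suc_diff_Suc Suc_eq_plus1 k nat.inject)
  have "vcat v B \<in> K (m - k) m" using vcat_M[OF v(1) B(1)] k by (simp add: Suc_diff_Suc)
  then show ?case using B vcat_assoc[of A k m v 1 B] Suc.prems v by auto
qed

text \<open>Stacking is injective, so matrices built from an upper and a lower block are counted by
  a fibred sum, even when the admissible lower blocks depend on the upper one.\<close>

lemma card_vcat_Sigma:
  assumes "\<A> \<subseteq> K k m" "\<And>A. A \<in> \<A> \<Longrightarrow> B A \<subseteq> K l m"
  shows "card {vcat A v | A v. A \<in> \<A> \<and> v \<in> B A} = (\<Sum>A\<in>\<A>. card (B A))"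
proof -
  have "{vcat A v | A v. A \<in> \<A> \<and> v \<in> B A} = (\<lambda>(A, v). vcat A v) ` Sigma \<A> B" by auto
  moreover have "inj_on (\<lambda>(A, v). vcat A v) (Sigma \<A> B)"
    using assms by (auto intro!: inj_onI simp: vcat_inj[where S = F and a = k and n = m and b = l] subset_iff)
  moreover have "finite \<A>" "\<And>A. A \<in> \<A> \<Longrightarrow> finite (B A)"
    using assms card_K(1) finite_subset by blast+
  ultimately show ?thesis by (simp add: card_image)
qed

lemma real_card_diff_row_span:
  assumes "H \<subseteq> K 1 m" "A \<in> full_rank k m" "row_span A \<subseteq> H"
  shows "real (card (H - row_span A)) = real (card H) - real q ^ k"
proof -
  have "finite H" using assms(1) card_K(1) finite_subset by blast
  then show ?thesis using assms card_row_span[OF assms(2)]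
      card_mono[OF _ assms(3)]
    by (simp add: card_Diff_subset finite_subset[OF assms(3)] of_nat_diff)
qed

text \<open>A set \<open>H\<close> that contains the row space of every matrix with rows in \<open>H\<close> is a subspace.\<close>

lemma card_full_rank_in_subspace:
  assumes H: "H \<subseteq> K 1 m" and sub: "\<And>k A. A \<in> K k m \<Longrightarrow> (\<And>i. i < k \<Longrightarrow> row_mat A i \<in> H) \<Longrightarrow> row_span A \<subseteq> H"
  shows "real (card {A \<in> full_rank k m. \<forall>i<k. row_mat A i \<in> H}) = (\<Prod>i<k. (real (card H) - real q ^ i))"
proof (induction k)
  case 0
  then show ?case by (simp add: full_rank_0)
next
  case (Suc k)
  let ?A = "\<lambda>k. {A \<in> full_rank k m. \<forall>i<k. row_mat A i \<in> H}"
  have rv: "row_mat (vcat A v) i = (if i < k then row_mat A i else v)"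
    if "A \<in> K k m" "v \<in> K 1 m" "i < Suc k" for A v i
    using that by (intro eq_matI) (auto simp: row_mat_def vcat_def M_dim)
  have "?A (Suc k) = {vcat A v | A v. A \<in> ?A k \<and> v \<in> H - row_span A}"
  proof (intro equalityI subsetI)
    fix B assume B: "B \<in> ?A (Suc k)"
    then have "B \<in> K (k + 1) m" using B full_rank_K unfolding Suc_eq_plus1 by blast
    then obtain A v where Av: "A \<in> K k m" "v \<in> K 1 m" "B = vcat A v"
      by (rule vcat_cases)
    then show "B \<in> {vcat A v | A v. A \<in> ?A k \<and> v \<in> H - row_span A}"
      using B full_rank_vcat_iff[OF Av(1,2), folded Suc_eq_plus1] rv[OF Av(1,2)] by (auto simp: less_Suc_eq)
  next
    fix B assume "B \<in> {vcat A v | A v. A \<in> ?A k \<and> v \<in> H - row_span A}"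
    then obtain A v where Av: "A \<in> ?A k" "v \<in> H - row_span A" "B = vcat A v" by blast
    then show "B \<in> ?A (Suc k)"
      using full_rank_vcat_iff[of A k m v, folded Suc_eq_plus1] rv[of A v] H by (auto simp: subset_iff)
  qed
  moreover have "real (card {vcat A v | A v. A \<in> ?A k \<and> v \<in> H - row_span A})
      = real (card (?A k)) * (real (card H) - real q ^ k)"
  proof (cases "?A k = {}")
    case False
    then obtain A where A: "A \<in> ?A k" by blast
    have s: "row_span B \<subseteq> H" if "B \<in> ?A k" for B
      using that sub[of B k] full_rank_K[of B k m] by blast
    have c: "card (H - row_span B) = card (H - row_span A)" if "B \<in> ?A k" for B
    proof -
      have "real (card (H - row_span B)) = real (card (H - row_span A))"
        using that A real_card_diff_row_span[OF H, of A k] real_card_diff_row_span[OF H, of B k] s by simp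
      then show ?thesis by simp
    qed
    have "card {vcat A v | A v. A \<in> ?A k \<and> v \<in> H - row_span A} = (\<Sum>B\<in>?A k. card (H - row_span B))"
      using H by (intro card_vcat_Sigma[where k = k and m = m and l = 1]) auto
    also have "\<dots> = (\<Sum>B\<in>?A k. card (H - row_span A))" by (rule sum.cong[OF refl c])
    also have "\<dots> = card (?A k) * card (H - row_span A)" by simp
    finally have "card {vcat A v | A v. A \<in> ?A k \<and> v \<in> H - row_span A} = card (?A k) * card (H - row_span A)" .
    then show ?thesis using real_card_diff_row_span[OF H, of A k] A s by simp
  next
    \<comment> \<open>If k independent rows no longer fit into H, both sides are zero whatever the
      sign of the last factor.\<close>
    case True
    then have "{vcat A v | A v. A \<in> ?A k \<and> v \<in> H - row_span A} = {}" by blast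
    then show ?thesis unfolding True by simp
  qed
  ultimately show ?case using Suc by simp
qed

lemma card_full_rank: "real (card (full_rank k m)) = (\<Prod>i<k. (real q ^ m - real q ^ i))"
proof -
  have "{A \<in> full_rank k m. \<forall>i<k. row_mat A i \<in> K 1 m} = full_rank k m" using row_mat_K full_rank_K by blast
  then show ?thesis using card_full_rank_in_subspace[of "K 1 m" m k] row_span_sub card_K(2)[of 1 m] by simp
qed

lemma card_full_rank_pos: "k \<le> m \<Longrightarrow> 0 < real (card (full_rank k m))"
  unfolding card_full_rank using q_ge_2 by (intro prod_pos) auto

text \<open>The first d factors of the product count d independent rows, and each of the other m - d
  factors contains a factor q^d. This turns counts of matrices with a given action on a
  d-dimensional space into proportions in dimension m - d.\<close>

lemma card_full_rank_split:
  assumes "d \<le> m"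
  shows "real (card (full_rank m m)) = real (card (full_rank d m)) * real q ^ (d * (m - d)) * real (card (full_rank (m - d) (m - d)))"
proof -
  define e where "e = m - d"
  have m: "m = d + e" using assms by (simp add: e_def)
  have split: "(\<Prod>i<d + k. f i) = (\<Prod>i<d. f i) * (\<Prod>i<k. f (d + i))" for k and f :: "nat \<Rightarrow> real"
    by (induction k) (auto simp: mult.assoc)
  have "(\<Prod>i<e. (real q ^ m - real q ^ (d + i))) = (\<Prod>i<e. real q ^ d * (real q ^ e - real q ^ i))"
    by (intro prod.cong) (auto simp: m power_add algebra_simps)
  also have "\<dots> = real q ^ (d * e) * (\<Prod>i<e. (real q ^ e - real q ^ i))"
    by (simp add: prod.distrib power_mult)
  finally have "(\<Prod>i<d + e. (real q ^ m - real q ^ i))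
      = (\<Prod>i<d. (real q ^ m - real q ^ i)) * (real q ^ (d * e) * (\<Prod>i<e. (real q ^ e - real q ^ i)))"
    using split[of "\<lambda>i. real q ^ m - real q ^ i" e] by simp
  then show ?thesis by (simp add: card_full_rank e_def[symmetric] m[symmetric])
qed

end

section \<open>The Cayley--Hamilton theorem over a commutative ring type\<close>

text \<open>Horner's scheme with A on the right. The evaluation of coefficient lists proceeds in the
  same order, which makes the comparison \<open>pam_phi\<close> a plain induction.\<close>

definition poly_mat :: "nat \<Rightarrow> 'r::comm_ring_1 mat \<Rightarrow> 'r poly \<Rightarrow> 'r mat" where
  "poly_mat n A p = fold_coeffs (\<lambda>a B. B * A + a \<cdot>\<^sub>m 1\<^sub>m n) p (0\<^sub>m n n)"

context
  fixes n :: nat and A :: "'r::comm_ring_1 mat"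
  assumes A: "A \<in> carrier_mat n n"
begin

lemma poly_mat_0: "poly_mat n A 0 = 0\<^sub>m n n"
  by (simp add: poly_mat_def)

lemma poly_mat_pCons: "poly_mat n A (pCons a p) = poly_mat n A p * A + a \<cdot>\<^sub>m 1\<^sub>m n"
proof (cases "p = 0 \<and> a = 0")
  case True
  then show ?thesis using A by (auto intro!: eq_matI simp: poly_mat_def)
next
  case False
  then show ?thesis unfolding poly_mat_def
    by (cases "p = 0") (auto simp: fold_coeffs_pCons_not_0_0_eq fold_coeffs_pCons_coeff_not_0_eq)
qed

lemma poly_mat_carrier [simp]: "poly_mat n A p \<in> carrier_mat n n"
proof (induction p)
  case (pCons a p)
  then show ?case using A by (simp add: poly_mat_pCons)
qed (simp add: poly_mat_0)

lemma poly_mat_add: "poly_mat n A (p + q) = poly_mat n A p + poly_mat n A q"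
proof (induction p q rule: poly_induct2)
  case 0
  then show ?case by (simp add: poly_mat_0)
next
  case (pCons a p b q)
  have "poly_mat n A (pCons a p + pCons b q) = (poly_mat n A p + poly_mat n A q) * A + (a + b) \<cdot>\<^sub>m 1\<^sub>m n"
    using pCons by (simp add: poly_mat_pCons)
  also have "(poly_mat n A p + poly_mat n A q) * A = poly_mat n A p * A + poly_mat n A q * A"
    by (rule add_mult_distrib_mat[OF poly_mat_carrier poly_mat_carrier A])
  also have "\<dots> + (a + b) \<cdot>\<^sub>m 1\<^sub>m n = poly_mat n A (pCons a p) + poly_mat n A (pCons b q)"
    using A mult_carrier_mat[OF poly_mat_carrier A, of p] mult_carrier_mat[OF poly_mat_carrier A, of q]
    by (intro eq_matI) (auto simp: poly_mat_pCons algebra_simps simp del: index_mult_mat(1))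
  finally show ?case .
qed

lemma poly_mat_smult: "poly_mat n A (Polynomial.smult c p) = c \<cdot>\<^sub>m poly_mat n A p"
proof (induction p)
  case 0
  then show ?case by (auto intro!: eq_matI simp: poly_mat_0)
next
  case (pCons a p)
  have "c \<cdot>\<^sub>m poly_mat n A p * A = c \<cdot>\<^sub>m (poly_mat n A p * A)"
    using mult_smult_assoc_mat[OF poly_mat_carrier A] .
  then show ?case using pCons A mult_carrier_mat[OF poly_mat_carrier A, of p]
    by (intro eq_matI) (auto simp: poly_mat_pCons algebra_simps simp del: index_mult_mat(1))
qed

text \<open>The reversed order costs nothing, since polynomials in A commute, and it is the one that
  Cayley-Hamilton uses: there the factor that stems from t I - A must stand on the left to be summed
  to zero.\<close>

lemma poly_mat_mult: "poly_mat n A (p * r) = poly_mat n A r * poly_mat n A p"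
proof (induction r)
  case 0
  then show ?case using left_mult_zero_mat[OF poly_mat_carrier] by (simp add: poly_mat_0)
next
  case (pCons a r)
  let ?f = "poly_mat n A"
  have comm: "?f p * A = A * ?f p" for p
  proof (induction p)
    case 0
    then show ?case using A by (simp add: poly_mat_0)
  next
    case (pCons b p)
    have "?f (pCons b p) * A = ?f p * A * A + b \<cdot>\<^sub>m A"
      using A mult_smult_assoc_mat[OF one_carrier_mat A, of b]
        add_mult_distrib_mat[OF mult_carrier_mat[OF poly_mat_carrier A] smult_carrier_mat[OF one_carrier_mat] A, of p b]
      by (simp add: poly_mat_pCons)
    also have "\<dots> = A * ?f (pCons b p)"
      using A pCons mult_smult_distrib[OF A one_carrier_mat, of b]
      by (simp add: poly_mat_pCons mult_add_distrib_mat[of _ n n _ n] assoc_mult_mat[of _ n n _ n _ n])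
    finally show ?case .
  qed
  have "?f (p * pCons a r) = a \<cdot>\<^sub>m ?f p + ?f (p * r) * A"
    using A mult_carrier_mat[OF poly_mat_carrier A, of "p * r"]
    by (auto simp: poly_mat_add poly_mat_smult poly_mat_pCons intro!: eq_matI simp del: index_mult_mat(1))
  also have "?f (p * r) * A = ?f r * A * ?f p"
    using A pCons comm[of p] by (simp add: assoc_mult_mat[of _ n n _ n _ n])
  also have "a \<cdot>\<^sub>m ?f p + \<dots> = ?f r * A * ?f p + a \<cdot>\<^sub>m ?f p"
    by (rule comm_add_mat[of _ n n])
      (use mult_carrier_mat[OF mult_carrier_mat[OF poly_mat_carrier A] poly_mat_carrier, of r p] in auto)
  also have "\<dots> = ?f (pCons a r) * ?f p"
    using A mult_smult_assoc_mat[of "1\<^sub>m n" n n "?f p" n a] left_mult_one_mat[OF poly_mat_carrier, of p]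
      add_mult_distrib_mat[OF mult_carrier_mat[OF poly_mat_carrier A, of r]
        smult_carrier_mat[OF one_carrier_mat] poly_mat_carrier, of a p]
    by (simp add: poly_mat_pCons)
  finally show ?case .
qed

lemma poly_mat_sum_index:
  "finite S \<Longrightarrow> i < n \<Longrightarrow> j < n \<Longrightarrow> poly_mat n A (sum f S) $$ (i, j) = (\<Sum>k\<in>S. poly_mat n A (f k) $$ (i, j))"
  by (induction S rule: finite_induct) (auto simp: poly_mat_0 poly_mat_add carrier_matD[OF poly_mat_carrier])

text \<open>The rows of the identity matrix generate a module over the polynomials in which the
  indeterminate acts as \<open>A\<close>. The matrix \<open>t I - A\<close> annihilates the vector of these generators, hence
  so does its multiple \<open>det (t I - A) I\<close> by the adjugate.\<close>

theorem cayley_hamilton: "poly_mat n A (char_poly A) = 0\<^sub>m n n"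
proof (rule eq_matI)
  let ?f = "poly_mat n A"
  let ?M = "char_poly_matrix A"
  have M: "?M \<in> carrier_mat n n" using A by simp
  note adj = adj_mat(1)[OF M] adj_mat(3)[OF M]
  \<comment> \<open>The relation between the generators: t I contributes row j of A at k = j, and -
    A contributes the entry \<open>A $$ (j, m)\<close> with a minus sign at k = m.\<close>
  have fM: "(\<Sum>k<n. ?f (?M $$ (j, k)) $$ (k, m)) = 0" if jm: "j < n" "m < n" for j m
  proof -
    have c: "?f [:a:] = a \<cdot>\<^sub>m 1\<^sub>m n" for a
      using A by (auto simp: poly_mat_pCons poly_mat_0 intro!: eq_matI)
    have x: "?f [:0, 1:] = A"
      using A by (auto simp: poly_mat_pCons poly_mat_0 intro!: eq_matI)
    have "?f (?M $$ (j, k)) $$ (k, m) = (if k = j then A $$ (j, m) else 0) - (if k = m then A $$ (j, m) else 0)"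
      if k: "k < n" for k
    proof -
      have "?M $$ (j, k) = (if k = j then [:0, 1:] else 0) + [: - A $$ (j, k) :]"
        using A jm k by (auto simp: char_poly_matrix_def)
      then show ?thesis using A jm k x by (auto simp: poly_mat_add c poly_mat_0)
    qed
    then have "(\<Sum>k<n. ?f (?M $$ (j, k)) $$ (k, m))
        = (\<Sum>k<n. (if k = j then A $$ (j, m) else 0) - (if k = m then A $$ (j, m) else 0))"
      by (intro sum.cong) auto
    also have "\<dots> = 0" using jm by (simp add: sum_subtractf)
    finally show ?thesis .
  qed
  fix i l assume "i < dim_row (0\<^sub>m n n :: 'r mat)" "l < dim_col (0\<^sub>m n n :: 'r mat)"
  then have il: "i < n" "l < n" by auto
  have z: "?f 0 $$ (i', l) = 0" if "i' < n" for i' using that il by (simp add: poly_mat_0)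
  have "?f (char_poly A) $$ (i, l) = (\<Sum>k<n. ?f ((adj_mat ?M * ?M) $$ (i, k)) $$ (k, l))"
  proof -
    have "(\<Sum>k<n. ?f ((adj_mat ?M * ?M) $$ (i, k)) $$ (k, l))
        = (\<Sum>k<n. if k = i then ?f (char_poly A) $$ (i, l) else 0)"
      using il by (intro sum.cong) (auto simp: adj(2) char_poly_def z)
    then show ?thesis using il by simp
  qed
  also have "\<dots> = (\<Sum>k<n. \<Sum>j<n. ?f (adj_mat ?M $$ (i, j) * ?M $$ (j, k)) $$ (k, l))"
  proof (intro sum.cong refl)
    fix k assume "k \<in> {..<n}"
    then have "(adj_mat ?M * ?M) $$ (i, k) = (\<Sum>j<n. adj_mat ?M $$ (i, j) * ?M $$ (j, k))"
      using il carrier_matD[OF adj(1)] carrier_matD[OF M]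
      by (auto simp: scalar_prod_def atLeast0LessThan intro!: sum.cong)
    then show "?f ((adj_mat ?M * ?M) $$ (i, k)) $$ (k, l)
        = (\<Sum>j<n. ?f (adj_mat ?M $$ (i, j) * ?M $$ (j, k)) $$ (k, l))"
      using il \<open>k \<in> {..<n}\<close> by (simp add: poly_mat_sum_index)
  qed
  also have "\<dots> = (\<Sum>k<n. \<Sum>j<n. \<Sum>m<n. ?f (?M $$ (j, k)) $$ (k, m) * ?f (adj_mat ?M $$ (i, j)) $$ (m, l))"
    using il carrier_matD[OF poly_mat_carrier]
    by (intro sum.cong refl) (auto simp: poly_mat_mult scalar_prod_def atLeast0LessThan intro!: sum.cong)
  also have "\<dots> = (\<Sum>j<n. \<Sum>m<n. (\<Sum>k<n. ?f (?M $$ (j, k)) $$ (k, m)) * ?f (adj_mat ?M $$ (i, j)) $$ (m, l))"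
    unfolding sum_distrib_right by (subst sum.swap) (intro sum.cong refl sum.swap)
  also have "\<dots> = 0" by (intro sum.neutral ballI) (simp add: fM)
  finally show "?f (char_poly A) $$ (i, l) = 0\<^sub>m n n $$ (i, l)" using il by simp
qed (auto simp: carrier_matD[OF poly_mat_carrier])

end

text \<open>The matrix t I - T has the same block shape with the same zero block, so its determinant
  factors.\<close>

lemma char_poly_four_block_lower:
  fixes A :: "'r::idom mat"
  assumes A: "A \<in> carrier_mat a a" and B: "B \<in> carrier_mat b a" and D: "D \<in> carrier_mat b b"
  shows "char_poly (four_block_mat A (0\<^sub>m a b) B D) = char_poly A * char_poly D"
proof -
  have "char_poly_matrix (four_block_mat A (0\<^sub>m a b) B D)
      = four_block_mat (char_poly_matrix A) (0\<^sub>m a b) (map_mat (\<lambda>x. [:- x:]) B) (char_poly_matrix D)"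
    using assms by (intro eq_matI) (auto simp: char_poly_matrix_def)
  then show ?thesis
    using assms by (simp add: char_poly_def det_four_block_mat_upper_right_zero[of _ a _ b])
qed

text \<open>For \<open>a = 2\<close> the annihilating polynomial has degree one less than the dimension, which is why a
  two-dimensional eigenspace makes a matrix noncyclic.\<close>

lemma poly_mat_block_annihilates:
  fixes D :: "'r::comm_ring_1 mat"
  assumes B: "B \<in> carrier_mat b a" and D: "D \<in> carrier_mat b b"
  shows "poly_mat (a + b) (four_block_mat (c \<cdot>\<^sub>m 1\<^sub>m a) (0\<^sub>m a b) B D) ([:- c, 1:] * char_poly D) = 0\<^sub>m (a + b) (a + b)"
proof -
  let ?T = "four_block_mat (c \<cdot>\<^sub>m 1\<^sub>m a) (0\<^sub>m a b) B D"
  have T: "?T \<in> carrier_mat (a + b) (a + b)" using D by auto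
  \<comment> \<open>Only the lower right block of p(T) and the zero block above it are
    tracked.\<close>
  have "\<exists>U W. U \<in> carrier_mat a a \<and> W \<in> carrier_mat b a \<and>
      poly_mat (a + b) ?T p = four_block_mat U (0\<^sub>m a b) W (poly_mat b D p)" for p
  proof (induction p)
    case 0
    then show ?case
      by (intro exI[of _ "0\<^sub>m a a"] exI[of _ "0\<^sub>m b a"]) (auto simp: poly_mat_0[OF T] poly_mat_0[OF D])
  next
    case (pCons x p)
    then obtain U W where UW: "U \<in> carrier_mat a a" "W \<in> carrier_mat b a"
        "poly_mat (a + b) ?T p = four_block_mat U (0\<^sub>m a b) W (poly_mat b D p)" by blast
    have "poly_mat (a + b) ?T p * ?T = four_block_mat (U * (c \<cdot>\<^sub>m 1\<^sub>m a) + 0\<^sub>m a b * B) (U * 0\<^sub>m a b + 0\<^sub>m a b * D)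
        (W * (c \<cdot>\<^sub>m 1\<^sub>m a) + poly_mat b D p * B) (W * 0\<^sub>m a b + poly_mat b D p * D)"
      unfolding UW(3) by (rule mult_four_block_mat) (use UW B D poly_mat_carrier[OF D] in auto)
    then have "poly_mat (a + b) ?T (pCons x p) = four_block_mat (U * (c \<cdot>\<^sub>m 1\<^sub>m a) + x \<cdot>\<^sub>m 1\<^sub>m a) (0\<^sub>m a b)
        (W * (c \<cdot>\<^sub>m 1\<^sub>m a) + poly_mat b D p * B) (poly_mat b D (pCons x p))"
      using UW B D carrier_matD[OF poly_mat_carrier[OF D, of p]]
      by (intro eq_matI) (auto simp: poly_mat_pCons[OF T] poly_mat_pCons[OF D] simp del: index_mult_mat(1))
    then show ?case
      using UW B poly_mat_carrier[OF D, of p]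
      by (intro exI[of _ "U * (c \<cdot>\<^sub>m 1\<^sub>m a) + x \<cdot>\<^sub>m 1\<^sub>m a"] exI[of _ "W * (c \<cdot>\<^sub>m 1\<^sub>m a) + poly_mat b D p * B"]) auto
  qed
  then obtain U W where UW: "U \<in> carrier_mat a a" "W \<in> carrier_mat b a"
      "poly_mat (a + b) ?T (char_poly D) = four_block_mat U (0\<^sub>m a b) W (poly_mat b D (char_poly D))" by blast
  \<comment> \<open>T - c has zero rows on top, and by Cayley-Hamilton \<open>char_poly D\<close> at
    T has zero columns on the right, so the product in this order vanishes.\<close>
  have lin: "poly_mat (a + b) ?T [:- c, 1:] = four_block_mat (0\<^sub>m a a) (0\<^sub>m a b) B (D - c \<cdot>\<^sub>m 1\<^sub>m b)"
    using T B D by (intro eq_matI) (auto simp: poly_mat_pCons[OF T] poly_mat_0[OF T])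
  have "poly_mat (a + b) ?T ([:- c, 1:] * char_poly D)
      = four_block_mat U (0\<^sub>m a b) W (0\<^sub>m b b) * four_block_mat (0\<^sub>m a a) (0\<^sub>m a b) B (D - c \<cdot>\<^sub>m 1\<^sub>m b)"
    unfolding poly_mat_mult[OF T] lin UW(3) cayley_hamilton[OF D] ..
  also have "\<dots> = four_block_mat (U * 0\<^sub>m a a + 0\<^sub>m a b * B) (U * 0\<^sub>m a b + 0\<^sub>m a b * (D - c \<cdot>\<^sub>m 1\<^sub>m b))
      (W * 0\<^sub>m a a + 0\<^sub>m b b * B) (W * 0\<^sub>m a b + 0\<^sub>m b b * (D - c \<cdot>\<^sub>m 1\<^sub>m b))"
    by (rule mult_four_block_mat) (use UW B D in auto)
  also have "\<dots> = 0\<^sub>m (a + b) (a + b)" using UW B D by (intro eq_matI) auto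
  finally show ?thesis .
qed

section \<open>Characteristic polynomials over the field\<close>

sublocale finite_field \<subseteq> UP: domain "poly_ring F"
  by (rule univ_poly_is_domain[OF carrier_is_subring])

context finite_field
begin

abbreviation R where "R \<equiv> poly_ring F"

text \<open>Applies \<open>phi\<close> to the coefficients, but is built by \<open>poly_lift\<close>
  so that it is a ring homomorphism by construction. Its value as a list is determined in
  \<open>psi_monic\<close>.\<close>

definition psi :: "int poly poly \<Rightarrow> 'a list" where
  "psi = poly_lift R (\<lambda>a. poly_of_const (phi a)) [\<one>, \<zero>]"

lemma const_type_hom: "type_hom R (\<lambda>a. poly_of_const (phi a))"
proof -
  have h: "poly_of_const \<in> Ring.ring_hom F R"
    using canonical_embedding_is_hom[OF carrier_is_subring] by simp
  show ?thesis
    by unfold_locales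
      (auto simp: ring_hom_memE[OF h] phi.hom_add phi.hom_mult phi.hom_one)
qed

lemma X_closed: "[\<one>, \<zero>] \<in> carrier R"
  using var_closed(1)[OF carrier_is_subring] by (simp add: var_def)

end

sublocale finite_field \<subseteq> psi: type_hom "poly_ring F" psi
  unfolding psi_def using type_hom.type_hom_poly_lift[OF const_type_hom X_closed] .

context finite_field
begin

lemma poly_of_const_eq: "poly_of_const c = (if c = \<zero> then [] else [c])"
  by (simp add: poly_of_const_def)

lemma psi_const: "psi [:a:] = poly_of_const (phi a)"
  unfolding psi_def using type_hom.poly_lift_const[OF const_type_hom X_closed] .

lemma psi_pCons: "psi (pCons a p) = poly_of_const (phi a) \<oplus>\<^bsub>R\<^esub> [\<one>, \<zero>] \<otimes>\<^bsub>R\<^esub> psi p"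
  unfolding psi_def using type_hom.poly_lift_pCons[OF const_type_hom X_closed] .

lemma psi_X: "psi [:0, 1:] = [\<one>, \<zero>]"
  unfolding psi_def using type_hom.poly_lift_X[OF const_type_hom X_closed] .

lemma eval_hom:
  assumes "c \<in> carrier F"
  shows "p \<in> carrier R \<Longrightarrow> eval p c \<in> carrier F"
    "p \<in> carrier R \<Longrightarrow> r \<in> carrier R \<Longrightarrow> eval (p \<otimes>\<^bsub>R\<^esub> r) c = eval p c \<otimes> eval r c"
    "p \<in> carrier R \<Longrightarrow> r \<in> carrier R \<Longrightarrow> eval (p \<oplus>\<^bsub>R\<^esub> r) c = eval p c \<oplus> eval r c"
  using ring_hom_memE[OF eval_is_hom[OF carrier_is_subring assms]] by blast+

lemma eval_psi: "eval (psi p) (phi c) = phi (poly p c)"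
proof (induction p)
  case 0
  then show ?case using psi.hom_zero by (simp add: univ_poly_zero phi.hom_zero)
next
  case (pCons a p)
  have cc: "poly_of_const (phi a) \<in> carrier R" using psi.closed[of "[:a:]"] by (simp add: psi_const)
  have "eval (poly_of_const (phi a)) (phi c) = phi a" "eval [\<one>, \<zero>] (phi c) = phi c"
    by (auto simp: poly_of_const_eq)
  then show ?case
    using pCons eval_hom[OF phi.closed[of c]] cc X_closed
    by (simp add: psi_pCons phi.hom_add phi.hom_mult)
qed

lemma map2_add_zeros: "set l \<subseteq> carrier F \<Longrightarrow> map2 (\<oplus>) l (replicate (length l) \<zero>) = l"
  by (induction l) auto

text \<open>A polynomial list must not start with zero, and \<open>phi\<close> may kill a leading
  coefficient; a leading coefficient 1 survives. Characteristic polynomials are monic.\<close>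

lemma psi_monic:
  assumes "lead_coeff p = 1"
  shows "psi p = map phi (rev (coeffs p))"
  using assms
proof (induction p)
  case 0
  then show ?case by simp
next
  case (pCons a p)
  show ?case
  proof (cases "p = 0")
    case True
    then have "a = 1" using pCons by simp
    then show ?thesis using True psi.hom_one by (simp add: univ_poly_one phi.hom_one flip: one_pCons)
  next
    case False
    define l where "l = psi p"
    have l: "l = map phi (rev (coeffs p))" using pCons False by (simp add: l_def)
    have lc: "l \<in> carrier R" by (simp add: l_def)
    have ne: "l \<noteq> []" using False l by simp
    have hd: "hd l = \<one>"
      using pCons False l ne by (simp add: hd_map hd_rev last_coeffs_eq_coeff_degree phi.hom_one)
    have sl: "set l \<subseteq> carrier F" using l by auto
    have "[\<one>, \<zero>] \<otimes>\<^bsub>R\<^esub> l = l @ [\<zero>]"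
      using poly_mult_var[OF carrier_is_subring lc] ne UP.m_comm[OF X_closed lc] by (simp add: var_def)
    moreover have "(l @ [\<zero>]) \<oplus>\<^bsub>R\<^esub> poly_of_const (phi a) = l @ [phi a]"
    proof (cases "phi a = \<zero>")
      case True
      have "l @ [\<zero>] \<in> carrier R"
        using sl hd ne by (simp add: univ_poly_carrier[symmetric] polynomial_def hd_append)
      then show ?thesis using True UP.r_zero by (simp add: poly_of_const_eq univ_poly_zero)
    next
      case False
      have "map2 (\<oplus>) (l @ [\<zero>]) (replicate (length l) \<zero> @ [phi a]) = l @ [phi a]"
        using map2_add_zeros[OF sl] by simp
      moreover have "polynomial (carrier F) (l @ [phi a])"
        using sl hd ne by (simp add: polynomial_def hd_append)
      ultimately show ?thesis
        using False normalize_polynomial by (simp add: univ_poly_add poly_of_const_eq)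
    qed
    moreover have "poly_of_const (phi a) \<in> carrier R" using psi.closed[of "[:a:]"] by (simp add: psi_const)
    ultimately have "psi (pCons a p) = l @ [phi a]"
      unfolding psi_pCons l_def[symmetric] using UP.a_comm UP.m_closed[OF X_closed lc] by metis
    then show ?thesis using False l by (simp add: cCons_def)
  qed
qed

abbreviation cp :: "nat \<Rightarrow> 'a mat \<Rightarrow> 'a list" where "cp n A \<equiv> char_polynomial F n A"

text \<open>The determinant that defines the characteristic polynomial commutes with
  \<open>psi\<close>, so results over \<open>int poly\<close> apply through any lift of a matrix
  over the field.\<close>

lemma cp_phi:
  assumes A: "A \<in> carrier_mat n n"
  shows "cp n (map_mat phi A) = psi (char_poly A)"
proof -
  interpret cst: type_hom R "\<lambda>a. poly_of_const (phi a)" by (rule const_type_hom)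
  have "map_mat psi (char_poly_matrix A) = mat n n (\<lambda>(i, j). (if i = j then [\<one>, \<zero>] else [])
      \<ominus>\<^bsub>R\<^esub> poly_of_const (map_mat phi A $$ (i, j)))"
  proof (rule eq_matI)
    fix i j assume ij: "i < dim_row (mat n n (\<lambda>(i, j). (if i = j then [\<one>, \<zero>] else [])
        \<ominus>\<^bsub>R\<^esub> poly_of_const (map_mat phi A $$ (i, j))))"
      "j < dim_col (mat n n (\<lambda>(i, j). (if i = j then [\<one>, \<zero>] else [])
        \<ominus>\<^bsub>R\<^esub> poly_of_const (map_mat phi A $$ (i, j))))"
    have "char_poly_matrix A $$ (i, j) = (if i = j then [:0, 1:] else 0) - [:A $$ (i, j):]"
      using ij A by (auto simp: char_poly_matrix_def)
    then show "map_mat psi (char_poly_matrix A) $$ (i, j) = mat n n (\<lambda>(i, j). (if i = j then [\<one>, \<zero>] else [])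
        \<ominus>\<^bsub>R\<^esub> poly_of_const (map_mat phi A $$ (i, j))) $$ (i, j)"
      using ij A psi.hom_minus psi.hom_zero carrier_matD[OF char_poly_matrix_closed[OF A]]
      by (simp add: psi_X psi_const univ_poly_zero)
  qed (use A carrier_matD[OF char_poly_matrix_closed[OF A]] in auto)
  then show ?thesis
    using psi.hom_det[OF char_poly_matrix_closed[OF A]] by (simp add: char_polynomial_def char_poly_def)
qed

lemma cp_closed [simp]: "A \<in> K n n \<Longrightarrow> cp n A \<in> carrier R"
  using cp_phi by (metis lift psi.closed)

lemma length_cp:
  assumes "A \<in> K n n"
  shows "length (cp n A) = n + 1"
proof -
  obtain A' where A': "A' \<in> carrier_mat n n" "A = map_mat phi A'" using lift[OF assms] .
  have "degree (char_poly A') = n" "lead_coeff (char_poly A') = 1"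
    using degree_monic_char_poly[OF A'(1)] by auto
  then show ?thesis
    using A' psi_monic[of "char_poly A'"] length_coeffs_degree[of "char_poly A'"] cp_phi[OF A'(1)]
    by fastforce
qed

text \<open>Row vectors multiply from the left, so the zero block stands in the upper right: the
  span of the first coordinate vectors is then invariant.\<close>

definition blk :: "'a mat \<Rightarrow> 'a mat \<Rightarrow> 'a mat \<Rightarrow> 'a mat" where
  "blk A B C = vcat (hcat A (Z (dim_row A) (dim_col C))) (hcat B C)"

lemma blk_K [simp]:
  assumes "A \<in> K a a" "B \<in> K b a" "C \<in> K b b"
  shows "blk A B C \<in> K (a + b) (a + b)"
  using assms by (simp add: blk_def M_dim)

lemma blk_vcat:
  assumes "A \<in> K a a" "B \<in> K b a" "C \<in> K b b" "U \<in> K a n" "W \<in> K b n"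
  shows "blk A B C \<star> vcat U W = vcat (A \<star> U) (B \<star> U \<boxplus> C \<star> W)"
proof -
  have "blk A B C \<star> vcat U W = vcat (hcat A (Z a b) \<star> vcat U W) (hcat B C \<star> vcat U W)"
    using assms by (simp add: blk_def M_dim vcat_mul[of _ a "a + b" _ b _ n])
  then show ?thesis
    using assms by (simp add: hcat_mul_vcat[of _ _ a _ b _ n] mul_K[of _ a a _ n])
qed

lemma hcat_blk:
  assumes "A \<in> K a a" "B \<in> K b a" "C \<in> K b b" "u \<in> K k a" "w \<in> K k b"
  shows "hcat u w \<star> blk A B C = hcat (u \<star> A \<boxplus> w \<star> B) (w \<star> C)"
proof -
  have "hcat u w \<star> blk A B C = u \<star> hcat A (Z a b) \<boxplus> w \<star> hcat B C"
    using assms by (simp add: blk_def M_dim hcat_mul_vcat[of _ k a _ b _ "a + b"])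
  also have "\<dots> = hcat (u \<star> A) (Z k b) \<boxplus> hcat (w \<star> B) (w \<star> C)"
    using assms by (simp add: mul_hcat[of _ k a _ a _ b] mul_hcat[of _ k b _ a _ b])
  also have "\<dots> = hcat (u \<star> A \<boxplus> w \<star> B) (w \<star> C)"
    using assms mul_K[of w k b C b] by (simp add: hcat_plus[of _ k a _ b])
  finally show ?thesis .
qed

lemma cp_blk:
  assumes "A \<in> K a a" "B \<in> K b a" "C \<in> K b b"
  shows "cp (a + b) (blk A B C) = cp a A \<otimes>\<^bsub>R\<^esub> cp b C"
proof -
  obtain A' B' C' where l: "A' \<in> carrier_mat a a" "A = map_mat phi A'" "B' \<in> carrier_mat b a"
      "B = map_mat phi B'" "C' \<in> carrier_mat b b" "C = map_mat phi C'"
    using assms by (metis lift)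
  let ?T = "four_block_mat A' (0\<^sub>m a b) B' C'"
  have "blk A B C = map_mat phi ?T"
    using l by (intro eq_matI) (auto simp: blk_def vcat_def hcat_def mat_zero_def phi.hom_zero)
  then have "cp (a + b) (blk A B C) = psi (char_poly ?T)" using l by (simp add: cp_phi)
  then show ?thesis
    using l by (simp add: char_poly_four_block_lower psi.hom_mult cp_phi)
qed

text \<open>A lift of the inverse is an inverse only after \<open>phi\<close>, so the determinants
  are compared there; the product of their images is \<one>.\<close>

lemma phi_det_nonzero:
  assumes "A' \<in> carrier_mat n n" "map_mat phi A' \<in> full_rank n n"
  shows "phi (Determinant.det A') \<noteq> \<zero>"
proof -
  obtain B where B: "B \<in> full_rank n n" "map_mat phi A' \<star> B = I n" using full_rank_square_inverse[OF assms(2)] by metis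
  obtain B' where B': "B' \<in> carrier_mat n n" "B = map_mat phi B'" using lift[OF full_rank_K[OF B(1)]] .
  have "map_mat phi (A' * B') = map_mat phi (1\<^sub>m n)"
    using assms B B' phi.map_mat_mult[OF assms(1) B'(1)] by (simp add: phi.map_mat_one)
  then have "phi (Determinant.det (A' * B')) = phi (Determinant.det (1\<^sub>m n))"
    using phi.hom_det[OF mult_carrier_mat[OF assms(1) B'(1)]] phi.hom_det[of "1\<^sub>m n" n] by simp
  then have "phi (Determinant.det A') \<otimes> phi (Determinant.det B') = \<one>"
    using assms B' by (simp add: det_mult phi.hom_mult phi.hom_one)
  then show ?thesis by auto
qed

text \<open>A lift of P need not be invertible, and the lifted relation holds only modulo the kernel
  of \<open>phi\<close>. Instead of inverting P, the determinants of P (t I - T) and (t I - S) P are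
  compared after \<open>psi\<close>, and the nonzero constant that comes from det P is cancelled in
  the domain \<open>poly_ring F\<close>.\<close>

lemma cp_similar:
  assumes P: "P \<in> full_rank n n" and T: "T \<in> K n n" and S: "S \<in> K n n" and eq: "P \<star> T = S \<star> P"
  shows "cp n T = cp n S"
proof -
  obtain P' T' S' where l: "P' \<in> carrier_mat n n" "P = map_mat phi P'" "T' \<in> carrier_mat n n"
      "T = map_mat phi T'" "S' \<in> carrier_mat n n" "S = map_mat phi S'"
    using full_rank_K[OF P] T S by (metis lift)
  interpret cst: type_hom R "\<lambda>a. poly_of_const (phi a)" by (rule const_type_hom)
  interpret c: comm_ring_hom "\<lambda>a :: int poly. [:a:]" by unfold_locales (auto simp: one_pCons)
  let ?c = "map_mat (\<lambda>a :: int poly. [:a:])"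
  have cpm: "char_poly_matrix A = [:0, 1:] \<cdot>\<^sub>m 1\<^sub>m n - ?c A" if "A \<in> carrier_mat n n" for A :: "int poly mat"
    using that by (intro eq_matI) (auto simp: char_poly_matrix_def)
  have cc: "?c A \<in> carrier_mat n n" if "A \<in> carrier_mat n n" for A using that by simp
  have xx: "[:0, 1:] \<cdot>\<^sub>m 1\<^sub>m n \<in> carrier_mat n n" by simp
  have 1: "?c P' * char_poly_matrix T' = [:0, 1:] \<cdot>\<^sub>m ?c P' - ?c (P' * T')"
    using l mult_minus_distrib_mat[OF cc[OF l(1)] xx cc[OF l(3)]]
      mult_smult_distrib[OF cc[OF l(1)] one_carrier_mat, of "[:0, 1:]"] c.mat_hom_mult[OF l(1,3)]
    by (simp add: cpm)
  have 2: "char_poly_matrix S' * ?c P' = [:0, 1:] \<cdot>\<^sub>m ?c P' - ?c (S' * P')"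
    using l minus_mult_distrib_mat[OF xx cc[OF l(5)] cc[OF l(1)]]
      mult_smult_assoc_mat[OF one_carrier_mat cc[OF l(1)], of "[:0, 1:]"] c.mat_hom_mult[OF l(5,1)]
    by (simp add: cpm)
  have pe: "map_mat phi (P' * T') = map_mat phi (S' * P')"
    using phi.map_mat_mult[OF l(1,3)] phi.map_mat_mult[OF l(5,1)] l eq by simp
  have "map_mat psi (?c P' * char_poly_matrix T') = map_mat psi (char_poly_matrix S' * ?c P')"
    unfolding 1 2
  proof (rule eq_matI)
    fix i j assume "i < dim_row (map_mat psi ([:0, 1:] \<cdot>\<^sub>m ?c P' - ?c (S' * P')))"
      "j < dim_col (map_mat psi ([:0, 1:] \<cdot>\<^sub>m ?c P' - ?c (S' * P')))"
    then have ij: "i < n" "j < n" using l by auto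
    have "phi ((P' * T') $$ (i, j)) = phi ((S' * P') $$ (i, j))"
      using arg_cong[OF pe, of "\<lambda>Z. Z $$ (i, j)"] ij l carrier_matD[OF mult_carrier_mat[OF l(1,3)]]
        carrier_matD[OF mult_carrier_mat[OF l(5,1)]] by (simp del: index_mult_mat(1))
    then show "map_mat psi ([:0, 1:] \<cdot>\<^sub>m ?c P' - ?c (P' * T')) $$ (i, j)
        = map_mat psi ([:0, 1:] \<cdot>\<^sub>m ?c P' - ?c (S' * P')) $$ (i, j)"
      using ij l carrier_matD[OF mult_carrier_mat[OF l(1,3)]] carrier_matD[OF mult_carrier_mat[OF l(5,1)]]
      by (simp add: psi_pCons phi.hom_uminus del: index_mult_mat(1))
  qed (use l in auto)
  then have "psi (Determinant.det (?c P' * char_poly_matrix T')) = psi (Determinant.det (char_poly_matrix S' * ?c P'))"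
    
    using psi.hom_det[OF mult_carrier_mat[OF cc[OF l(1)] char_poly_matrix_closed[OF l(3)]]]
      psi.hom_det[OF mult_carrier_mat[OF char_poly_matrix_closed[OF l(5)] cc[OF l(1)]]] by (simp only:)
  then have "psi (Determinant.det (?c P')) \<otimes>\<^bsub>R\<^esub> psi (char_poly T') = psi (char_poly S') \<otimes>\<^bsub>R\<^esub> psi (Determinant.det (?c P'))"
    using l by (simp add: det_mult[of _ n] psi.hom_mult[symmetric] char_poly_def ac_simps)
  moreover have "psi (Determinant.det (?c P')) \<noteq> \<zero>\<^bsub>R\<^esub>"
    using phi_det_nonzero[of P' n] P l by (simp add: c.hom_det psi_const poly_of_const_eq univ_poly_zero)
  ultimately have "psi (char_poly T') = psi (char_poly S')"
    using UP.m_lcancel[of "psi (Determinant.det (?c P'))"] UP.m_comm psi.closed by metis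
  then show ?thesis using l by (simp add: cp_phi)
qed

lemma full_rank_1_iff: "v \<in> K 1 m \<Longrightarrow> v \<in> full_rank 1 m \<longleftrightarrow> v \<noteq> Z 1 m"
proof -
  assume v: "v \<in> K 1 m"
  have "vcat (Z 0 m) v = v" using v by (intro eq_matI) (auto simp: vcat_def mat_zero_def M_dim)
  moreover have "row_span (Z 0 m) = {Z 1 m}"
  proof -
    have "Z 1 0 \<in> K 1 0" "c \<star> Z 0 m = Z 1 m" if "c \<in> K 1 0" for c using that by auto
    then show ?thesis using Z_K[of 1 0] by (fastforce simp: row_span_def mat_zero_def)
  qed
  ultimately show ?thesis using full_rank_vcat_iff[of "Z 0 m" 0 m v] v by (simp add: full_rank_0)
qed

lemma eigenvector_iff:
  assumes "c \<in> carrier F" "A \<in> K n n" "V \<in> K k n"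
  shows "V \<star> (A \<boxminus> scalar_matrix F n c) = Z k n \<longleftrightarrow> V \<star> A = sc c V"
  using assms minus_eq_Z_iff[of "V \<star> A" k n "sc c V"]
  by (simp add: mul_minus[of _ k n _ n] scalar_mul)

lemma not_full_rank_eigenvector:
  assumes "c \<in> carrier F" "A \<in> K n n" "A \<boxminus> scalar_matrix F n c \<notin> full_rank n n"
  obtains v where "v \<in> full_rank 1 n" "v \<star> A = sc c v"
proof -
  have "A \<boxminus> scalar_matrix F n c \<in> K n n" using assms by simp
  then obtain v where "v \<in> K 1 n" "v \<star> (A \<boxminus> scalar_matrix F n c) = Z 1 n" "v \<noteq> Z 1 n"
    using assms(3) full_rank_I by blast
  then show thesis using that assms eigenvector_iff[of c A n v 1] full_rank_1_iff by blast
qed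

text \<open>The rows of W complete those of U to a basis. Expanding W T in this basis gives the rows
  of (B, C).\<close>

lemma block_of_invariant:
  assumes U: "U \<in> K d n" and W: "W \<in> K e n" and P: "vcat U W \<in> full_rank n n" and n: "n = d + e"
    and D: "D \<in> K d d" and T: "T \<in> K n n" and inv: "U \<star> T = D \<star> U"
  obtains B C where "B \<in> K e d" "C \<in> K e e" "vcat U W \<star> T = blk D B C \<star> vcat U W"
proof -
  obtain Q where Q: "Q \<in> full_rank n n" "Q \<star> vcat U W = I n" using full_rank_square_inverse[OF P] by metis
  have WT: "W \<star> T \<in> K e n" using W T by simp
  have "W \<star> T \<star> Q \<in> K e (d + e)" using mul_K[OF WT full_rank_K[OF Q(1)]] n by simp
  then obtain B C where BC: "B \<in> K e d" "C \<in> K e e" "W \<star> T \<star> Q = hcat B C" by (rule hcat_cases)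
  have "W \<star> T = hcat B C \<star> vcat U W"
    using mul_assoc[OF WT full_rank_K[OF Q(1)] full_rank_K[OF P]] BC Q WT by simp
  then have "vcat U W \<star> T = vcat (D \<star> U) (B \<star> U \<boxplus> C \<star> W)"
    using vcat_mul[OF U W T] inv hcat_mul_vcat[OF BC(1,2) U W] by simp
  then show thesis using that BC blk_vcat[OF D BC(1,2) U W] by simp
qed

lemma eval_cp:
  assumes A: "A' \<in> carrier_mat n n"
  shows "eval (cp n (map_mat phi A')) (phi c) = phi (Determinant.det (c \<cdot>\<^sub>m 1\<^sub>m n - A'))"
proof -
  have "poly (char_poly A') c = Determinant.det (c \<cdot>\<^sub>m 1\<^sub>m n - A')"
    unfolding char_poly_def
    by (rule poly_det_cong[of _ n]) (use A in \<open>auto simp: char_poly_matrix_def\<close>)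
  then show ?thesis using A by (simp add: cp_phi eval_psi)
qed

lemma cp_single:
  assumes "c \<in> carrier F"
  shows "cp 1 (scalar_matrix F 1 c) = [\<one>, \<ominus> c]"
proof -
  obtain c' where c': "c = phi c'" using lift_elem[OF assms] by blast
  have 1: "c' \<cdot>\<^sub>m 1\<^sub>m 1 \<in> carrier_mat 1 1" by simp
  have "char_poly (c' \<cdot>\<^sub>m 1\<^sub>m 1) = [:- c', 1:]"
    unfolding char_poly_def by (subst det_single) (auto simp: char_poly_matrix_def)
  then have "cp 1 (scalar_matrix F 1 c) = psi [:- c', 1:]"
    using cp_phi[OF 1] c' by (simp add: phi.map_mat_scalar)
  then show ?thesis using psi_monic[of "[:- c', 1:]"] c' by (simp add: phi.hom_one phi.hom_uminus)
qed

lemma eval_linear: "c \<in> carrier F \<Longrightarrow> d \<in> carrier F \<Longrightarrow> eval [\<one>, \<ominus> c] d = d \<ominus> c"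
  by (simp add: a_minus_def)

lemma linear_closed: "c \<in> carrier F \<Longrightarrow> [\<one>, \<ominus> c] \<in> carrier R"
  by (simp add: univ_poly_carrier[symmetric] polynomial_def)

text \<open>An eigenvector spans an invariant line, hence an upper block of size 1, whose
  characteristic polynomial splits off.\<close>

lemma cp_eigenvector:
  assumes c: "c \<in> carrier F" and T: "T \<in> K n n" and v: "v \<in> full_rank 1 n" "v \<star> T = sc c v"
  obtains P B C where "P \<in> full_rank n n" "B \<in> K (n - 1) 1" "C \<in> K (n - 1) (n - 1)"
    "P \<star> T = blk (scalar_matrix F 1 c) B C \<star> P" "cp n T = [\<one>, \<ominus> c] \<otimes>\<^bsub>R\<^esub> cp (n - 1) C"
proof -
  have n: "n = 1 + (n - 1)" using full_rank_le[OF v(1)] by simp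
  obtain W where W: "W \<in> K (n - 1) n" "vcat v W \<in> full_rank n n" using full_rank_complete[OF v(1)] by blast
  have "v \<star> T = scalar_matrix F 1 c \<star> v" using v c by (simp add: scalar_mul[of c v 1 n])
  then obtain B C where BC: "B \<in> K (n - 1) 1" "C \<in> K (n - 1) (n - 1)"
      "vcat v W \<star> T = blk (scalar_matrix F 1 c) B C \<star> vcat v W"
    using block_of_invariant[OF full_rank_K[OF v(1)] W n _ T, of "scalar_matrix F 1 c"] c by (metis scalar_K)
  have "blk (scalar_matrix F 1 c) B C \<in> K n n"
    using blk_K[OF scalar_K[OF c, of 1] BC(1,2)] n by simp
  then have "cp n T = cp n (blk (scalar_matrix F 1 c) B C)" using cp_similar[OF W(2) T _ BC(3)] by simp
  also have "\<dots> = [\<one>, \<ominus> c] \<otimes>\<^bsub>R\<^esub> cp (n - 1) C"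
    using cp_blk[OF scalar_K[OF c, of 1] BC(1,2)] n cp_single[OF c] by simp
  finally show thesis using that W BC by blast
qed

text \<open>In one direction an eigenvector splits off the factor t - c. In the other, the value at
  c is the determinant of c - A, which is nonzero by \<open>phi_det_nonzero\<close> when that matrix
  is invertible.\<close>

lemma cp_root_iff:
  assumes c: "c \<in> carrier F" and A: "A \<in> K n n"
  shows "eval (cp n A) c = \<zero> \<longleftrightarrow> A \<boxminus> scalar_matrix F n c \<notin> full_rank n n"
proof
  assume "A \<boxminus> scalar_matrix F n c \<notin> full_rank n n"
  then obtain v where v: "v \<in> full_rank 1 n" "v \<star> A = sc c v" using not_full_rank_eigenvector[OF c A] by blast
  obtain C where C: "C \<in> K (n - 1) (n - 1)" "cp n A = [\<one>, \<ominus> c] \<otimes>\<^bsub>R\<^esub> cp (n - 1) C"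
    using cp_eigenvector[OF c A v] by metis
  have "eval [\<one>, \<ominus> c] c = \<zero>" unfolding eval_linear[OF c c] using c by (simp add: a_minus_def r_neg)
  then show "eval (cp n A) c = \<zero>" using C eval_hom[OF c] linear_closed[OF c] by (metis cp_closed l_null)
next
  assume e: "eval (cp n A) c = \<zero>"
  obtain A' c' where A': "A' \<in> carrier_mat n n" "A = map_mat phi A'" "c = phi c'"
    using lift[OF A] lift_elem[OF c] by metis
  have M: "c' \<cdot>\<^sub>m 1\<^sub>m n - A' \<in> carrier_mat n n" using A' by auto
  have N: "map_mat phi (c' \<cdot>\<^sub>m 1\<^sub>m n - A') = scalar_matrix F n c \<boxminus> A"
    using A' phi.map_mat_minus[of "c' \<cdot>\<^sub>m 1\<^sub>m n" n n A'] by (simp add: phi.map_mat_scalar)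
  have z: "phi (Determinant.det (c' \<cdot>\<^sub>m 1\<^sub>m n - A')) = \<zero>"
    using e A' eval_cp[OF A'(1), of c'] by simp
  show "A \<boxminus> scalar_matrix F n c \<notin> full_rank n n"
  proof
    assume fr: "A \<boxminus> scalar_matrix F n c \<in> full_rank n n"
    \<comment> \<open>The characteristic polynomial is det (t - A), so the sign has to be changed;
      this is done by comparing left kernels.\<close>
    have "scalar_matrix F n c \<boxminus> A \<in> full_rank n n"
    proof (rule full_rank_I)
      show "scalar_matrix F n c \<boxminus> A \<in> K n n" using c A by simp
      fix v assume v: "v \<in> K 1 n" "v \<star> (scalar_matrix F n c \<boxminus> A) = Z 1 n"
      then have "v \<star> A = sc c v"
        using c A minus_eq_Z_iff[of "sc c v" 1 n "v \<star> A"] by (simp add: mul_minus[of _ 1 n _ n] scalar_mul)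
      then show "v = Z 1 n" using eigenvector_iff[OF c A v(1)] full_rank_D[OF fr v(1)] by blast
    qed
    then show False using phi_det_nonzero[OF M] N z by simp
  qed
qed

end

section \<open>Minimal polynomials\<close>

lemma carrier_matrix_ring: "carrier (matrix_ring F n) = M F n n"
  by (simp add: matrix_ring_def M_def)

context finite_field
begin

abbreviation MR :: "nat \<Rightarrow> 'a mat ring" where "MR \<equiv> matrix_ring F"

lemma MR_mult: "A \<in> K n n \<Longrightarrow> B \<in> K n n \<Longrightarrow> A \<otimes>\<^bsub>MR n\<^esub> B = A \<star> B"
  by (simp add: matrix_ring_def mat_mul_def M_dim)

lemma MR_add: "A \<in> K n n \<Longrightarrow> B \<in> K n n \<Longrightarrow> A \<oplus>\<^bsub>MR n\<^esub> B = A \<boxplus> B"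
  by (auto simp: matrix_ring_def mat_plus_def M_dim)

lemma MR_zero: "\<zero>\<^bsub>MR n\<^esub> = Z n n"
  by (auto simp: matrix_ring_def scalar_matrix_def mat_zero_def)

lemma MR_one: "\<one>\<^bsub>MR n\<^esub> = I n"
  by (simp add: matrix_ring_def)

lemma ring_MR: "ring (MR n)"
proof (rule ringI)
  show "abelian_group (MR n)"
  proof (rule abelian_groupI)
    fix A assume "A \<in> carrier (MR n)"
    then have A: "A \<in> K n n" by (simp add: carrier_matrix_ring)
    have "(Z n n \<boxminus> A) \<boxplus> A = Z n n" using A minus_plus_cancel[of "Z n n" n n A] by simp
    then show "\<exists>B\<in>carrier (MR n). B \<oplus>\<^bsub>MR n\<^esub> A = \<zero>\<^bsub>MR n\<^esub>"
      using A by (intro bexI[of _ "Z n n \<boxminus> A"]) (auto simp: MR_add MR_zero carrier_matrix_ring)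
  qed (auto simp: MR_add MR_zero carrier_matrix_ring plus_assoc intro: plus_comm)
  show "Group.monoid (MR n)"
    by (rule monoidI) (auto simp: MR_mult MR_one carrier_matrix_ring mul_assoc[of _ n n _ n _ n])
qed (auto simp: MR_mult MR_add carrier_matrix_ring plus_mul[of _ n n _ _ n] mul_plus[of _ n n _ n])

lemma Units_MR: "Units (MR n) = full_rank n n"
proof (intro equalityI subsetI)
  fix A assume "A \<in> Units (MR n)"
  then obtain B where "A \<in> K n n" "B \<in> K n n" "A \<star> B = I n"
    by (auto simp: Units_def carrier_matrix_ring MR_mult MR_one)
  then show "A \<in> full_rank n n" using full_rank_of_right_inverse by blast
next
  fix A assume A: "A \<in> full_rank n n"
  then obtain B where "B \<in> full_rank n n" "B \<star> A = I n" "A \<star> B = I n" using full_rank_square_inverse by metis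
  then show "A \<in> Units (MR n)"
    using A full_rank_K[of A n n] full_rank_K[of B n n]
    by (auto simp: Units_def carrier_matrix_ring MR_mult MR_one)
qed

abbreviation pam :: "nat \<Rightarrow> 'a list \<Rightarrow> 'a mat \<Rightarrow> 'a mat" where "pam n f T \<equiv> poly_at_matrix F n f T"

lemma pam_Nil: "pam n [] T = Z n n"
  using ring.eval.simps(1)[OF ring_MR] by (simp add: poly_at_matrix_def MR_zero)

lemma pam_closed [simp]: "set f \<subseteq> carrier F \<Longrightarrow> T \<in> K n n \<Longrightarrow> pam n f T \<in> K n n"
  unfolding poly_at_matrix_def carrier_matrix_ring[symmetric]
  by (rule ring.eval_in_carrier[OF ring_MR]) (auto simp: carrier_matrix_ring)

lemma pam_snoc:
  assumes "set f \<subseteq> carrier F" "b \<in> carrier F" "T \<in> K n n"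
  shows "pam n (f @ [b]) T = pam n f T \<star> T \<boxplus> scalar_matrix F n b"
proof -
  have "pam n (f @ [b]) T = pam n f T \<otimes>\<^bsub>MR n\<^esub> T \<oplus>\<^bsub>MR n\<^esub> scalar_matrix F n b"
    unfolding poly_at_matrix_def map_append list.map
    by (rule ring.eval_append_aux[OF ring_MR]) (use assms in \<open>auto simp: carrier_matrix_ring\<close>)
  then show ?thesis
    using assms MR_add[OF mul_K[OF pam_closed[OF assms(1,3)] assms(3)] scalar_K[OF assms(2)]]
    by (simp add: MR_mult)
qed

text \<open>The counterpart of the Horner step \<open>pam_snoc\<close>, at the other end of the
  list. It allows two lists of equal length to be subtracted entry by entry.\<close>

lemma pam_Cons:
  assumes "set f \<subseteq> carrier F" "b \<in> carrier F" "T \<in> K n n"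
  shows "pam n (b # f) T = sc b (T [^]\<^bsub>MR n\<^esub> length f) \<boxplus> pam n f T" "T [^]\<^bsub>MR n\<^esub> length f \<in> K n n"
proof -
  interpret MR: ring "MR n" by (rule ring_MR)
  show p: "T [^]\<^bsub>MR n\<^esub> length f \<in> K n n"
    using MR.nat_pow_closed[of T] assms by (simp add: carrier_matrix_ring)
  have "pam n (b # f) T = scalar_matrix F n b \<otimes>\<^bsub>MR n\<^esub> T [^]\<^bsub>MR n\<^esub> length f \<oplus>\<^bsub>MR n\<^esub> pam n f T"
    by (simp add: poly_at_matrix_def)
  then show "pam n (b # f) T = sc b (T [^]\<^bsub>MR n\<^esub> length f) \<boxplus> pam n f T"
    using assms p by (simp add: MR_mult MR_add scalar_mul)
qed

lemma pam_similar:
  assumes P: "P \<in> K n n" and T: "T \<in> K n n" and S: "S \<in> K n n" and eq: "P \<star> T = S \<star> P"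
    and f: "set f \<subseteq> carrier F"
  shows "P \<star> pam n f T = pam n f S \<star> P"
  using f
proof (induction f rule: rev_induct)
  case Nil
  then show ?case using P by (simp add: pam_Nil)
next
  case (snoc b f)
  then have f: "set f \<subseteq> carrier F" "b \<in> carrier F" by auto
  have "P \<star> (pam n f T \<star> T) = pam n f S \<star> S \<star> P"
    using snoc f P T S eq mul_assoc[of P n n "pam n f T" n T n] mul_assoc[of "pam n f S" n n P n T n]
      mul_assoc[of "pam n f S" n n S n P n] by simp
  then show ?case
    using f P T S by (simp add: pam_snoc mul_plus[of _ n n _ n] plus_mul[of _ n n _ _ n] scalar_mul[of _ _ n n]
        mul_K[of _ n n _ n])
qed

lemma pam_scale:
  assumes c: "c \<in> carrier F" and T: "T \<in> K n n" and f: "set f \<subseteq> carrier F"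
  shows "pam n (map (\<lambda>a. c \<otimes> a) f) T = sc c (pam n f T)"
  using f
proof (induction f rule: rev_induct)
  case Nil
  then show ?case using c by (simp add: pam_Nil)
next
  case (snoc b f)
  then have f: "set f \<subseteq> carrier F" "b \<in> carrier F" "set (map (\<lambda>a. c \<otimes> a) f) \<subseteq> carrier F" using c by auto
  have "scalar_matrix F n (c \<otimes> b) = sc c (scalar_matrix F n b)"
    using c by (intro eq_matI) (auto simp: scalar_matrix_def mat_scale_def)
  then show ?case
    using snoc f c T pam_snoc[OF f(3) _ T, of "c \<otimes> b"]
    by (simp add: pam_snoc sc_plus[of _ _ n n] mul_sc[of _ _ n n _ n] mul_K[of _ n n _ n])
qed

text \<open>The entrywise difference keeps its leading zeros and so need not be an element of
  \<open>poly_ring F\<close>; \<open>annihilates_of_list\<close> repairs that afterwards.\<close>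

lemma pam_diff:
  assumes T: "T \<in> K n n" and "length f = length g" "set f \<subseteq> carrier F" "set g \<subseteq> carrier F"
    and "pam n f T = pam n g T"
  shows "pam n (map2 (\<lambda>a b. a \<ominus> b) f g) T = Z n n"
proof -
  have "pam n (map2 (\<lambda>a b. a \<ominus> b) f g) T = pam n f T \<boxminus> pam n g T"
    using assms(2-4)
  proof (induction f g rule: list_induct2)
    case Nil
    then show ?case by (simp add: pam_Nil)
  next
    case (Cons a f b g)
    have s: "set (map2 (\<lambda>a b. a \<ominus> b) f g) \<subseteq> carrier F"
      using Cons.prems by (auto dest: set_zip_leftD set_zip_rightD)
    let ?p = "T [^]\<^bsub>MR n\<^esub> length f"
    have p: "?p \<in> K n n" using pam_Cons(2)[OF _ zero_closed T, of f] Cons.prems by simp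
    have "pam n (map2 (\<lambda>a b. a \<ominus> b) (a # f) (b # g)) T = sc (a \<ominus> b) ?p \<boxplus> (pam n f T \<boxminus> pam n g T)"
      using Cons pam_Cons(1)[OF s _ T, of "a \<ominus> b"] by simp
    also have "\<dots> = (sc a ?p \<boxplus> pam n f T) \<boxminus> (sc b ?p \<boxplus> pam n g T)"
    proof (rule M_eqI[of _ F n n])
      have fg: "pam n f T \<in> K n n" "pam n g T \<in> K n n" using Cons.prems T by auto
      then show "sc (a \<ominus> b) ?p \<boxplus> (pam n f T \<boxminus> pam n g T) \<in> K n n"
        "(sc a ?p \<boxplus> pam n f T) \<boxminus> (sc b ?p \<boxplus> pam n g T) \<in> K n n"
        using p Cons.prems by auto
      fix i j assume ij: "i < n" "j < n"
      have e: "?p $$ (i, j) \<in> carrier F" "pam n f T $$ (i, j) \<in> carrier F" "pam n g T $$ (i, j) \<in> carrier F"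
        "a \<in> carrier F" "b \<in> carrier F"
        using M_entry[OF p ij] M_entry[OF fg(1) ij] M_entry[OF fg(2) ij] Cons.prems by auto
      show "(sc (a \<ominus> b) ?p \<boxplus> (pam n f T \<boxminus> pam n g T)) $$ (i, j)
          = ((sc a ?p \<boxplus> pam n f T) \<boxminus> (sc b ?p \<boxplus> pam n g T)) $$ (i, j)"
        using ij e M_dim[OF p] M_dim[OF fg(1)]
        by (simp add: mat_plus_def mat_minus_def mat_scale_def a_minus_def l_distr l_minus minus_add a_ac)
    qed
    also have "\<dots> = pam n (a # f) T \<boxminus> pam n (b # g) T"
      using Cons pam_Cons(1)[OF _ _ T, of f a] pam_Cons(1)[OF _ _ T, of g b] by simp
    finally show ?case .
  qed
  then show ?thesis using assms minus_eq_Z_iff[of "pam n f T" n n "pam n g T"] by simp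
qed

definition annihilates :: "nat \<Rightarrow> 'a mat \<Rightarrow> 'a list \<Rightarrow> bool" where
  "annihilates n T f \<longleftrightarrow> f \<in> carrier R \<and> f \<noteq> [] \<and> pam n f T = Z n n"

lemma carrier_R_set: "f \<in> carrier R \<Longrightarrow> set f \<subseteq> carrier F"
  by (auto simp: univ_poly_carrier[symmetric] polynomial_def)

lemma annihilates_of_list:
  assumes T: "T \<in> K n n" and "set f \<subseteq> carrier F" "pam n f T = Z n n" "\<exists>a\<in>set f. a \<noteq> \<zero>"
  shows "\<exists>g. annihilates n T g \<and> length g \<le> length f"
  using assms(2-4)
proof (induction f)
  case (Cons a f)
  show ?case
  proof (cases "a = \<zero>")
    case True
    have sf: "set f \<subseteq> carrier F" using Cons.prems(1) by auto
    have "pam n f T = Z n n"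
      using Cons.prems(2) pam_Cons[OF sf zero_closed T] pam_closed[OF sf T] True by simp
    moreover have "\<exists>a\<in>set f. a \<noteq> \<zero>" using Cons.prems(3) True by auto
    ultimately have "\<exists>g. annihilates n T g \<and> length g \<le> length f"
      using Cons.IH[OF sf] by blast
    then show ?thesis by (metis le_SucI length_Cons)
  next
    case False
    then show ?thesis using Cons.prems
      by (intro exI[of _ "a # f"]) (auto simp: annihilates_def univ_poly_carrier[symmetric] polynomial_def)
  qed
qed simp

text \<open>\<open>min_polynomial\<close> is a definite description, so nothing is known about it
  before existence and uniqueness are shown. A shortest annihilating polynomial can be scaled to be
  monic, and the difference of two monic ones of the same length would give a shorter one.\<close>

lemma length_min_polynomial_le:
  assumes T: "T \<in> K n n" and f: "annihilates n T f"
  shows "length (min_polynomial F n T) \<le> length f"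
proof -
  define k where "k = (LEAST k. \<exists>g. annihilates n T g \<and> length g = k)"
  have ex: "\<exists>g. annihilates n T g \<and> length g = k"
    unfolding k_def by (rule LeastI_ex) (use f in blast)
  have le: "k \<le> length g" if "annihilates n T g" for g
    unfolding k_def by (rule Least_le) (use that in blast)
  obtain g where g: "annihilates n T g" "length g = k" using ex by blast
  then obtain b l where bl: "g = b # l" by (cases g) (auto simp: annihilates_def)
  have b: "b \<in> carrier F" "b \<noteq> \<zero>" "set g \<subseteq> carrier F"
    using g bl carrier_R_set by (auto simp: annihilates_def univ_poly_carrier[symmetric] polynomial_def)
  then have ib: "inv b \<in> carrier F" "inv b \<otimes> b = \<one>" by (auto simp: field_Units)
  let ?Q = "\<lambda>m. m \<in> carrier R \<and> m \<noteq> [] \<and> hd m = \<one> \<and> pam n m T = \<zero>\<^bsub>MR n\<^esub> \<and>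
             (\<forall>f\<in>carrier R. f \<noteq> [] \<and> pam n f T = \<zero>\<^bsub>MR n\<^esub> \<longrightarrow> length m \<le> length f)"
  \<comment> \<open>The minimality clause amounts to having length k, because the length k is
    attained.\<close>
  have Q_iff: "?Q m \<longleftrightarrow> annihilates n T m \<and> hd m = \<one> \<and> length m = k" for m
    using le ex by (auto simp: annihilates_def MR_zero) (metis le_antisym)
  let ?m = "map (\<lambda>a. inv b \<otimes> a) g"
  have "?Q ?m"
    unfolding Q_iff
    using g b ib bl pam_scale[OF ib(1) T b(3)]
    by (auto simp: annihilates_def univ_poly_carrier[symmetric] polynomial_def)
  moreover have "m = m'" if "?Q m" "?Q m'" for m m'
  proof (rule ccontr)
    assume ne: "m \<noteq> m'"
    have m: "annihilates n T m" "hd m = \<one>" "length m = k" and m': "annihilates n T m'" "hd m' = \<one>" "length m' = k"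
      using that Q_iff by blast+
    obtain a a' where a: "m = \<one> # a" "m' = \<one> # a'"
      using m m' by (cases m; cases m') (auto simp: annihilates_def)
    have sa: "set a \<subseteq> carrier F" "set a' \<subseteq> carrier F" "length a = length a'"
      using carrier_R_set[of m] carrier_R_set[of m'] m m' a by (auto simp: annihilates_def)
    have cl: "pam n a T \<in> K n n" "pam n a' T \<in> K n n" "T [^]\<^bsub>MR n\<^esub> length a \<in> K n n"
      using sa T pam_Cons(2)[OF sa(1) one_closed T] by auto
    have "T [^]\<^bsub>MR n\<^esub> length a \<boxplus> pam n a T = T [^]\<^bsub>MR n\<^esub> length a \<boxplus> pam n a' T"
      using m m' a sa T cl pam_Cons(1)[OF sa(1) one_closed T] pam_Cons(1)[OF sa(2) one_closed T]
      by (simp add: annihilates_def)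
    then have "pam n a T = pam n a' T" using cl plus_comm plus_minus_cancel by metis
    then have z: "pam n (map2 (\<lambda>a b. a \<ominus> b) a a') T = Z n n" using pam_diff[OF T] sa by simp
    have "\<exists>x\<in>set (map2 (\<lambda>a b. a \<ominus> b) a a'). x \<noteq> \<zero>"
    proof (rule ccontr)
      assume neg: "\<not> (\<exists>x\<in>set (map2 (\<lambda>a b. a \<ominus> b) a a'). x \<noteq> \<zero>)"
      have "a ! i = a' ! i" if i: "i < length a" for i
      proof -
        have "a ! i \<ominus> a' ! i \<in> set (map2 (\<lambda>a b. a \<ominus> b) a a')" using i sa(3) by (force simp: set_zip)
        then have "a ! i \<ominus> a' ! i = \<zero>" using neg by blast
        then show ?thesis using i sa nth_mem[of i a] nth_mem[of i a'] by (simp add: subset_iff)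
      qed
      then have "a = a'" using sa(3) by (rule nth_equalityI[rotated])
      then show False using ne a by simp
    qed
    moreover have "set (map2 (\<lambda>a b. a \<ominus> b) a a') \<subseteq> carrier F"
      using sa by (auto dest: set_zip_leftD set_zip_rightD)
    ultimately obtain g' where "annihilates n T g'" "length g' \<le> length (map2 (\<lambda>a b. a \<ominus> b) a a')"
      using annihilates_of_list[OF T _ z] by blast
    then show False using le[of g'] m a sa by simp
  qed
  ultimately have "?Q (min_polynomial F n T)"
    unfolding min_polynomial_def by (intro theI'[of ?Q]) blast
  then show ?thesis using Q_iff le[OF f] by simp
qed

lemma pam_phi:
  assumes "T \<in> carrier_mat n n"
  shows "pam n (map phi (rev (coeffs p))) (map_mat phi T) = map_mat phi (poly_mat n T p)"
proof (induction p)
  case 0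
  then show ?case by (simp add: pam_Nil poly_mat_0[OF assms] phi.map_mat_zero)
next
  case (pCons a p)
  have s: "set (map phi (rev (coeffs p))) \<subseteq> carrier F" by auto
  have c: "coeffs (pCons a p) = a # coeffs p" using pCons by (auto simp: cCons_def)
  have sm: "a \<cdot>\<^sub>m 1\<^sub>m n \<in> carrier_mat n n" by simp
  show ?case
    unfolding c rev.simps map_append list.map
    using pCons pam_snoc[OF s phi.closed[of a] phi.map_mat_M[OF assms]]
      phi.map_mat_mult[OF poly_mat_carrier[OF assms] assms, of p]
      phi.map_mat_add[OF mult_carrier_mat[OF poly_mat_carrier[OF assms] assms] sm, of p]
    by (simp add: poly_mat_pCons[OF assms] phi.map_mat_scalar)
qed

text \<open>In a basis that extends the eigenplane the complementary block C has size n - 2. So (t -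
  c) times its characteristic polynomial has degree n - 1 and annihilates T, while the
  characteristic polynomial of T has degree n.\<close>

theorem not_cyclic_of_eigenplane:
  assumes c: "c \<in> carrier F" and T: "T \<in> K n n" and V: "V \<in> full_rank 2 n" "V \<star> T = sc c V"
  shows "\<not> cyclic_matrix F n T"
proof -
  have n: "n = 2 + (n - 2)" using full_rank_le[OF V(1)] by simp
  define e where "e = n - 2"
  obtain W where W: "W \<in> K e n" "vcat V W \<in> full_rank n n" using full_rank_complete[OF V(1)] by (auto simp: e_def)
  have "V \<star> T = scalar_matrix F 2 c \<star> V" using V c by (simp add: scalar_mul[of c V 2 n])
  then obtain B C where BC: "B \<in> K e 2" "C \<in> K e e"
      "vcat V W \<star> T = blk (scalar_matrix F 2 c) B C \<star> vcat V W"
    using block_of_invariant[OF full_rank_K[OF V(1)] W, of "scalar_matrix F 2 c" T] c n T by (metis e_def scalar_K)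
  obtain c' B' C' where l: "c = phi c'" "B' \<in> carrier_mat e 2" "B = map_mat phi B'" "C' \<in> carrier_mat e e" "C = map_mat phi C'"
    using lift[OF BC(1)] lift[OF BC(2)] lift_elem[OF c] by metis
  let ?S = "four_block_mat (c' \<cdot>\<^sub>m 1\<^sub>m 2) (0\<^sub>m 2 e) B' C'"
  let ?p = "[:- c', 1:] * char_poly C'"
  have S: "?S \<in> carrier_mat n n" using l n e_def by (metis four_block_carrier_mat one_carrier_mat smult_carrier_mat)
  have Sb: "map_mat phi ?S = blk (scalar_matrix F 2 c) B C"
    using l by (intro eq_matI) (auto simp: blk_def vcat_def hcat_def mat_zero_def scalar_matrix_def phi.hom_zero phi.hom_one)
  have "poly_mat n ?S ?p = 0\<^sub>m n n"
    using poly_mat_block_annihilates[OF l(2,4), of c'] n e_def by simp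
  then have z: "pam n (map phi (rev (coeffs ?p))) (map_mat phi ?S) = Z n n"
    by (simp only: pam_phi[OF S] phi.map_mat_zero)
  have dmat: "degree (char_poly C') = e" "lead_coeff (char_poly C') = 1"
    using degree_monic_char_poly[OF l(4)] by auto
  have nz: "char_poly C' \<noteq> 0" using dmat by auto
  have lc: "lead_coeff ?p = 1" using dmat lead_coeff_mult[of "[:- c', 1:]" "char_poly C'"] by simp
  have dp: "degree ?p = e + 1" using dmat nz degree_mult_eq[of "[:- c', 1:]" "char_poly C'"] by simp
  define f where "f = map phi (rev (coeffs ?p))"
  have fc: "f \<in> carrier R" using psi_monic[OF lc] psi.closed[of ?p] by (simp only: f_def)
  have "?p \<noteq> 0" using lc by auto
  \<comment> \<open>A list is one longer than the degree: n here, against n + 1 for the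
    characteristic polynomial.\<close>
  then have lf: "length f = n" using dp n length_coeffs_degree[of ?p] by (simp add: f_def e_def)
  have PT: "vcat V W \<star> pam n f T = pam n f (map_mat phi ?S) \<star> vcat V W"
    using pam_similar[OF full_rank_K[OF W(2)] T phi.map_mat_M[OF S] _ carrier_R_set[OF fc]] BC(3) Sb by simp
  then have PZ: "vcat V W \<star> pam n f T = Z n n" using z W by (simp add: f_def)
  obtain Q where Q: "Q \<in> full_rank n n" "Q \<star> vcat V W = I n" using full_rank_square_inverse[OF W(2)] by metis
  have "pam n f T = Z n n"
    using mul_assoc[OF full_rank_K[OF Q(1)] full_rank_K[OF W(2)] pam_closed[OF carrier_R_set[OF fc] T]] PZ Q
      pam_closed[OF carrier_R_set[OF fc] T] Z_mul(2)[OF full_rank_K[OF Q(1)], of n] by simp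
  then have "annihilates n T f" using fc lf n by (auto simp: annihilates_def)
  then have "length (min_polynomial F n T) \<le> n" using length_min_polynomial_le[OF T] lf by metis
  then show ?thesis using length_cp[OF T] by (auto simp: cyclic_matrix_def)
qed

section \<open>Simple roots\<close>

text \<open>Multiplicity exactly one, expressed by a cofactor, so that products of characteristic
  polynomials can be treated by evaluating the cofactor.\<close>

definition simple_root :: "'a \<Rightarrow> 'a list \<Rightarrow> bool" where
  "simple_root c p \<longleftrightarrow> (\<exists>h\<in>carrier R. p = [\<one>, \<ominus> c] \<otimes>\<^bsub>R\<^esub> h \<and> eval h c \<noteq> \<zero>)"

lemma linear_nonzero: "[\<one>, \<ominus> c] \<noteq> \<zero>\<^bsub>R\<^esub>"
  by (simp add: univ_poly_zero)

lemma simple_root_iff: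
  assumes "c \<in> carrier F" "h \<in> carrier R" "p = [\<one>, \<ominus> c] \<otimes>\<^bsub>R\<^esub> h"
  shows "simple_root c p \<longleftrightarrow> eval h c \<noteq> \<zero>"
  using assms UP.m_lcancel[OF linear_nonzero linear_closed[OF assms(1)]] unfolding simple_root_def by metis

lemma linear_pdivides_iff:
  assumes c: "c \<in> carrier F" and p: "p \<in> carrier R"
  shows "[\<one>, \<ominus> c] pdivides p \<longleftrightarrow> eval p c = \<zero>"
proof (cases "p = []")
  case True
  then show ?thesis using pdivides_zero[OF carrier_is_subring linear_closed[OF c]] by simp
next
  case False
  then show ?thesis
    using pdivides_imp_is_root[OF False c] is_root_imp_pdivides[OF p, of c] c by (auto simp: is_root_def)
qed

text \<open>Each factor contains t - c once already. Cancelling (t - c)^2 in the domain leaves the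
  question whether t - c divides h h', which evaluation at c decides.\<close>

lemma cube_not_pdivides_iff:
  assumes c: "c \<in> carrier F" and h: "h \<in> carrier R" "h' \<in> carrier R"
  shows "\<not> ([\<one>, \<ominus> c] [^]\<^bsub>R\<^esub> (3::nat)) pdivides (([\<one>, \<ominus> c] \<otimes>\<^bsub>R\<^esub> h) \<otimes>\<^bsub>R\<^esub> ([\<one>, \<ominus> c] \<otimes>\<^bsub>R\<^esub> h'))
    \<longleftrightarrow> eval h c \<noteq> \<zero> \<and> eval h' c \<noteq> \<zero>"
proof -
  let ?l = "[\<one>, \<ominus> c]"
  note l = linear_closed[OF c] linear_nonzero[of c]
  have 3: "?l [^]\<^bsub>R\<^esub> (3::nat) = (?l \<otimes>\<^bsub>R\<^esub> ?l) \<otimes>\<^bsub>R\<^esub> ?l"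
    using l by (simp add: numeral_3_eq_3)
  have 2: "(?l \<otimes>\<^bsub>R\<^esub> h) \<otimes>\<^bsub>R\<^esub> (?l \<otimes>\<^bsub>R\<^esub> h') = (?l \<otimes>\<^bsub>R\<^esub> ?l) \<otimes>\<^bsub>R\<^esub> (h \<otimes>\<^bsub>R\<^esub> h')"
    using l h by (simp add: UP.m_ac)
  have "(?l [^]\<^bsub>R\<^esub> (3::nat)) pdivides ((?l \<otimes>\<^bsub>R\<^esub> h) \<otimes>\<^bsub>R\<^esub> (?l \<otimes>\<^bsub>R\<^esub> h')) \<longleftrightarrow> ?l pdivides (h \<otimes>\<^bsub>R\<^esub> h')"
    unfolding 2 3 pdivides_def factor_def
    using l h UP.m_lcancel[of "?l \<otimes>\<^bsub>R\<^esub> ?l"] UP.integral_iff[of ?l ?l]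
    by (metis (no_types, lifting) UP.m_assoc UP.m_closed)
  then show ?thesis
    using h c linear_pdivides_iff[OF c, of "h \<otimes>\<^bsub>R\<^esub> h'"] eval_hom[OF c] by (simp add: integral_iff)
qed

end

section \<open>Invertible matrices without prescribed eigenvalues\<close>

context finite_field
begin

lemma blk_minus:
  assumes "D \<in> K a a" "B \<in> K b a" "C \<in> K b b" "c \<in> carrier F"
  shows "blk D B C \<boxminus> scalar_matrix F (a + b) c = blk (D \<boxminus> scalar_matrix F a c) B (C \<boxminus> scalar_matrix F b c)"
  using assms by (intro eq_matI)
    (auto simp: blk_def vcat_def hcat_def mat_minus_def mat_zero_def scalar_matrix_def M_dim M_entry a_minus_def)

lemma blk_full_rank_iff:
  assumes D: "D \<in> K a a" and B: "B \<in> K b a" and C: "C \<in> K b b"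
  shows "blk D B C \<in> full_rank (a + b) (a + b) \<longleftrightarrow> D \<in> full_rank a a \<and> C \<in> full_rank b b"
proof
  assume fr: "blk D B C \<in> full_rank (a + b) (a + b)"
  have D': "D \<in> full_rank a a"
  proof (rule full_rank_I[OF D])
    fix u assume u: "u \<in> K 1 a" "u \<star> D = Z 1 a"
    have "hcat u (Z 1 b) \<star> blk D B C = Z 1 (a + b)"
      using hcat_blk[OF D B C u(1) Z_K[of 1 b]] u B C by (simp add: hcat_Z)
    then have "hcat u (Z 1 b) = hcat (Z 1 a) (Z 1 b)"
      using full_rank_D[OF fr hcat_M[OF u(1) Z_K]] by (simp add: hcat_Z)
    then show "u = Z 1 a" using hcat_inj[OF u(1) Z_K Z_K Z_K] by blast
  qed
  obtain Q where Q: "Q \<in> full_rank a a" "Q \<star> D = I a" using full_rank_square_inverse[OF D'] by metis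
  have "C \<in> full_rank b b"
  proof (rule full_rank_I[OF C])
    fix w assume w: "w \<in> K 1 b" "w \<star> C = Z 1 b"
    have wB: "w \<star> B \<in> K 1 a" using w B by simp
    \<comment> \<open>Chosen so that u D = - w B, which makes (u, w) a kernel vector of the block
      matrix.\<close>
    define u where "u = Z 1 a \<boxminus> w \<star> B \<star> Q"
    have wBQ: "w \<star> B \<star> Q \<in> K 1 a" using mul_K[OF wB full_rank_K[OF Q(1)]] .
    then have u: "u \<in> K 1 a" by (simp add: u_def)
    have "u \<star> D = Z 1 a \<boxminus> w \<star> B"
      using minus_mul[OF Z_K wBQ D] mul_assoc[OF wB full_rank_K[OF Q(1)] D] Q wB D by (simp add: u_def)
    then have "u \<star> D \<boxplus> w \<star> B = Z 1 a" using minus_plus_cancel[OF Z_K wB] by simp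
    then have "hcat u w \<star> blk D B C = Z 1 (a + b)"
      using hcat_blk[OF D B C u w(1)] w by (simp add: hcat_Z)
    then have "hcat u w = hcat (Z 1 a) (Z 1 b)"
      using full_rank_D[OF fr hcat_M[OF u w(1)]] by (simp add: hcat_Z)
    then show "w = Z 1 b" using hcat_inj[OF u w(1) Z_K Z_K] by blast
  qed
  with D' show "D \<in> full_rank a a \<and> C \<in> full_rank b b" by simp
next
  assume fr: "D \<in> full_rank a a \<and> C \<in> full_rank b b"
  show "blk D B C \<in> full_rank (a + b) (a + b)"
  proof (rule full_rank_I)
    show "blk D B C \<in> K (a + b) (a + b)" using D B C by simp
    fix v assume v: "v \<in> K 1 (a + b)" "v \<star> blk D B C = Z 1 (a + b)"
    obtain u w where uw: "u \<in> K 1 a" "w \<in> K 1 b" "v = hcat u w" using hcat_cases[OF v(1)] .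
    have "hcat (u \<star> D \<boxplus> w \<star> B) (w \<star> C) = hcat (Z 1 a) (Z 1 b)"
      using v uw hcat_blk[OF D B C uw(1,2)] by (simp add: hcat_Z)
    moreover have "u \<star> D \<boxplus> w \<star> B \<in> K 1 a" "w \<star> C \<in> K 1 b" using uw D B C by auto
    ultimately have e: "u \<star> D \<boxplus> w \<star> B = Z 1 a" "w \<star> C = Z 1 b"
      using hcat_inj[of "u \<star> D \<boxplus> w \<star> B" F 1 a "w \<star> C" b "Z 1 a" "Z 1 b"] by auto
    then have w: "w = Z 1 b" using full_rank_D uw fr by blast
    then have "u \<star> D = Z 1 a" using e uw D B mul_K[OF uw(1) D] by simp
    then have "u = Z 1 a" using full_rank_D uw fr by blast
    then show "v = Z 1 (a + b)" using uw w by (simp add: hcat_Z)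
  qed
qed

text \<open>If 0 lies in S the elements are invertible, and S = {0} gives the whole general linear
  group; one notion covers both kinds of condition.\<close>

definition eigfree :: "nat \<Rightarrow> 'a set \<Rightarrow> 'a mat set" where
  "eigfree m S = {A \<in> K m m. \<forall>c\<in>S. A \<boxminus> scalar_matrix F m c \<in> full_rank m m}"

lemma eigfree_K: "A \<in> eigfree m S \<Longrightarrow> A \<in> K m m"
  by (simp add: eigfree_def)

lemma finite_full_rank: "finite (full_rank k m)"
  by (rule finite_subset[OF subsetI[OF full_rank_K] card_K(1)])

lemma finite_eigfree: "finite (eigfree m S)"
  by (rule finite_subset[OF _ card_K(1)]) (auto simp: eigfree_def)

lemma eigfree_zero: "eigfree m {\<zero>} = full_rank m m"
proof -
  have "scalar_matrix F m \<zero> = Z m m" by (intro eq_matI) (auto simp: scalar_matrix_def mat_zero_def)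
  moreover have "A \<boxminus> Z m m = A" if "A \<in> K m m" for A using that by simp
  ultimately show ?thesis using full_rank_K by (auto simp: eigfree_def)
qed

lemma eigfree_insert: "eigfree m (insert c S) = {A \<in> eigfree m S. A \<boxminus> scalar_matrix F m c \<in> full_rank m m}"
  by (auto simp: eigfree_def)

lemma scalar_eigfree:
  assumes "c \<in> carrier F" "S \<subseteq> carrier F" "c \<notin> S"
  shows "scalar_matrix F d c \<in> eigfree d S"
proof -
  have "scalar_matrix F d c \<boxminus> scalar_matrix F d s \<in> full_rank d d" if s: "s \<in> S" for s
  proof -
    have "s \<in> carrier F" "c \<ominus> s \<noteq> \<zero>" using s assms by auto
    moreover have "scalar_matrix F d c \<boxminus> scalar_matrix F d s = scalar_matrix F d (c \<ominus> s)"
      by (intro eq_matI) (auto simp: mat_minus_def scalar_matrix_def a_minus_def)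
    ultimately show ?thesis using full_rank_scalar[of "c \<ominus> s" d] assms by simp
  qed
  then show ?thesis using assms by (simp add: eigfree_def)
qed

lemma eigfree_similar:
  assumes P: "P \<in> full_rank n n" and T: "T \<in> K n n" and W: "W \<in> K n n" and eq: "P \<star> T = W \<star> P"
    and S: "S \<subseteq> carrier F"
  shows "T \<in> eigfree n S \<longleftrightarrow> W \<in> eigfree n S"
proof -
  have "T \<boxminus> scalar_matrix F n c \<in> full_rank n n \<longleftrightarrow> W \<boxminus> scalar_matrix F n c \<in> full_rank n n" if "c \<in> S" for c
  proof (rule full_rank_conj_iff[OF P])
    have c: "c \<in> carrier F" using that S by blast
    show "T \<boxminus> scalar_matrix F n c \<in> K n n" "W \<boxminus> scalar_matrix F n c \<in> K n n" using T W c by auto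
    show "P \<star> (T \<boxminus> scalar_matrix F n c) = (W \<boxminus> scalar_matrix F n c) \<star> P"
      using eq mul_minus[OF full_rank_K[OF P] T scalar_K[OF c]] minus_mul[OF W scalar_K[OF c] full_rank_K[OF P]]
        scalar_mul[OF c full_rank_K[OF P]] by simp
  qed
  then show ?thesis using T W by (simp add: eigfree_def)
qed

lemma block_eigfree_iff:
  assumes "D \<in> K a a" "B \<in> K b a" "C \<in> K b b" "S \<subseteq> carrier F"
  shows "blk D B C \<in> eigfree (a + b) S \<longleftrightarrow> D \<in> eigfree a S \<and> C \<in> eigfree b S"
proof -
  have "blk D B C \<boxminus> scalar_matrix F (a + b) c \<in> full_rank (a + b) (a + b) \<longleftrightarrow>
      D \<boxminus> scalar_matrix F a c \<in> full_rank a a \<and> C \<boxminus> scalar_matrix F b c \<in> full_rank b b" if "c \<in> S" for c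
  proof -
    have c: "c \<in> carrier F" using that assms by blast
    show ?thesis using blk_minus[OF assms(1-3) c] blk_full_rank_iff[of "D \<boxminus> scalar_matrix F a c" a B b] assms c by simp
  qed
  then show ?thesis using assms by (auto simp: eigfree_def)
qed

text \<open>In a basis that starts with the rows of U, prescribing the action on them fixes the
  upper blocks and leaves B and C free. Counts of matrices with a prescribed action are taken from
  this bijection.\<close>

lemma block_bij:
  assumes U: "U \<in> full_rank d m" and D: "D \<in> K d d" and m: "m = d + e"
  obtains f P where "bij_betw f (K e d \<times> K e e) {T \<in> K m m. U \<star> T = D \<star> U}" "P \<in> full_rank m m"
    "\<forall>B\<in>K e d. \<forall>C\<in>K e e. P \<star> f (B, C) = blk D B C \<star> P"
proof -
  obtain W where W: "W \<in> K e m" "vcat U W \<in> full_rank m m" using full_rank_complete[OF U] m by auto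
  define P where "P = vcat U W"
  have P: "P \<in> full_rank m m" using W by (simp add: P_def)
  obtain Q where Q: "Q \<in> full_rank m m" "Q \<star> P = I m" "P \<star> Q = I m" using full_rank_square_inverse[OF P] .
  note k = full_rank_K[OF U] full_rank_K[OF P] full_rank_K[OF Q(1)]
  define f where "f = (\<lambda>(B, C). Q \<star> (blk D B C \<star> P))"
  have bk: "blk D B C \<in> K m m" if "B \<in> K e d" "C \<in> K e e" for B C using blk_K[OF D that] m by simp
  have fk: "f (B, C) \<in> K m m" if "B \<in> K e d" "C \<in> K e e" for B C
    using mul_K[OF k(3) mul_K[OF bk[OF that] k(2)]] by (simp add: f_def)
  have Pf: "P \<star> f (B, C) = blk D B C \<star> P" if "B \<in> K e d" "C \<in> K e e" for B C
    using mul_assoc[OF k(2,3) mul_K[OF bk[OF that] k(2)]] Q mul_K[OF bk[OF that] k(2)] by (simp add: f_def)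
  have "bij_betw f (K e d \<times> K e e) {T \<in> K m m. U \<star> T = D \<star> U}"
    unfolding bij_betw_def
  proof (intro conjI inj_onI equalityI subsetI)
    fix p p' assume pp: "p \<in> K e d \<times> K e e" "p' \<in> K e d \<times> K e e" "f p = f p'"
    obtain B C B' C' where p: "p = (B, C)" "p' = (B', C')" by fastforce
    have c: "B \<in> K e d" "C \<in> K e e" "B' \<in> K e d" "C' \<in> K e e" using pp p by auto
    have "blk D B C \<star> P = blk D B' C' \<star> P" using Pf[OF c(1,2)] Pf[OF c(3,4)] pp p by simp
    then have "blk D B C = blk D B' C'" using full_rank_cancel[OF P] bk c by blast
    then have "hcat B C = hcat B' C'"
      using vcat_inj[of "hcat D (Z d e)" F d "d + e" "hcat B C" e "hcat D (Z d e)" "hcat B' C'"] c D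
      by (simp add: blk_def M_dim)
    then show "p = p'" using hcat_inj c p by metis
  next
    fix T assume "T \<in> f ` (K e d \<times> K e e)"
    then obtain B C where BC: "B \<in> K e d" "C \<in> K e e" "T = f (B, C)" by auto
    have "vcat (U \<star> T) (W \<star> T) = vcat (D \<star> U) (B \<star> U \<boxplus> C \<star> W)"
      using Pf[OF BC(1,2)] BC vcat_mul[OF k(1) W(1) fk[OF BC(1,2)]] blk_vcat[OF D BC(1,2) k(1) W(1)]
      by (simp add: P_def)
    moreover have "B \<star> U \<boxplus> C \<star> W \<in> K e m" using mul_K[OF BC(1) k(1)] mul_K[OF BC(2) W(1)] by simp
    moreover have "U \<star> T \<in> K d m" "W \<star> T \<in> K e m" "D \<star> U \<in> K d m"
      using mul_K[OF k(1) fk[OF BC(1,2)]] mul_K[OF W(1) fk[OF BC(1,2)]] mul_K[OF D k(1)] BC by auto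
    ultimately have "U \<star> T = D \<star> U" using vcat_inj by metis
    then show "T \<in> {T \<in> K m m. U \<star> T = D \<star> U}" using fk[OF BC(1,2)] BC by simp
  next
    fix T assume "T \<in> {T \<in> K m m. U \<star> T = D \<star> U}"
    then have T: "T \<in> K m m" "U \<star> T = D \<star> U" by auto
    obtain B C where BC: "B \<in> K e d" "C \<in> K e e" "P \<star> T = blk D B C \<star> P"
      using block_of_invariant[OF k(1) W m D T] by (metis P_def)
    have "Q \<star> (P \<star> T) = T" using mul_assoc[OF k(3,2) T(1)] Q T by simp
    then have "T = f (B, C)" using BC by (simp add: f_def)
    then show "T \<in> f ` (K e d \<times> K e e)" using BC by blast
  qed
  then show thesis using that P Pf by blast
qed

text \<open>B is arbitrary and contributes q^(e d); as D already avoids S, the condition falls on C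
  alone.\<close>

lemma card_eigfree_invariant:
  assumes U: "U \<in> full_rank d m" and D: "D \<in> eigfree d S" and m: "m = d + e" and S: "S \<subseteq> carrier F"
  shows "card {T \<in> eigfree m S. U \<star> T = D \<star> U} = q ^ (e * d) * card (eigfree e S)"
proof -
  obtain f P where f: "bij_betw f (K e d \<times> K e e) {T \<in> K m m. U \<star> T = D \<star> U}" "P \<in> full_rank m m"
      "\<forall>B\<in>K e d. \<forall>C\<in>K e e. P \<star> f (B, C) = blk D B C \<star> P"
    using block_bij[OF U eigfree_K[OF D] m] .
  have fk: "f (B, C) \<in> K m m \<and> U \<star> f (B, C) = D \<star> U" if "B \<in> K e d" "C \<in> K e e" for B C
    using bij_betwE[OF f(1)] that by blast
  have iff: "f (B, C) \<in> eigfree m S \<longleftrightarrow> C \<in> eigfree e S" if BC: "B \<in> K e d" "C \<in> K e e" for B C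
  proof -
    have "f (B, C) \<in> eigfree m S \<longleftrightarrow> blk D B C \<in> eigfree m S"
      using eigfree_similar[OF f(2) _ _ f(3)[rule_format, OF BC] S] fk[OF BC] blk_K[OF eigfree_K[OF D] BC] m by simp
    then show ?thesis using block_eigfree_iff[OF eigfree_K[OF D] BC S] D m by simp
  qed
  have "{T \<in> eigfree m S. U \<star> T = D \<star> U} = f ` (K e d \<times> eigfree e S)"
  proof (intro equalityI subsetI)
    fix T assume T: "T \<in> {T \<in> eigfree m S. U \<star> T = D \<star> U}"
    then have "T \<in> f ` (K e d \<times> K e e)" using f(1) eigfree_K by (auto simp: bij_betw_def)
    then obtain B C where "B \<in> K e d" "C \<in> K e e" "T = f (B, C)" by auto
    then show "T \<in> f ` (K e d \<times> eigfree e S)" using iff T by auto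
  next
    fix T assume "T \<in> f ` (K e d \<times> eigfree e S)"
    then obtain B C where "B \<in> K e d" "C \<in> eigfree e S" "T = f (B, C)" by auto
    then show "T \<in> {T \<in> eigfree m S. U \<star> T = D \<star> U}" using iff fk eigfree_K by auto
  qed
  moreover have "inj_on f (K e d \<times> eigfree e S)"
    using f(1) eigfree_K by (intro inj_on_subset[OF bij_betw_imp_inj_on[OF f(1)]]) auto
  ultimately show ?thesis by (simp add: card_image card_cartesian_product card_K)
qed

section \<open>Proportions of matrices without prescribed eigenvalues, and sizes of
  eigenspaces\<close>

definition eigfree_prop :: "nat \<Rightarrow> 'a set \<Rightarrow> real" where
  "eigfree_prop m S = real (card (eigfree m S)) / real (card (full_rank m m))"

lemma eigfree_prop_zero: "eigfree_prop m {\<zero>} = 1"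
  using card_full_rank_pos[of m m] by (simp add: eigfree_prop_def eigfree_zero)

lemma eigfree_prop_le_1: "\<zero> \<in> S \<Longrightarrow> eigfree_prop m S \<le> 1"
proof -
  assume "\<zero> \<in> S"
  then have "eigfree m S \<subseteq> full_rank m m" using eigfree_zero[of m] by (auto simp: eigfree_def)
  then have "card (eigfree m S) \<le> card (full_rank m m)"
    using finite_full_rank by (intro card_mono)
  then show ?thesis using card_full_rank_pos[of m m] by (simp add: eigfree_prop_def)
qed

definition eigenspace :: "nat \<Rightarrow> 'a \<Rightarrow> 'a mat \<Rightarrow> 'a mat set" where
  "eigenspace m c T = {v \<in> K 1 m. v \<star> T = sc c v}"

context
  fixes m :: nat and c :: 'a and T :: "'a mat"
  assumes c: "c \<in> carrier F" and T: "T \<in> K m m"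
begin

lemma rows_eigenspace_iff: "U \<in> K d m \<Longrightarrow> U \<star> T = sc c U \<longleftrightarrow> (\<forall>i<d. row_mat U i \<in> eigenspace m c T)"
proof -
  assume U: "U \<in> K d m"
  have "U \<star> T = sc c U \<longleftrightarrow> (\<forall>i<d. row_mat (U \<star> T) i = row_mat (sc c U) i)"
    using row_mat_eqI[of "U \<star> T" d m "sc c U"] U T c by auto
  then show ?thesis using row_mat_mul[OF U T] row_mat_sc[OF U] row_mat_K[OF U] by (auto simp: eigenspace_def)
qed

lemma card_eigenspaces:
  "real (card {U \<in> full_rank d m. U \<star> T = sc c U}) = (\<Prod>i<d. (real (card (eigenspace m c T)) - real q ^ i))"
proof -
  have "{U \<in> full_rank d m. U \<star> T = sc c U} = {U \<in> full_rank d m. \<forall>i<d. row_mat U i \<in> eigenspace m c T}"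
    using rows_eigenspace_iff full_rank_K by blast
  moreover have "row_span U \<subseteq> eigenspace m c T" if U: "U \<in> K k m" "\<And>i. i < k \<Longrightarrow> row_mat U i \<in> eigenspace m c T" for k U
  proof
    fix v assume "v \<in> row_span U"
    then obtain w where w: "w \<in> K 1 k" "v = w \<star> U" using U by (auto simp: row_span_def M_dim)
    have "U \<star> T = sc c U" using rows_eigenspace_iff U by blast
    then show "v \<in> eigenspace m c T"
      using w U mul_assoc[OF w(1) U(1) T] mul_sc(1)[OF c w(1) U(1)] by (simp add: eigenspace_def)
  qed
  ultimately show ?thesis using card_full_rank_in_subspace[of "eigenspace m c T" m d] by (simp add: eigenspace_def)
qed

text \<open>No m + 1 independent rows exist in dimension m, so the product in
  \<open>card_eigenspaces\<close> vanishes for d = m + 1, and one of its factors must be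
  zero.\<close>

lemma card_eigenspace: obtains j where "j \<le> m" "card (eigenspace m c T) = q ^ j"
proof -
  have "{U \<in> full_rank (Suc m) m. U \<star> T = sc c U} = {}" using full_rank_le by fastforce
  then have "(\<Prod>i<Suc m. (real (card (eigenspace m c T)) - real q ^ i)) = 0"
    using card_eigenspaces[of "Suc m"] by (simp only: card.empty of_nat_0)
  then have "\<exists>j\<in>{..<Suc m}. real (card (eigenspace m c T)) - real q ^ j = 0"
    by (rule prod_zero_iff[OF finite_lessThan, THEN iffD1])
  then obtain j where "j < Suc m" "real (card (eigenspace m c T)) = real q ^ j" by auto
  then show thesis using that[of j] by (metis less_Suc_eq_le of_nat_eq_iff of_nat_power)
qed

lemma card_eigenspace_1_iff: "card (eigenspace m c T) = 1 \<longleftrightarrow> T \<boxminus> scalar_matrix F m c \<in> full_rank m m"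
proof -
  have z: "Z 1 m \<in> eigenspace m c T" using c T by (simp add: eigenspace_def)
  have fin: "finite (eigenspace m c T)" by (rule finite_subset[OF _ card_K(1)]) (auto simp: eigenspace_def)
  have "card (eigenspace m c T) = 1 \<longleftrightarrow> (\<forall>v\<in>eigenspace m c T. v = Z 1 m)"
    using z fin by (auto simp: card_1_singleton_iff One_nat_def)
  also have "\<dots> \<longleftrightarrow> T \<boxminus> scalar_matrix F m c \<in> full_rank m m"
  proof
    assume "\<forall>v\<in>eigenspace m c T. v = Z 1 m"
    then show "T \<boxminus> scalar_matrix F m c \<in> full_rank m m"
      using eigenvector_iff[OF c T] T c by (intro full_rank_I) (auto simp: eigenspace_def)
  next
    assume "T \<boxminus> scalar_matrix F m c \<in> full_rank m m"
    then show "\<forall>v\<in>eigenspace m c T. v = Z 1 m" using eigenvector_iff[OF c T] full_rank_D by (fastforce simp: eigenspace_def)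
  qed
  finally show ?thesis .
qed

end

text \<open>These are (-1)^d / ((q - 1) ... (q^d - 1)), the coefficients in Euler's expansion of the
  product of 1 - x / q^i over i \<ge> 1.\<close>

definition qcoef :: "nat \<Rightarrow> real" where
  "qcoef d = (\<Prod>i<d. - 1 / (real q ^ (i + 1) - 1))"

lemma q_power_gt_1: "1 < real q ^ (i + 1)"
  using q_ge_2 by (intro one_less_power) auto

text \<open>A \<open>q\<close>-analogue of inclusion-exclusion: the sum is \<open>1\<close> for \<open>N = 1\<close> and vanishes
  for \<open>N = q\<^sup>j\<close> with \<open>1 \<le> j \<le> m\<close>.\<close>

lemma sum_qcoef_prod:
  "(\<Sum>d\<le>m. qcoef d * (\<Prod>i<d. (N - real q ^ i))) = (\<Prod>i<m. (real q ^ (i + 1) - N) / (real q ^ (i + 1) - 1))"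
proof (induction m)
  case 0
  then show ?case by (simp add: qcoef_def)
next
  case (Suc m)
  let ?p = "\<Prod>i<m. (real q ^ (i + 1) - N) / (real q ^ (i + 1) - 1)"
  \<comment> \<open>The factor for i = 0 is split off; the remaining factors combine with
    \<open>qcoef m\<close> to the product for m.\<close>
  have "qcoef (Suc m) * (\<Prod>i<Suc m. (N - real q ^ i)) = - ?p * ((N - 1) / (real q ^ (m + 1) - 1))"
  proof -
    have "(\<Prod>i<Suc m. (N - real q ^ i)) = (N - 1) * (\<Prod>i<m. (N - real q ^ (i + 1)))"
      by (subst prod.lessThan_Suc_shift) (simp flip: Suc_eq_plus1)
    moreover have "qcoef m * (\<Prod>i<m. (N - real q ^ (i + 1))) = ?p"
      unfolding qcoef_def prod.distrib[symmetric] by (intro prod.cong) (auto simp: divide_simps)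
    moreover have "qcoef (Suc m) = qcoef m * (- 1 / (real q ^ (m + 1) - 1))" by (simp add: qcoef_def)
    ultimately show ?thesis by (simp add: ac_simps)
  qed
  moreover have "?p + - ?p * ((N - 1) / (real q ^ (m + 1) - 1)) = ?p * ((real q ^ (m + 1) - N) / (real q ^ (m + 1) - 1))"
  proof -
    have "1 - (N - 1) / (real q ^ (m + 1) - 1) = (real q ^ (m + 1) - N) / (real q ^ (m + 1) - 1)"
      using q_power_gt_1[of m] by (simp add: field_simps)
    then show ?thesis by (metis (no_types, lifting) add_uminus_conv_diff mult.right_neutral mult_minus_left right_diff_distrib)
  qed
  ultimately show ?case using Suc by simp
qed

text \<open>Writes the event that c is no eigenvalue as a combination of the numbers of independent
  d-tuples of eigenvectors, whose means \<open>sum_card_eigenspaces\<close> supplies.\<close>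

lemma indicator_eigenspace:
  assumes "c \<in> carrier F" "T \<in> K m m"
  shows "(\<Sum>d\<le>m. qcoef d * (\<Prod>i<d. (real (card (eigenspace m c T)) - real q ^ i)))
    = (if T \<boxminus> scalar_matrix F m c \<in> full_rank m m then 1 else 0)"
proof -
  obtain j where j: "j \<le> m" "card (eigenspace m c T) = q ^ j" using card_eigenspace[OF assms] .
  show ?thesis
  proof (cases "j = 0")
    case True
    then have "(\<Prod>i<m. (real q ^ (i + 1) - 1) / (real q ^ (i + 1) - 1)) = 1"
      by (intro prod.neutral ballI) (use q_power_gt_1 in \<open>auto simp: less_le\<close>)
    then show ?thesis
      unfolding sum_qcoef_prod using True j card_eigenspace_1_iff[OF assms] by simp
  next
    case False
    then have "1 < q ^ j" using q_ge_2 by (intro one_less_power) auto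
    then have "card (eigenspace m c T) \<noteq> 1" using j by simp
    moreover have "(\<Prod>i<m. (real q ^ (i + 1) - real (card (eigenspace m c T))) / (real q ^ (i + 1) - 1)) = 0"
      \<comment> \<open>The vanishing factor has index j - 1, because the exponents in this product
        start at 1.\<close>
      using False j by (intro prod_zero) (auto intro!: bexI[of _ "j - 1"])
    ultimately show ?thesis unfolding sum_qcoef_prod using card_eigenspace_1_iff[OF assms] by simp
  qed
qed

text \<open>Double counting of the pairs of a matrix \<open>T\<close> and a full-rank matrix \<open>U\<close> of eigenvectors of \<open>T\<close>.\<close>

lemma sum_card_eigenspaces:
  assumes c: "c \<in> carrier F" "c \<notin> S" and S: "S \<subseteq> carrier F" and d: "d \<le> m"
  shows "(\<Sum>T\<in>eigfree m S. (\<Prod>i<d. (real (card (eigenspace m c T)) - real q ^ i))) = real (card (full_rank m m)) * eigfree_prop (m - d) S"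
proof -
  have fin: "finite (full_rank d m)" by (rule finite_full_rank)
  have "(\<Sum>T\<in>eigfree m S. (\<Prod>i<d. (real (card (eigenspace m c T)) - real q ^ i)))
      = (\<Sum>T\<in>eigfree m S. \<Sum>U\<in>full_rank d m. if U \<star> T = sc c U then 1 else 0)"
  proof (rule sum.cong)
    fix T assume "T \<in> eigfree m S"
    then show "(\<Prod>i<d. (real (card (eigenspace m c T)) - real q ^ i)) = (\<Sum>U\<in>full_rank d m. if U \<star> T = sc c U then 1 else 0)"
      using card_eigenspaces[OF c(1) eigfree_K, of T m S d] fin by (simp add: sum.If_cases Int_def)
  qed simp
  also have "\<dots> = (\<Sum>U\<in>full_rank d m. \<Sum>T\<in>eigfree m S. if U \<star> T = sc c U then 1 else 0)"
    by (rule sum.swap)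
  also have "\<dots> = (\<Sum>U\<in>full_rank d m. real q ^ ((m - d) * d) * real (card (eigfree (m - d) S)))"
  proof (rule sum.cong)
    fix U assume U: "U \<in> full_rank d m"
    have "scalar_matrix F d c \<star> U = sc c U" using scalar_mul(1)[OF c(1) full_rank_K[OF U]] .
    then have "card {T \<in> eigfree m S. U \<star> T = sc c U} = q ^ ((m - d) * d) * card (eigfree (m - d) S)"
      using card_eigfree_invariant[OF U scalar_eigfree[OF c(1) S c(2)], of "m - d"] d S by simp
    then show "(\<Sum>T\<in>eigfree m S. if U \<star> T = sc c U then 1 else 0) = real q ^ ((m - d) * d) * real (card (eigfree (m - d) S))"
      using finite_eigfree by (simp add: sum.If_cases Int_def)
  qed simp
  also have "\<dots> = real (card (full_rank m m)) * eigfree_prop (m - d) S"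
    using card_full_rank_split[OF d] card_full_rank_pos[of "m - d" "m - d"] by (simp add: eigfree_prop_def mult.commute)
  finally show ?thesis .
qed

text \<open>Averaging \<open>indicator_eigenspace\<close> over the matrices that avoid S replaces
  the d-th product by the proportion in dimension m - d.\<close>

lemma eigfree_prop_insert:
  assumes c: "c \<in> carrier F" "c \<notin> S" and S: "S \<subseteq> carrier F"
  shows "eigfree_prop m (insert c S) = (\<Sum>d\<le>m. qcoef d * eigfree_prop (m - d) S)"
proof -
  have "real (card (eigfree m (insert c S))) = (\<Sum>T\<in>eigfree m S. if T \<boxminus> scalar_matrix F m c \<in> full_rank m m then 1 else 0)"
    using finite_eigfree by (simp add: eigfree_insert sum.If_cases Int_def)
  also have "\<dots> = (\<Sum>T\<in>eigfree m S. \<Sum>d\<le>m. qcoef d * (\<Prod>i<d. (real (card (eigenspace m c T)) - real q ^ i)))"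
    using indicator_eigenspace[OF c(1) eigfree_K] by (intro sum.cong) auto
  also have "\<dots> = (\<Sum>d\<le>m. qcoef d * (\<Sum>T\<in>eigfree m S. (\<Prod>i<d. (real (card (eigenspace m c T)) - real q ^ i))))"
    by (subst sum.swap) (simp add: sum_distrib_left)
  also have "\<dots> = (\<Sum>d\<le>m. qcoef d * (real (card (full_rank m m)) * eigfree_prop (m - d) S))"
    using sum_card_eigenspaces[OF c S] by (intro sum.cong) auto
  also have "\<dots> = real (card (full_rank m m)) * (\<Sum>d\<le>m. qcoef d * eigfree_prop (m - d) S)"
    by (simp add: sum_distrib_left mult.left_commute)
  finally show ?thesis using card_full_rank_pos[of m m] by (simp add: eigfree_prop_def)
qed

lemma summable_qcoef: "summable (\<lambda>d. \<bar>qcoef d\<bar>)"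
\<comment> \<open>Consecutive terms have ratio 1 / (q^(d + 1) - 1) in absolute value. For q = 2 this
  is 1 at d = 0, so the test starts at d = 1, where it is at most 1/3.\<close>
proof (rule summable_ratio_test[where c = "1 / 3" and N = 1])
  fix d :: nat assume "1 \<le> d"
  then have "(2::real) ^ 2 \<le> 2 ^ (d + 1)" by (intro power_increasing) auto
  also have "\<dots> \<le> real q ^ (d + 1)" using q_ge_2 by (intro power_mono) auto
  finally have "3 \<le> real q ^ (d + 1) - 1" by simp
  then have "\<bar>- 1 / (real q ^ (d + 1) - 1)\<bar> \<le> 1 / 3" by (simp add: abs_div field_simps)
  then have "\<bar>qcoef d\<bar> * \<bar>- 1 / (real q ^ (d + 1) - 1)\<bar> \<le> \<bar>qcoef d\<bar> * (1 / 3)"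
    by (intro mult_left_mono) auto
  moreover have "qcoef (Suc d) = qcoef d * (- 1 / (real q ^ (d + 1) - 1))" by (simp add: qcoef_def)
  ultimately show "norm \<bar>qcoef (Suc d)\<bar> \<le> 1 / 3 * norm \<bar>qcoef d\<bar>" by (simp only: abs_mult real_norm_def abs_abs)
qed simp

text \<open>More than convergence is stated so that the induction goes through: convolving
  \<open>qcoef\<close> with partial sums gives the partial sums of a Cauchy product, which is again
  absolutely summable. The induction starts from the constant proportion 1.\<close>

lemma eigfree_prop_partial_sums:
  assumes "finite S" "S \<subseteq> carrier F - {\<zero>}"
  shows "\<exists>\<delta>. summable (\<lambda>k. \<bar>\<delta> k :: real\<bar>) \<and> (\<forall>m. eigfree_prop m (insert \<zero> S) = (\<Sum>k\<le>m. \<delta> k))"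
  using assms
proof (induction S rule: finite_induct)
  case empty
  have "(\<Sum>k\<le>m. if k = 0 then 1 else 0 :: real) = 1" for m :: nat by simp
  moreover have "summable (\<lambda>k::nat. \<bar>if k = 0 then 1 else 0 :: real\<bar>)"
    by (rule summable_finite[of "{0}"]) auto
  ultimately show ?case using eigfree_prop_zero by (intro exI[of _ "\<lambda>k. if k = 0 then 1 else 0"]) auto
next
  case (insert c S)
  then obtain \<delta> :: "nat \<Rightarrow> real" where d: "summable (\<lambda>k. \<bar>\<delta> k\<bar>)" "\<And>m. eigfree_prop m (insert \<zero> S) = (\<Sum>k\<le>m. \<delta> k)"
    by auto
  let ?\<delta> = "\<lambda>n. \<Sum>i\<le>n. qcoef i * \<delta> (n - i)"
  have "summable (\<lambda>n. \<Sum>i\<le>n. \<bar>qcoef i\<bar> * \<bar>\<delta> (n - i)\<bar>)"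
    using summable_Cauchy_product[of "\<lambda>i. \<bar>qcoef i\<bar>" "\<lambda>i. \<bar>\<delta> i\<bar>"] summable_qcoef d(1) by simp
  then have 1: "summable (\<lambda>n. \<bar>?\<delta> n\<bar>)"
    by (rule summable_comparison_test[rotated]) (auto intro!: exI[of _ 0] order.trans[OF sum_abs] simp: abs_mult)
  have "(\<Sum>d\<le>m. qcoef d * (\<Sum>k\<le>m - d. \<delta> k)) = (\<Sum>n\<le>m. ?\<delta> n)" for m
  proof (induction m)
    case (Suc m)
    have "(\<Sum>d\<le>Suc m. qcoef d * (\<Sum>k\<le>Suc m - d. \<delta> k))
        = (\<Sum>d\<le>m. qcoef d * (\<Sum>k\<le>m - d. \<delta> k) + qcoef d * \<delta> (Suc m - d)) + qcoef (Suc m) * \<delta> 0"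
      by (simp add: Suc_diff_le distrib_left)
    then show ?case using Suc by (simp add: sum.distrib)
  qed simp
  moreover have "eigfree_prop m (insert c (insert \<zero> S)) = (\<Sum>d\<le>m. qcoef d * (\<Sum>k\<le>m - d. \<delta> k))" for m
    using eigfree_prop_insert[of c "insert \<zero> S" m] insert.prems insert.hyps d(2) by auto
  ultimately show ?case using 1 by (intro exI[of _ ?\<delta>]) (auto simp: insert_commute)
qed

lemma convergent_eigfree_prop:
  assumes "S \<subseteq> carrier F - {\<zero>}"
  shows "convergent (\<lambda>m. eigfree_prop m (insert \<zero> S))"
proof -
  have "finite S" by (rule finite_subset[OF assms finite_Diff[OF fin]])
  obtain \<delta> :: "nat \<Rightarrow> real" where *: "summable (\<lambda>k. \<bar>\<delta> k\<bar>) \<and> (\<forall>m. eigfree_prop m (insert \<zero> S) = (\<Sum>k\<le>m. \<delta> k))"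
    using eigfree_prop_partial_sums[OF \<open>finite S\<close> assms] by (rule exE)
  note d = conjunct1[OF *] conjunct2[OF *, rule_format]
  have "summable \<delta>" using summable_rabs_cancel[OF d(1)] .
  then show ?thesis unfolding d(2) using summable_LIMSEQ' convergentI by blast
qed

text \<open>This is Markov's inequality: for m \<ge> 1 the mean number of nonzero eigenvectors for c
  over the general linear group is 1, and a matrix with eigenvalue c has at least q - 1 of
  them.\<close>

lemma eigfree_prop_ge:
  assumes c: "c \<in> carrier F" "c \<noteq> \<zero>"
  shows "1 - 1 / (real q - 1) \<le> eigfree_prop m {\<zero>, c}"
proof (cases m)
  case 0
  have k: "A \<in> full_rank 0 0" if "A \<in> K 0 0" for A using Z_0(1)[OF that] full_rank_0 by blast
  have "eigfree 0 {\<zero>, c} = full_rank 0 0"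
  proof (intro equalityI subsetI)
    fix A assume "A \<in> full_rank 0 0"
    then have "A \<in> K 0 0" by (rule full_rank_K)
    then show "A \<in> eigfree 0 {\<zero>, c}" using k c minus_K[of A 0 0] scalar_K[of _ 0] unfolding eigfree_def by blast
  qed (use k eigfree_K in blast)
  then show ?thesis using 0 q_ge_2 card_full_rank_pos[of 0 0] by (simp add: eigfree_prop_def)
next
  case (Suc k)
  have fin: "finite (full_rank m m)" by (rule finite_full_rank)
  have "(\<Sum>T\<in>full_rank m m. (real (card (eigenspace m c T)) - 1)) = real (card (full_rank m m))"
    using sum_card_eigenspaces[of c "{\<zero>}" 1 m] c Suc by (simp add: eigfree_zero eigfree_prop_zero)
  moreover have "(\<Sum>T\<in>full_rank m m. if T \<boxminus> scalar_matrix F m c \<in> full_rank m m then 0 else real q - 1)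
      \<le> (\<Sum>T\<in>full_rank m m. (real (card (eigenspace m c T)) - 1))"
  proof (rule sum_mono)
    fix T assume T: "T \<in> full_rank m m"
    obtain j where j: "card (eigenspace m c T) = q ^ j" using card_eigenspace[OF c(1) full_rank_K[OF T]] .
    have "q \<le> q ^ j" if "j \<noteq> 0" using that q_ge_2 self_le_power[of q j] by simp
    then show "(if T \<boxminus> scalar_matrix F m c \<in> full_rank m m then 0 else real q - 1) \<le> real (card (eigenspace m c T)) - 1"
      using j card_eigenspace_1_iff[OF c(1) full_rank_K[OF T]] q_ge_2
      by (cases "j = 0") (auto simp flip: of_nat_power)
  qed
  moreover have "(\<Sum>T\<in>full_rank m m. if T \<boxminus> scalar_matrix F m c \<in> full_rank m m then 0 else real q - 1)
      = (real q - 1) * (real (card (full_rank m m)) - real (card (eigfree m {\<zero>, c})))"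
  proof -
    have e: "eigfree m {\<zero>, c} = {T \<in> full_rank m m. T \<boxminus> scalar_matrix F m c \<in> full_rank m m}"
      using eigfree_insert[of m c "{\<zero>}"] eigfree_zero[of m] by (simp add: insert_commute)
    have "full_rank m m - eigfree m {\<zero>, c} = full_rank m m \<inter> - {T. T \<boxminus> scalar_matrix F m c \<in> full_rank m m}" unfolding e by auto
    moreover have "real (card (full_rank m m - eigfree m {\<zero>, c})) = real (card (full_rank m m)) - real (card (eigfree m {\<zero>, c}))"
      using fin e by (subst card_Diff_subset) (auto simp: of_nat_diff card_mono)
    ultimately show ?thesis using fin by (simp add: sum.If_cases)
  qed
  ultimately have "(real q - 1) * (real (card (full_rank m m)) - real (card (eigfree m {\<zero>, c}))) \<le> real (card (full_rank m m))" by simp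
  then have "(real q - 1) * (1 - eigfree_prop m {\<zero>, c}) \<le> 1"
    using card_full_rank_pos[of m m] by (simp add: eigfree_prop_def field_simps)
  then show ?thesis using q_ge_2 by (simp add: field_simps)
qed

end

section \<open>Matrices with prescribed simple eigenvalues\<close>

context finite_field
begin

definition dmat :: "nat \<Rightarrow> (nat \<Rightarrow> 'a) \<Rightarrow> 'a mat" where
  "dmat s l = mat s s (\<lambda>(i, j). if i = j then l i else \<zero>)"

lemma dmat_K: "(\<And>i. i < s \<Longrightarrow> l i \<in> carrier F) \<Longrightarrow> dmat s l \<in> K s s"
  by (intro M_I) (auto simp: dmat_def)

lemma dmat_Suc:
  "dmat (Suc s) l = blk (dmat s l) (Z 1 s) (scalar_matrix F 1 (l s))"
  by (intro eq_matI) (auto simp: dmat_def blk_def vcat_def hcat_def mat_zero_def scalar_matrix_def less_Suc_eq One_nat_def)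

lemma row_mat_dmat_mul:
  assumes l: "\<And>i. i < s \<Longrightarrow> l i \<in> carrier F" and U: "U \<in> K s n" and i: "i < s"
  shows "row_mat (dmat s l \<star> U) i = sc (l i) (row_mat U i)"
proof (rule eq_matI)
  fix a j assume "a < dim_row (sc (l i) (row_mat U i))" "j < dim_col (sc (l i) (row_mat U i))"
  then have j: "a = 0" "j < n" using U by (auto simp: mat_scale_def row_mat_def M_dim)
  have "(dmat s l \<star> U) $$ (i, j) = (\<Oplus>k\<in>{0..<s}. if i = k then l k \<otimes> U $$ (k, j) else \<zero>)"
    using l U i j M_entry[OF U] M_dim[OF U] by (simp add: mat_mul_def dmat_def) (rule finsum_cong', auto)
  also have "\<dots> = l i \<otimes> U $$ (i, j)"
    using l i j M_entry[OF U] by (intro add.finprod_singleton) auto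
  finally show "row_mat (dmat s l \<star> U) i $$ (a, j) = sc (l i) (row_mat U i) $$ (a, j)"
    using i j U by (simp add: row_mat_def mat_scale_def mat_mul_def dmat_def M_dim)
qed (use U in \<open>auto simp: row_mat_def mat_scale_def mat_mul_def M_dim\<close>)

lemma dmat_mul_iff:
  assumes l: "\<And>i. i < s \<Longrightarrow> l i \<in> carrier F" and U: "U \<in> K s n" and T: "T \<in> K n n"
  shows "U \<star> T = dmat s l \<star> U \<longleftrightarrow> (\<forall>i<s. row_mat U i \<star> T = sc (l i) (row_mat U i))"
proof -
  have "U \<star> T = dmat s l \<star> U \<longleftrightarrow> (\<forall>i<s. row_mat (U \<star> T) i = row_mat (dmat s l \<star> U) i)"
    using row_mat_eqI[OF mul_K[OF U T] mul_K[OF dmat_K[of s l] U]] l by auto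
  then show ?thesis using row_mat_mul[OF U T] row_mat_dmat_mul[of s l U n] l U by simp
qed

lemma cp_dmat_Suc:
  assumes "\<And>i. i < Suc s \<Longrightarrow> l i \<in> carrier F"
  shows "cp (Suc s) (dmat (Suc s) l) = cp s (dmat s l) \<otimes>\<^bsub>R\<^esub> [\<one>, \<ominus> l s]"
  using assms cp_blk[OF dmat_K[of s l] Z_K[of 1 s] scalar_K[of "l s" 1]] cp_single[of "l s"]
  by (simp add: dmat_Suc flip: Suc_eq_plus1)

lemma eval_cp_dmat:
  assumes "\<And>i. i < s \<Longrightarrow> l i \<in> carrier F" "c \<in> carrier F" "\<And>i. i < s \<Longrightarrow> l i \<noteq> c"
  shows "eval (cp s (dmat s l)) c \<noteq> \<zero>"
  using assms
proof (induction s)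
  case 0
  have d: "dmat 0 l \<in> K 0 0" by (intro dmat_K) auto
  have "dmat 0 l \<boxminus> scalar_matrix F 0 c \<in> full_rank 0 0"
    using Z_0(1)[of "dmat 0 l \<boxminus> scalar_matrix F 0 c" 0] d 0 by (simp add: full_rank_0)
  then show ?case using cp_root_iff[OF 0(2) d] by simp
next
  case (Suc s)
  have "eval [\<one>, \<ominus> l s] c \<noteq> \<zero>" using Suc.prems eval_linear[of "l s" c] by auto
  moreover have "eval (cp s (dmat s l)) c \<noteq> \<zero>" using Suc by simp
  ultimately show ?case
    using cp_dmat_Suc[of s l] Suc.prems eval_hom[OF Suc.prems(2)] linear_closed[of "l s"] dmat_K[of s l]
    by (simp add: integral_iff)
qed

lemma simple_root_dmat:
  assumes "\<And>i. i < s \<Longrightarrow> l i \<in> carrier F" "inj_on l {..<s}" "i < s"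
  shows "simple_root (l i) (cp s (dmat s l))"
  using assms
proof (induction s)
  case (Suc s)
  have ls: "l s \<in> carrier F" "l i \<in> carrier F" "cp s (dmat s l) \<in> carrier R" "[\<one>, \<ominus> l s] \<in> carrier R"
    using Suc.prems linear_closed[of "l s"] dmat_K[of s l] by auto
  show ?case
  proof (cases "i = s")
    case True
    have "cp (Suc s) (dmat (Suc s) l) = [\<one>, \<ominus> l s] \<otimes>\<^bsub>R\<^esub> cp s (dmat s l)"
      using cp_dmat_Suc[of s l] Suc.prems ls UP.m_comm by simp
    moreover have "eval (cp s (dmat s l)) (l s) \<noteq> \<zero>"
      using Suc.prems by (intro eval_cp_dmat) (auto simp: inj_on_def)
    ultimately show ?thesis using True ls by (auto simp: simple_root_def)
  next
    case False
    then have "simple_root (l i) (cp s (dmat s l))"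
      using Suc by (auto simp: inj_on_def)
    then obtain h where h: "h \<in> carrier R" "cp s (dmat s l) = [\<one>, \<ominus> l i] \<otimes>\<^bsub>R\<^esub> h" "eval h (l i) \<noteq> \<zero>"
      by (auto simp: simple_root_def)
    have "l s \<noteq> l i" using Suc.prems False by (auto simp: inj_on_def)
    then have "eval (h \<otimes>\<^bsub>R\<^esub> [\<one>, \<ominus> l s]) (l i) \<noteq> \<zero>"
      using h ls eval_hom[OF ls(2)] eval_linear[OF ls(1,2)] by (simp add: integral_iff)
    moreover have "cp (Suc s) (dmat (Suc s) l) = [\<one>, \<ominus> l i] \<otimes>\<^bsub>R\<^esub> (h \<otimes>\<^bsub>R\<^esub> [\<one>, \<ominus> l s])"
      using cp_dmat_Suc[of s l] Suc.prems h ls linear_closed[OF ls(2)] by (simp add: UP.m_assoc)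
    ultimately show ?thesis using h ls by (auto simp: simple_root_def)
  qed
qed simp

text \<open>A dependence v = w V of the last eigenvector on the earlier ones yields w (D - l_k) = 0,
  where D is the diagonal matrix of the earlier eigenvalues. As these differ from l_k, w is
  zero.\<close>

lemma eigenvectors_full_rank:
  assumes "\<And>i. i < k \<Longrightarrow> l i \<in> carrier F" "inj_on l {..<k}" and T: "T \<in> K n n" and "U \<in> K k n"
    and "\<And>i. i < k \<Longrightarrow> row_mat U i \<star> T = sc (l i) (row_mat U i)" "\<And>i. i < k \<Longrightarrow> row_mat U i \<noteq> Z 1 n"
  shows "U \<in> full_rank k n"
  using assms(1,2,4-)
proof (induction k arbitrary: U)
  case 0
  show ?case using Z_0(1)[OF 0(3)] full_rank_0[of n] by simp
next
  case (Suc k)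
  have "U \<in> K (k + 1) n" using Suc.prems(3) by (simp flip: Suc_eq_plus1)
  then obtain V v where Vv: "V \<in> K k n" "v \<in> K 1 n" "U = vcat V v" by (rule vcat_cases)
  have rv: "row_mat U i = row_mat V i" if "i < k" for i
    using that Vv by (intro eq_matI) (auto simp: row_mat_def vcat_def M_dim)
  have rk: "row_mat U k = v" using Vv by (intro eq_matI) (auto simp: row_mat_def vcat_def M_dim)
  have lk: "l i \<in> carrier F" if "i < Suc k" for i using Suc.prems that by blast
  have V: "V \<in> full_rank k n"
  proof (rule Suc.IH[OF _ _ Vv(1)])
    show "inj_on l {..<k}" using Suc.prems(2) by (auto simp: inj_on_def)
    fix i assume i: "i < k"
    then show "l i \<in> carrier F" "row_mat V i \<star> T = sc (l i) (row_mat V i)" "row_mat V i \<noteq> Z 1 n"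
      using Suc.prems(1)[of i] Suc.prems(4)[of i] Suc.prems(5)[of i] rv[of i] by simp_all
  qed
  have "row_mat V i \<star> T = sc (l i) (row_mat V i)" if "i < k" for i
    using that Suc.prems(4)[of i] rv[of i] by simp
  then have VT: "V \<star> T = dmat k l \<star> V" using dmat_mul_iff[of k l V n T, OF _ Vv(1) T] lk by simp
  have v: "v \<star> T = sc (l k) v" "v \<noteq> Z 1 n" using Suc.prems(4,5)[of k] rk by auto
  have d: "dmat k l \<in> K k k" using lk by (intro dmat_K) auto
  have "v \<notin> row_span V"
  proof
    assume "v \<in> row_span V"
    then obtain w where w: "w \<in> K 1 k" "v = w \<star> V" using Vv by (auto simp: row_span_def M_dim)
    have "w \<star> dmat k l \<star> V = sc (l k) w \<star> V"
      using mul_assoc[OF w(1) d Vv(1)] mul_assoc[OF w(1) Vv(1) T] VT v w mul_sc(2)[OF lk w(1) Vv(1)] by simp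
    then have "w \<star> dmat k l = sc (l k) w"
      using full_rank_cancel[OF V mul_K[OF w(1) d] sc_K[OF lk w(1)]] by simp
    then have "w \<star> (dmat k l \<boxminus> scalar_matrix F k (l k)) = Z 1 k"
      using eigenvector_iff[OF lk d w(1)] by simp
    moreover have "dmat k l \<boxminus> scalar_matrix F k (l k) \<in> full_rank k k"
      using cp_root_iff[OF lk d, of k] eval_cp_dmat[of k l "l k"] lk Suc.prems(2)
      by (fastforce simp: inj_on_def)
    ultimately have "w = Z 1 k" using full_rank_D w by blast
    then show False using w v Vv by simp
  qed
  then show ?case using full_rank_vcat_iff[OF Vv(1,2), folded Suc_eq_plus1] V Vv by simp
qed

text \<open>A scalar block of size 2 contributes (t - c)^2 to the characteristic polynomial.\<close>

lemma not_simple_of_eigenplane: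
  assumes c: "c \<in> carrier F" and T: "T \<in> K n n" and V: "V \<in> full_rank 2 n" "V \<star> T = sc c V"
  shows "\<not> simple_root c (cp n T)"
proof -
  have n: "n = 2 + (n - 2)" using full_rank_le[OF V(1)] by simp
  have VT: "V \<star> T = scalar_matrix F 2 c \<star> V" using V scalar_mul(1)[OF c full_rank_K[OF V(1)]] by simp
  obtain f P where f: "bij_betw f (K (n - 2) 2 \<times> K (n - 2) (n - 2)) {T \<in> K n n. V \<star> T = scalar_matrix F 2 c \<star> V}"
      "P \<in> full_rank n n" "\<forall>B\<in>K (n - 2) 2. \<forall>C\<in>K (n - 2) (n - 2). P \<star> f (B, C) = blk (scalar_matrix F 2 c) B C \<star> P"
    using block_bij[OF V(1) scalar_K[OF c] n] .
  have "T \<in> f ` (K (n - 2) 2 \<times> K (n - 2) (n - 2))" using f(1) T VT by (simp add: bij_betw_def)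
  then obtain B C where BC: "B \<in> K (n - 2) 2" "C \<in> K (n - 2) (n - 2)" "T = f (B, C)" by auto
  have bk: "blk (scalar_matrix F 2 c) B C \<in> K n n" using blk_K[OF scalar_K[OF c] BC(1,2)] n by simp
  have 2: "scalar_matrix F 2 c = blk (scalar_matrix F 1 c) (Z 1 1) (scalar_matrix F 1 c)"
    by (intro eq_matI) (auto simp: blk_def vcat_def hcat_def mat_zero_def scalar_matrix_def less_2_cases_iff)
  have "cp 2 (scalar_matrix F 2 c) = [\<one>, \<ominus> c] \<otimes>\<^bsub>R\<^esub> [\<one>, \<ominus> c]"
    using cp_blk[OF scalar_K[OF c] Z_K scalar_K[OF c], of 1 1] cp_single[OF c] 2 by simp
  then have "cp n T = ([\<one>, \<ominus> c] \<otimes>\<^bsub>R\<^esub> [\<one>, \<ominus> c]) \<otimes>\<^bsub>R\<^esub> cp (n - 2) C"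
    using cp_similar[OF f(2) T bk] f(3) BC cp_blk[OF scalar_K[OF c] BC(1,2)] n by simp
  then have e: "cp n T = [\<one>, \<ominus> c] \<otimes>\<^bsub>R\<^esub> ([\<one>, \<ominus> c] \<otimes>\<^bsub>R\<^esub> cp (n - 2) C)"
    using linear_closed[OF c] BC by (simp add: UP.m_assoc)
  have "eval [\<one>, \<ominus> c] c = \<zero>" unfolding eval_linear[OF c c] using c by (simp add: a_minus_def r_neg)
  then have "eval ([\<one>, \<ominus> c] \<otimes>\<^bsub>R\<^esub> cp (n - 2) C) c = \<zero>"
    using eval_hom[OF c] linear_closed[OF c] BC by simp
  then show ?thesis
    using simple_root_iff[OF c _ e] linear_closed[OF c] BC by simp
qed

text \<open>The eigenvector must not vanish at coordinate t, and is scaled to \<one> there. In the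
  application t is 0 for the upper block and m - 1 for the lower one.\<close>

definition simple_mats :: "nat \<Rightarrow> nat \<Rightarrow> 'a set \<Rightarrow> 'a mat set" where
  "simple_mats m t S = {T \<in> full_rank m m. \<forall>c\<in>S. simple_root c (cp m T) \<and>
     (\<exists>y\<in>K 1 m. y $$ (0, t) = \<one> \<and> y \<star> T = sc c y)}"

definition frames :: "nat \<Rightarrow> nat \<Rightarrow> nat \<Rightarrow> 'a mat set" where
  "frames s m t = {Y \<in> full_rank s m. \<forall>i<s. Y $$ (i, t) = \<one>}"

text \<open>A second such vector outside the line of y would give an eigenplane, which a simple root
  excludes; within the line, coordinate t forces the factor \<one>.\<close>

lemma normalized_eigenvector_unique:
  assumes c: "c \<in> carrier F" and T: "T \<in> K n n" and s: "simple_root c (cp n T)" and t: "t < n"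
    and y: "y \<in> K 1 n" "y $$ (0, t) = \<one>" "y \<star> T = sc c y"
    and z: "z \<in> K 1 n" "z $$ (0, t) = \<one>" "z \<star> T = sc c z"
  shows "y = z"
proof -
  have "y \<noteq> Z 1 n" using y t by (auto simp: mat_zero_def)
  then have yF: "y \<in> full_rank 1 n" using full_rank_1_iff[OF y(1)] by simp
  have "z \<in> row_span y"
  proof (rule ccontr)
    assume "z \<notin> row_span y"
    then have V: "vcat y z \<in> full_rank 2 n" using full_rank_vcat_iff[OF y(1) z(1)] yF by simp
    have "vcat y z \<star> T = sc c (vcat y z)"
      using vcat_mul[OF y(1) z(1) T] y z by (auto intro!: eq_matI simp: vcat_def mat_scale_def M_dim)
    then show False using not_simple_of_eigenplane[OF c T V] s by blast
  qed
  then obtain w where w: "w \<in> K 1 1" "z = w \<star> y" using y by (auto simp: row_span_def M_dim)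
  define a where "a = w $$ (0, 0)"
  have a: "a \<in> carrier F" "z = sc a y" using w K11[OF w(1)] M_entry[OF w(1)] scalar_mul(1)[OF _ y(1), of a]
    by (auto simp: a_def)
  then have "z $$ (0, t) = a \<otimes> y $$ (0, t)" using y(1) t by (simp add: mat_scale_def M_dim)
  then have "a = \<one>" using a y z by simp
  then show ?thesis using a y by simp
qed

context
  fixes m t s :: nat and l :: "nat \<Rightarrow> 'a" and S :: "'a set"
  assumes t: "t < m" and S: "S \<subseteq> carrier F - {\<zero>}" and l: "bij_betw l {..<s} S"
begin

lemma l_S: "i < s \<Longrightarrow> l i \<in> S" "i < s \<Longrightarrow> l i \<in> carrier F" "i < s \<Longrightarrow> l i \<noteq> \<zero>"
  using bij_betwE[OF l] S by auto

lemma dmat_l_K: "dmat s l \<in> K s s"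
  using l_S by (intro dmat_K)

text \<open>The rows of Y are the unique normalized eigenvectors for the elements of S, and they are
  independent because the eigenvalues differ. Matrices can thus be counted as pairs (T, Y).\<close>

lemma ex1_frames:
  assumes T: "T \<in> simple_mats m t S"
  shows "card {Y \<in> frames s m t. Y \<star> T = dmat s l \<star> Y} = 1"
proof -
  have TK: "T \<in> K m m" using T full_rank_K by (auto simp: simple_mats_def)
  have sr: "simple_root (l i) (cp m T)" if "i < s" for i using T l_S(1)[OF that] by (simp add: simple_mats_def)
  have "\<forall>i<s. \<exists>y\<in>K 1 m. y $$ (0, t) = \<one> \<and> y \<star> T = sc (l i) y"
    using T l_S(1) by (simp add: simple_mats_def)
  then obtain y where y: "\<And>i. i < s \<Longrightarrow> y i \<in> K 1 m" "\<And>i. i < s \<Longrightarrow> y i $$ (0, t) = \<one>"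
      "\<And>i. i < s \<Longrightarrow> y i \<star> T = sc (l i) (y i)" by metis
  obtain Y where Y: "Y \<in> K s m" "\<And>i. i < s \<Longrightarrow> row_mat Y i = y i" using ex_of_rows[of s y m] y(1) by metis
  have Yt: "Y $$ (i, t) = \<one>" if "i < s" for i
    using arg_cong[OF Y(2)[OF that], of "\<lambda>Z. Z $$ (0, t)"] y(2)[OF that] Y(1) t by (simp add: row_mat_def M_dim)
  have nz: "row_mat Y i \<noteq> Z 1 m" if "i < s" for i
    using y(2)[OF that] Y(2)[OF that] t by (auto simp: mat_zero_def)
  have "Y \<in> full_rank s m"
    by (rule eigenvectors_full_rank[OF l_S(2) bij_betw_imp_inj_on[OF l] TK Y(1)]) (use y Y nz in auto)
  then have mem: "Y \<in> {Y \<in> frames s m t. Y \<star> T = dmat s l \<star> Y}"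
    using Yt dmat_mul_iff[of s l, OF l_S(2) Y(1) TK] y Y by (simp add: frames_def)
  moreover have "W = Y" if W: "W \<in> {Y \<in> frames s m t. Y \<star> T = dmat s l \<star> Y}" for W
  proof (rule row_mat_eqI[OF _ Y(1)])
    show WK: "W \<in> K s m" using W full_rank_K by (auto simp: frames_def)
    fix i assume i: "i < s"
    have e: "row_mat W i \<star> T = sc (l i) (row_mat W i)" using W dmat_mul_iff[of s l, OF l_S(2) WK TK] i by simp
    have "row_mat W i $$ (0, t) = \<one>" using W i t M_dim[OF WK] by (simp add: frames_def row_mat_def)
    then show "row_mat W i = row_mat Y i"
      using normalized_eigenvector_unique[OF l_S(2)[OF i] TK sr[OF i] t row_mat_K[OF WK i] _ e y(1)[OF i] y(2)[OF i] y(3)[OF i]] Y(2)[OF i]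
      by simp
  qed
  ultimately have "{Y \<in> frames s m t. Y \<star> T = dmat s l \<star> Y} = {Y}" by blast
  then show ?thesis by simp
qed

text \<open>In a basis that starts with the frame, the diagonal block has every element of S as a
  simple root. Simplicity for T then says that C has no eigenvalue in S, and invertibility adds 0 to
  the excluded set.\<close>

lemma card_simple_mats_invariant:
  assumes Y: "Y \<in> frames s m t"
  shows "card {T \<in> simple_mats m t S. Y \<star> T = dmat s l \<star> Y} = q ^ ((m - s) * s) * card (eigfree (m - s) (insert \<zero> S))"
proof -
  have YF: "Y \<in> full_rank s m" using Y by (simp add: frames_def)
  define e where "e = m - s"
  have m: "m = s + e" using full_rank_le[OF YF] by (simp add: e_def)
  obtain f P where f: "bij_betw f (K e s \<times> K e e) {T \<in> K m m. Y \<star> T = dmat s l \<star> Y}"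
      "P \<in> full_rank m m" "\<forall>B\<in>K e s. \<forall>C\<in>K e e. P \<star> f (B, C) = blk (dmat s l) B C \<star> P"
    using block_bij[OF YF dmat_l_K m] .
  have fk: "f (B, C) \<in> K m m \<and> Y \<star> f (B, C) = dmat s l \<star> Y" if "B \<in> K e s" "C \<in> K e e" for B C
    using bij_betwE[OF f(1)] that by blast
  \<comment> \<open>The diagonal block is invertible because 0 is not in S.\<close>
  have dF: "dmat s l \<in> full_rank s s"
    using cp_root_iff[OF zero_closed dmat_l_K] eval_cp_dmat[OF l_S(2) zero_closed] l_S(3) eigfree_zero[of s] dmat_l_K
    by (auto simp: eigfree_def)
  have iff: "f (B, C) \<in> simple_mats m t S \<longleftrightarrow> C \<in> eigfree e (insert \<zero> S)" if BC: "B \<in> K e s" "C \<in> K e e" for B C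
  proof -
    have bk: "blk (dmat s l) B C \<in> K m m" using blk_K[OF dmat_l_K BC] m by simp
    have cpf: "cp m (f (B, C)) = cp s (dmat s l) \<otimes>\<^bsub>R\<^esub> cp e C"
      using cp_similar[OF f(2) _ bk] fk[OF BC] f(3) BC cp_blk[OF dmat_l_K BC] m by simp
    have fr: "f (B, C) \<in> full_rank m m \<longleftrightarrow> C \<in> full_rank e e"
      using full_rank_conj_iff[OF f(2) _ bk] fk[OF BC] f(3) BC blk_full_rank_iff[OF dmat_l_K BC] m dF by simp
    have sr: "simple_root c (cp m (f (B, C))) \<longleftrightarrow> C \<boxminus> scalar_matrix F e c \<in> full_rank e e" if c: "c \<in> S" for c
    proof -
      have cF: "c \<in> carrier F" using c S by auto
      obtain i where i: "i < s" "c = l i" using l c by (auto simp: bij_betw_def)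
      obtain h where h: "h \<in> carrier R" "cp s (dmat s l) = [\<one>, \<ominus> c] \<otimes>\<^bsub>R\<^esub> h" "eval h c \<noteq> \<zero>"
        using simple_root_dmat[OF l_S(2) bij_betw_imp_inj_on[OF l] i(1)] i by (auto simp: simple_root_def)
      have "cp m (f (B, C)) = [\<one>, \<ominus> c] \<otimes>\<^bsub>R\<^esub> (h \<otimes>\<^bsub>R\<^esub> cp e C)"
        using cpf h linear_closed[OF cF] BC by (simp add: UP.m_assoc)
      then have "simple_root c (cp m (f (B, C))) \<longleftrightarrow> eval (h \<otimes>\<^bsub>R\<^esub> cp e C) c \<noteq> \<zero>"
        using simple_root_iff[OF cF] h BC by simp
      also have "\<dots> \<longleftrightarrow> eval (cp e C) c \<noteq> \<zero>"
        using h BC eval_hom[OF cF] by (simp add: integral_iff)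
      finally show ?thesis using cp_root_iff[OF cF BC(2)] by simp
    qed
    have ev: "\<exists>y\<in>K 1 m. y $$ (0, t) = \<one> \<and> y \<star> f (B, C) = sc c y" if c: "c \<in> S" for c
    proof -
      obtain i where i: "i < s" "c = l i" using l c by (auto simp: bij_betw_def)
      have "row_mat Y i \<star> f (B, C) = sc c (row_mat Y i)"
        using dmat_mul_iff[of s l, OF l_S(2) full_rank_K[OF YF], of "f (B, C)"] fk[OF BC] i by simp
      moreover have "row_mat Y i $$ (0, t) = \<one>" using Y i t M_dim[OF full_rank_K[OF YF]] by (simp add: frames_def row_mat_def)
      ultimately show ?thesis using row_mat_K[OF full_rank_K[OF YF] i(1)] by blast
    qed
    have "f (B, C) \<in> simple_mats m t S \<longleftrightarrow> f (B, C) \<in> full_rank m m \<and> (\<forall>c\<in>S. simple_root c (cp m (f (B, C))))"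
      using ev by (auto simp: simple_mats_def)
    then show ?thesis using fr sr eigfree_zero[of e] BC by (auto simp: eigfree_def)
  qed
  have "{T \<in> simple_mats m t S. Y \<star> T = dmat s l \<star> Y} = f ` (K e s \<times> eigfree e (insert \<zero> S))"
  proof (intro equalityI subsetI)
    fix T assume T: "T \<in> {T \<in> simple_mats m t S. Y \<star> T = dmat s l \<star> Y}"
    then have "T \<in> K m m" using full_rank_K by (auto simp: simple_mats_def)
    then have "T \<in> f ` (K e s \<times> K e e)" using f(1) T by (auto simp: bij_betw_def)
    then obtain B C where "B \<in> K e s" "C \<in> K e e" "T = f (B, C)" by auto
    then show "T \<in> f ` (K e s \<times> eigfree e (insert \<zero> S))" using iff T by auto
  next
    fix T assume "T \<in> f ` (K e s \<times> eigfree e (insert \<zero> S))"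
    then obtain B C where "B \<in> K e s" "C \<in> eigfree e (insert \<zero> S)" "T = f (B, C)" by auto
    then show "T \<in> {T \<in> simple_mats m t S. Y \<star> T = dmat s l \<star> Y}" using iff fk eigfree_K by auto
  qed
  moreover have "inj_on f (K e s \<times> eigfree e (insert \<zero> S))"
    using eigfree_K by (intro inj_on_subset[OF bij_betw_imp_inj_on[OF f(1)]]) auto
  ultimately show ?thesis by (simp add: card_image card_cartesian_product card_K e_def)
qed

text \<open>Double counting of the pairs of a matrix and its frame.\<close>

lemma card_simple_mats: "card (simple_mats m t S) = card (frames s m t) * (q ^ ((m - s) * s) * card (eigfree (m - s) (insert \<zero> S)))"
proof -
  have fin: "finite (simple_mats m t S)" "finite (frames s m t)"
    by (auto intro!: finite_subset[OF _ finite_full_rank] simp: simple_mats_def frames_def)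
  have "card (simple_mats m t S) = (\<Sum>T\<in>simple_mats m t S. card {Y \<in> frames s m t. Y \<star> T = dmat s l \<star> Y})"
    using ex1_frames by simp
  also have "\<dots> = (\<Sum>T\<in>simple_mats m t S. \<Sum>Y\<in>frames s m t. if Y \<star> T = dmat s l \<star> Y then 1 else 0)"
    using fin by (simp add: sum.If_cases Int_def)
  also have "\<dots> = (\<Sum>Y\<in>frames s m t. \<Sum>T\<in>simple_mats m t S. if Y \<star> T = dmat s l \<star> Y then 1 else 0)"
    by (rule sum.swap)
  also have "\<dots> = (\<Sum>Y\<in>frames s m t. card {T \<in> simple_mats m t S. Y \<star> T = dmat s l \<star> Y})"
    using fin by (simp add: sum.If_cases Int_def)
  finally show ?thesis using card_simple_mats_invariant by simp
qed

end

definition simple_prop :: "nat \<Rightarrow> nat \<Rightarrow> 'a set \<Rightarrow> real" where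
  "simple_prop m t S = real (card (simple_mats m t S)) / real (card (full_rank m m))"

text \<open>For large m the s entries at coordinate t behave like independent uniform field
  elements, as \<open>frame_prop_tendsto\<close> shows.\<close>

definition frame_prop :: "nat \<Rightarrow> nat \<Rightarrow> nat \<Rightarrow> real" where
  "frame_prop s m t = real (card (frames s m t)) / real (card (full_rank s m))"

lemma simple_prop_nonneg: "0 \<le> simple_prop m t S"
  by (simp add: simple_prop_def)

text \<open>By \<open>card_full_rank_split\<close> the denominator carries the same power of q as
  the count, and the two other factors separate.\<close>

lemma simple_prop_eq:
  assumes t: "t < m" and S: "S \<subseteq> carrier F - {\<zero>}" and s: "card S \<le> m"
  shows "simple_prop m t S = frame_prop (card S) m t * eigfree_prop (m - card S) (insert \<zero> S)"
proof -
  have "finite S" by (rule finite_subset[OF S finite_Diff[OF fin]])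
  then obtain l where l: "bij_betw l {..<card S} S"
    using ex_bij_betw_nat_finite[of S] by (auto simp: atLeast0LessThan)
  show ?thesis
    unfolding simple_prop_def frame_prop_def eigfree_prop_def card_simple_mats[OF t S l] card_full_rank_split[OF s]
    using card_full_rank_pos[OF s] card_full_rank_pos[of "m - card S" "m - card S"] q_ge_2 by (simp add: mult.commute)
qed

lemma simple_prop_eq_0:
  assumes t: "t < m" and S: "S \<subseteq> carrier F - {\<zero>}" and s: "m < card S"
  shows "simple_prop m t S = 0"
proof -
  have "finite S" by (rule finite_subset[OF S finite_Diff[OF fin]])
  then obtain l where l: "bij_betw l {..<card S} S"
    using ex_bij_betw_nat_finite[of S] by (auto simp: atLeast0LessThan)
  have "frames (card S) m t = {}" using full_rank_le s by (fastforce simp: frames_def)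
  then show ?thesis using card_simple_mats[OF t S l] by (simp add: simple_prop_def)
qed

section \<open>Counting frames\<close>

lemma card_affine:
  assumes t: "t < m"
  shows "card {v \<in> K 1 m. v $$ (0, t) = \<one>} = q ^ (m - 1)"
proof -
  let ?H = "{v \<in> K 1 m. v $$ (0, t) = \<one>}"
  let ?u = "\<lambda>v a. mat 1 m (\<lambda>(i, j). if j = t then a else v $$ (i, j))"
  have "bij_betw (\<lambda>(v, a). ?u v a) (?H \<times> carrier F) (K 1 m)"
  proof (rule bij_betw_byWitness[where f' = "\<lambda>v. (?u v \<one>, v $$ (0, t))"])
    show "\<forall>p\<in>?H \<times> carrier F. (\<lambda>v. (?u v \<one>, v $$ (0, t))) ((\<lambda>(v, a). ?u v a) p) = p"
      using t by (auto intro!: eq_matI simp: M_dim)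
    show "\<forall>v\<in>K 1 m. (\<lambda>(v, a). ?u v a) (?u v \<one>, v $$ (0, t)) = v"
      using t by (auto intro!: eq_matI simp: M_dim)
    show "(\<lambda>(v, a). ?u v a) ` (?H \<times> carrier F) \<subseteq> K 1 m"
      using t by (auto intro!: M_I simp: M_entry)
    show "(\<lambda>v. (?u v \<one>, v $$ (0, t))) ` K 1 m \<subseteq> ?H \<times> carrier F"
      using t by (auto intro!: M_I simp: M_entry)
  qed
  from bij_betw_same_card[OF this] have "card ?H * q = q ^ m"
    by (simp add: card_cartesian_product card_K)
  moreover have "q ^ m = q ^ (m - 1) * q" using t by (cases m) auto
  ultimately show ?thesis using q_ge_2 by (metis mult_right_cancel not_numeral_le_zero)
qed

lemma card_frames_Suc:
  assumes t: "t < m"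
  shows "card (frames (Suc s) m t) = (\<Sum>A\<in>frames s m t. card ({v \<in> K 1 m. v $$ (0, t) = \<one>} - row_span A))"
proof -
  let ?H = "{v \<in> K 1 m. v $$ (0, t) = \<one>}"
  have rv: "vcat A v $$ (i, t) = (if i < s then A $$ (i, t) else v $$ (0, t))"
    if "A \<in> K s m" "v \<in> K 1 m" "i < Suc s" for A v i
    using that t by (auto simp: vcat_def M_dim less_Suc_eq)
  have "frames (Suc s) m t = {vcat A v | A v. A \<in> frames s m t \<and> v \<in> ?H - row_span A}"
  proof (intro equalityI subsetI)
    fix B assume B: "B \<in> frames (Suc s) m t"
    then have "B \<in> K (s + 1) m" using full_rank_K unfolding frames_def Suc_eq_plus1 by blast
    then obtain A v where Av: "A \<in> K s m" "v \<in> K 1 m" "B = vcat A v" by (rule vcat_cases)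
    have "A \<in> full_rank s m" "v \<notin> row_span A"
      using B Av full_rank_vcat_iff[OF Av(1,2), folded Suc_eq_plus1] by (auto simp: frames_def)
    moreover have "\<forall>i<s. A $$ (i, t) = \<one>" "v $$ (0, t) = \<one>"
      using B Av rv[OF Av(1,2)] by (auto simp: frames_def less_Suc_eq)
    ultimately show "B \<in> {vcat A v | A v. A \<in> frames s m t \<and> v \<in> ?H - row_span A}"
      using Av by (auto simp: frames_def)
  next
    fix B assume "B \<in> {vcat A v | A v. A \<in> frames s m t \<and> v \<in> ?H - row_span A}"
    then obtain A v where Av: "A \<in> frames s m t" "v \<in> ?H - row_span A" "B = vcat A v" by blast
    have k: "A \<in> full_rank s m" "A \<in> K s m" "v \<in> K 1 m" using Av full_rank_K by (auto simp: frames_def)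
    then show "B \<in> frames (Suc s) m t"
      using Av full_rank_vcat_iff[OF k(2,3), folded Suc_eq_plus1] rv[OF k(2,3)] by (auto simp: frames_def)
  qed
  moreover have "frames s m t \<subseteq> K s m" using full_rank_K unfolding frames_def by blast
  moreover have "?H - row_span A \<subseteq> K 1 m" for A by blast
  ultimately show ?thesis using card_vcat_Sigma[of "frames s m t" s m "\<lambda>A. ?H - row_span A" 1] by simp
qed

text \<open>The new row ranges over an affine hyperplane of q^(m-1) vectors, of which at most q^s
  are excluded. These crude bounds have the same leading order.\<close>

lemma card_frames_bounds:
  assumes t: "t < m"
  shows "real (card (frames (Suc s) m t)) \<le> real (card (frames s m t)) * real q ^ (m - 1)"
    "real (card (frames s m t)) * (real q ^ (m - 1) - real q ^ s) \<le> real (card (frames (Suc s) m t))"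
proof -
  let ?H = "{v \<in> K 1 m. v $$ (0, t) = \<one>}"
  have fH: "finite ?H" by (rule finite_subset[OF _ card_K(1)[of 1 m]]) auto
  have b: "real (card (?H - row_span A)) \<le> real q ^ (m - 1)"
    "real q ^ (m - 1) - real q ^ s \<le> real (card (?H - row_span A))" if "A \<in> frames s m t" for A
  proof -
    have A: "A \<in> full_rank s m" using that by (simp add: frames_def)
    have fr: "finite (row_span A)" by (rule finite_subset[OF row_span_sub[OF full_rank_K[OF A]] card_K(1)])
    have "card (?H - row_span A) \<le> q ^ (m - 1)"
      using card_mono[OF fH, of "?H - row_span A"] card_affine[OF t] by auto
    then show "real (card (?H - row_span A)) \<le> real q ^ (m - 1)" by (simp flip: of_nat_power)
    have "q ^ (m - 1) - q ^ s \<le> card (?H - row_span A)"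
      using diff_card_le_card_Diff[OF fr, of ?H] card_affine[OF t] card_row_span[OF A] by simp
    then have "real (q ^ (m - 1)) - real (q ^ s) \<le> real (card (?H - row_span A))" by linarith
    then show "real q ^ (m - 1) - real q ^ s \<le> real (card (?H - row_span A))" by simp
  qed
  have e: "real (card (frames (Suc s) m t)) = (\<Sum>A\<in>frames s m t. real (card (?H - row_span A)))"
    using card_frames_Suc[OF t] by simp
  show "real (card (frames (Suc s) m t)) \<le> real (card (frames s m t)) * real q ^ (m - 1)"
    unfolding e by (rule sum_bounded_above) (use b in auto)
  show "real (card (frames s m t)) * (real q ^ (m - 1) - real q ^ s) \<le> real (card (frames (Suc s) m t))"
    unfolding e by (rule sum_bounded_below) (use b in auto)
qed

lemma card_frames_0: "card (frames 0 m t) = 1"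
proof -
  have "frames 0 m t = {Z 0 m}" by (auto simp: frames_def full_rank_0)
  then show ?thesis by simp
qed

lemma card_frames_1: "t < m \<Longrightarrow> card (frames 1 m t) = q ^ (m - 1)"
proof -
  assume t: "t < m"
  have "frames 0 m t = {Z 0 m}" by (auto simp: frames_def full_rank_0)
  moreover have "{v \<in> K 1 m. v $$ (0, t) = \<one>} - row_span (Z 0 m) = {v \<in> K 1 m. v $$ (0, t) = \<one>}"
  proof -
    have "v $$ (0, t) \<noteq> \<one>" if v: "v \<in> row_span (Z 0 m)" for v
    proof -
      have "dim_row (Z 0 m) = 0" by (simp add: mat_zero_def)
      then obtain w where w: "w \<in> K 1 0" "v = w \<star> Z 0 m" using v by (auto simp: row_span_def)
      then have "v = Z 1 m" using Z_mul(2)[OF w(1)] by simp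
      then show ?thesis using t by (auto simp: mat_zero_def)
    qed
    then show ?thesis by blast
  qed
  ultimately show ?thesis using card_frames_Suc[OF t, of 0] card_affine[OF t] by (simp add: One_nat_def)
qed

lemma card_full_rank_Suc: "real (card (full_rank (Suc s) m)) = real (card (full_rank s m)) * (real q ^ m - real q ^ s)"
  by (simp add: card_full_rank)

lemma frame_prop_Suc_bounds:
  assumes t: "t < m" and s: "s < m"
  shows "frame_prop (Suc s) m t \<le> frame_prop s m t * (real q ^ (m - 1) / (real q ^ m - real q ^ s))"
    "frame_prop s m t * ((real q ^ (m - 1) - real q ^ s) / (real q ^ m - real q ^ s)) \<le> frame_prop (Suc s) m t"
proof -
  have p: "0 < real q ^ m - real q ^ s" using s q_ge_2 by simp
  have f: "0 < real (card (full_rank s m))" using card_full_rank_pos[of s m] s by simp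
  show "frame_prop (Suc s) m t \<le> frame_prop s m t * (real q ^ (m - 1) / (real q ^ m - real q ^ s))"
    unfolding frame_prop_def card_full_rank_Suc times_divide_times_eq
    using card_frames_bounds(1)[OF t, of s] p f by (intro divide_right_mono) auto
  show "frame_prop s m t * ((real q ^ (m - 1) - real q ^ s) / (real q ^ m - real q ^ s)) \<le> frame_prop (Suc s) m t"
    unfolding frame_prop_def card_full_rank_Suc times_divide_times_eq
    using card_frames_bounds(2)[OF t, of s] p f by (intro divide_right_mono) auto
qed

lemma frame_prop_nonneg: "0 \<le> frame_prop s m t"
  by (simp add: frame_prop_def)

lemma frame_prop_1_bounds:
  assumes t: "t < m"
  shows "1 / real q \<le> frame_prop 1 m t" "frame_prop 1 m t \<le> 1 / (real q - 1)"
proof -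
  have p: "1 < real q ^ m" using t q_ge_2 by (intro one_less_power) auto
  have m: "real q ^ m = real q * real q ^ (m - 1)" using t by (cases m) auto
  have "real (card (full_rank 1 m)) = real q ^ m - 1" by (simp add: card_full_rank One_nat_def)
  then have e: "frame_prop 1 m t = real q ^ (m - 1) / (real q ^ m - 1)" using card_frames_1[OF t] by (simp add: frame_prop_def)
  have "1 \<le> real q ^ (m - 1)" using q_ge_2 by (intro one_le_power) auto
  then show "1 / real q \<le> frame_prop 1 m t" "frame_prop 1 m t \<le> 1 / (real q - 1)"
    unfolding e using p q_ge_2 m by (auto simp: divide_simps algebra_simps)
qed

text \<open>Each of the two rows contributes a factor of at most 1/(q - 1); for the second one this
  amounts to q \<le> q^(m-1).\<close>

lemma frame_prop_2_le:
  assumes t: "t < m" and m: "2 \<le> m"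
  shows "frame_prop 2 m t \<le> 1 / (real q - 1) ^ 2"
proof -
  have Q: "2 \<le> real q" using q_ge_2 by simp
  have m1: "real q ^ m = real q * real q ^ (m - 1)" using m by (cases m) auto
  have m2: "real q ^ (m - 1) = real q * real q ^ (m - 2)"
  proof -
    have "m - 1 = Suc (m - 2)" using m by simp
    then show ?thesis by simp
  qed
  have one: "1 \<le> real q ^ (m - 2)" using q_ge_2 by (intro one_le_power) auto
  have p: "real q < real q ^ m" using m Q power_strict_increasing[of 1 m "real q"] by simp
  have "real q ^ (m - 1) / (real q ^ m - real q) \<le> 1 / (real q - 1)"
  proof -
    have "real q * 1 \<le> real q * real q ^ (m - 2)" using one Q by (intro mult_left_mono) auto
    then have "real q ^ (m - 1) * (real q - 1) \<le> real q ^ m - real q" using m1 m2 by (simp add: algebra_simps)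
    then show ?thesis using p Q by (simp add: divide_simps)
  qed
  then have "frame_prop 1 m t * (real q ^ (m - 1) / (real q ^ m - real q)) \<le> (1 / (real q - 1)) * (1 / (real q - 1))"
    using frame_prop_1_bounds(2)[OF t] frame_prop_nonneg p Q by (intro mult_mono) auto
  moreover have "frame_prop 2 m t \<le> frame_prop 1 m t * (real q ^ (m - 1) / (real q ^ m - real q))"
    using frame_prop_Suc_bounds(1)[OF t, of 1] m by (simp add: numeral_2_eq_2)
  ultimately show ?thesis by (simp add: power2_eq_square)
qed

text \<open>One more row multiplies the proportion by a number between two bounds that both tend to
  1/q. The coordinate may move with m, as the last coordinate m - 1 does.\<close>

lemma frame_prop_tendsto:
  assumes t: "\<And>m. 0 < m \<Longrightarrow> \<tau> m < m"
  shows "(\<lambda>m. frame_prop s m (\<tau> m)) \<longlonglongrightarrow> 1 / real q ^ s"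
proof (induction s)
  case 0
  have "frame_prop 0 m t = 1" for m t by (simp add: frame_prop_def card_frames_0 full_rank_0)
  then show ?case by simp
next
  case (Suc s)
  have Q: "1 < real q" using q_ge_2 by simp
  have z: "(\<lambda>m. (1 / real q) ^ m) \<longlonglongrightarrow> 0" using Q by (intro LIMSEQ_realpow_zero) auto
  \<comment> \<open>The two factors of \<open>frame_prop_Suc_bounds\<close>, with numerator and
    denominator divided by q^m.\<close>
  let ?u = "\<lambda>m. (1 / real q) / (1 - real q ^ s * (1 / real q) ^ m)"
  let ?w = "\<lambda>m. (1 / real q - real q ^ s * (1 / real q) ^ m) / (1 - real q ^ s * (1 / real q) ^ m)"
  have "?u \<longlonglongrightarrow> (1 / real q) / (1 - real q ^ s * 0)" "?w \<longlonglongrightarrow> (1 / real q - real q ^ s * 0) / (1 - real q ^ s * 0)"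
    by (intro tendsto_intros z; simp)+
  then have "?u \<longlonglongrightarrow> 1 / real q" "?w \<longlonglongrightarrow> 1 / real q" by simp_all
  note lim = tendsto_mult[OF Suc this(1)] tendsto_mult[OF Suc this(2)]
  have eq: "real q ^ (m - 1) / (real q ^ m - real q ^ s) = ?u m"
      "(real q ^ (m - 1) - real q ^ s) / (real q ^ m - real q ^ s) = ?w m" if "s < m" for m
  proof -
    have "real q ^ m - real q ^ s \<noteq> 0" using that Q by simp
    moreover have "real q ^ m = real q * real q ^ (m - 1)" using that by (cases m) auto
    ultimately show "real q ^ (m - 1) / (real q ^ m - real q ^ s) = ?u m"
      "(real q ^ (m - 1) - real q ^ s) / (real q ^ m - real q ^ s) = ?w m"
      using Q by (auto simp: power_one_over field_simps)
  qed
  have "eventually (\<lambda>m. s < m) sequentially" by (rule eventually_gt_at_top)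
  then have e: "eventually (\<lambda>m. frame_prop (Suc s) m (\<tau> m) \<le> frame_prop s m (\<tau> m) * ?u m) sequentially"
    by (rule eventually_mono) (metis frame_prop_Suc_bounds(1) t eq(1) not_less_zero gr0I)
  have "eventually (\<lambda>m. frame_prop s m (\<tau> m) * ?w m \<le> frame_prop (Suc s) m (\<tau> m)) sequentially"
    using eventually_gt_at_top[of s]
    by (rule eventually_mono) (metis frame_prop_Suc_bounds(2) t eq(2) not_less_zero gr0I)
  then have "(\<lambda>m. frame_prop (Suc s) m (\<tau> m)) \<longlonglongrightarrow> 1 / real q ^ s * (1 / real q)"
    by (rule tendsto_sandwich[OF _ e lim(2,1)])
  then show ?case by (simp add: mult.commute)
qed

text \<open>For m beyond \<open>card S\<close> the factorization \<open>simple_prop_eq\<close>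
  applies, and both of its factors converge.\<close>

lemma convergent_simple_prop:
  assumes t: "\<And>m. 0 < m \<Longrightarrow> \<tau> m < m" and S: "S \<subseteq> carrier F - {\<zero>}"
  shows "convergent (\<lambda>m. simple_prop m (\<tau> m) S)"
proof -
  obtain L where L: "(\<lambda>m. eigfree_prop m (insert \<zero> S)) \<longlonglongrightarrow> L" using convergent_eigfree_prop[OF S] by (auto simp: convergent_def)
  have "(\<lambda>m. eigfree_prop (m - card S) (insert \<zero> S)) \<longlonglongrightarrow> L"
    by (rule LIMSEQ_offset[of _ "card S"]) (simp add: L)
  then have "(\<lambda>m. frame_prop (card S) m (\<tau> m) * eigfree_prop (m - card S) (insert \<zero> S)) \<longlonglongrightarrow> 1 / real q ^ card S * L"
    using frame_prop_tendsto[OF t] by (intro tendsto_mult)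
  moreover have "eventually (\<lambda>m. frame_prop (card S) m (\<tau> m) * eigfree_prop (m - card S) (insert \<zero> S) = simple_prop m (\<tau> m) S) sequentially"
  proof (rule eventually_mono[OF eventually_gt_at_top[of "card S"]])
    fix m assume "card S < m"
    then show "frame_prop (card S) m (\<tau> m) * eigfree_prop (m - card S) (insert \<zero> S) = simple_prop m (\<tau> m) S"
      using simple_prop_eq[OF _ S, of "\<tau> m" m] t[of m] by linarith
  qed
  ultimately have "(\<lambda>m. simple_prop m (\<tau> m) S) \<longlonglongrightarrow> 1 / real q ^ card S * L" by (rule Lim_transform_eventually)
  then show ?thesis by (rule convergentI)
qed

text \<open>The frame factor lies between 1/q and 1/(q - 1), and the eigenvalue factor between 1 -
  1/(q - 1) and 1.\<close>

lemma simple_prop_single_bounds: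
  assumes t: "t < m" and c: "c \<in> carrier F" "c \<noteq> \<zero>"
  shows "1 / real q * (1 - 1 / (real q - 1)) \<le> simple_prop m t {c}" "simple_prop m t {c} \<le> 1 / (real q - 1)"
proof -
  have e: "simple_prop m t {c} = frame_prop 1 m t * eigfree_prop (m - 1) {\<zero>, c}" using simple_prop_eq[OF t, of "{c}"] c t by (simp add: One_nat_def)
  have Q: "2 \<le> real q" using q_ge_2 by simp
  have "1 / real q * (1 - 1 / (real q - 1)) \<le> frame_prop 1 m t * (1 - 1 / (real q - 1))"
    using frame_prop_1_bounds(1)[OF t] Q by (intro mult_right_mono) (auto simp: divide_simps)
  also have "\<dots> \<le> simple_prop m t {c}"
    unfolding e using eigfree_prop_ge[OF c] frame_prop_nonneg by (intro mult_left_mono) auto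
  finally show "1 / real q * (1 - 1 / (real q - 1)) \<le> simple_prop m t {c}" .
  have "simple_prop m t {c} \<le> frame_prop 1 m t * 1"
    unfolding e using eigfree_prop_le_1[of "{\<zero>, c}"] frame_prop_nonneg by (intro mult_left_mono) auto
  then show "simple_prop m t {c} \<le> 1 / (real q - 1)" using frame_prop_1_bounds(2)[OF t] by simp
qed

lemma simple_prop_pair_le:
  assumes t: "t < m" and c: "c \<in> carrier F - {\<zero>}" "d \<in> carrier F - {\<zero>}" "c \<noteq> d"
  shows "simple_prop m t {c, d} \<le> 1 / (real q - 1) ^ 2"
proof (cases "2 \<le> m")
  case True
  then have "simple_prop m t {c, d} = frame_prop 2 m t * eigfree_prop (m - 2) {\<zero>, c, d}" using simple_prop_eq[OF t, of "{c, d}"] c by (simp add: numeral_2_eq_2)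
  also have "\<dots> \<le> frame_prop 2 m t * 1"
    using eigfree_prop_le_1[of "{\<zero>, c, d}"] frame_prop_nonneg by (intro mult_left_mono) auto
  finally show ?thesis using frame_prop_2_le[OF t True] by simp
next
  \<comment> \<open>In dimension 1 there is no room for two independent eigenvectors.\<close>
  case False
  then show ?thesis using simple_prop_eq_0[OF t, of "{c, d}"] c by simp
qed

end

section \<open>Counting block matrices\<close>

context finite_field
begin

text \<open>Rank and nullity in counted form: the fibres over the row space are translates of the
  kernel.\<close>

lemma card_image_kernel:
  assumes A: "A \<in> K r n"
  shows "card (row_span A) * card {v \<in> K 1 r. v \<star> A = Z 1 n} = q ^ r"
proof -
  let ?f = "\<lambda>w. {v \<in> K 1 r. v \<star> A = w}"
  have fib: "card (?f w) = card (?f (Z 1 n))" if w: "w \<in> row_span A" for w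
  proof -
    obtain u where u: "u \<in> K 1 r" "w = u \<star> A" using w A by (auto simp: row_span_def M_dim)
    have "bij_betw (\<lambda>v. v \<boxplus> u) (?f (Z 1 n)) (?f w)"
    proof (rule bij_betw_byWitness[where f' = "\<lambda>v. v \<boxminus> u"])
      show "\<forall>v\<in>?f (Z 1 n). v \<boxplus> u \<boxminus> u = v" using u plus_minus_cancel by auto
      show "\<forall>v\<in>?f w. v \<boxminus> u \<boxplus> u = v" using u minus_plus_cancel by auto
      show "(\<lambda>v. v \<boxplus> u) ` ?f (Z 1 n) \<subseteq> ?f w"
        using u A mul_K[OF u(1) A] plus_mul[OF _ u(1) A] by auto
      show "(\<lambda>v. v \<boxminus> u) ` ?f w \<subseteq> ?f (Z 1 n)"
        using u A mul_K[OF u(1) A] minus_mul[OF _ u(1) A] minus_eq_Z_iff[of w 1 n w] by auto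
    qed
    from bij_betw_same_card[OF this] show ?thesis by (rule sym)
  qed
  have fin: "finite (row_span A)" by (rule finite_subset[OF row_span_sub[OF A] card_K(1)])
  have "(\<Union>w\<in>row_span A. ?f w) = K 1 r" using A by (auto simp: row_span_def M_dim)
  moreover have "card (\<Union>w\<in>row_span A. ?f w) = (\<Sum>w\<in>row_span A. card (?f w))"
    by (rule card_UN_disjoint[OF fin]) (auto intro: finite_subset[OF _ card_K(1)[of 1 r]])
  moreover have "(\<Sum>w\<in>row_span A. card (?f w)) = (\<Sum>w\<in>row_span A. card (?f (Z 1 n)))" using fib by (rule sum.cong[OF refl])
  ultimately show ?thesis using card_K(2)[of 1 r] by simp
qed

lemma simple_root_eval:
  assumes "c \<in> carrier F" "simple_root c p"
  shows "eval p c = \<zero>"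
proof -
  obtain h where h: "h \<in> carrier R" "p = [\<one>, \<ominus> c] \<otimes>\<^bsub>R\<^esub> h" using assms by (auto simp: simple_root_def)
  have "eval [\<one>, \<ominus> c] c = \<zero>"
    unfolding eval_linear[OF assms(1) assms(1)] using assms by (simp add: a_minus_def r_neg)
  then show ?thesis using h eval_hom[OF assms(1)] linear_closed[OF assms(1)] by simp
qed

text \<open>The size is q^j, with j > 0 at a root. For j \<ge> 2 the number (q^j - 1)(q^j - q) of
  independent pairs of eigenvectors would be positive, contrary to simplicity.\<close>

lemma card_eigenspace_simple:
  assumes c: "c \<in> carrier F" and A: "A \<in> K r r" and s: "simple_root c (cp r A)"
  shows "card (eigenspace r c A) = q"
proof -
  obtain j where j: "j \<le> r" "card (eigenspace r c A) = q ^ j" using card_eigenspace[OF c A] .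
  have "card (eigenspace r c A) \<noteq> 1"
    using card_eigenspace_1_iff[OF c A] cp_root_iff[OF c A] simple_root_eval[OF c s] by simp
  then have "j \<noteq> 0" using j by (metis power_0)
  moreover have "\<not> 2 \<le> j"
  proof
    assume j2: "2 \<le> j"
    have "{U \<in> full_rank 2 r. U \<star> A = sc c U} = {}" using not_simple_of_eigenplane[OF c A] s by blast
    then have "(\<Prod>i<2. (real (card (eigenspace r c A)) - real q ^ i)) = 0"
      using card_eigenspaces[OF c A, of 2] by (simp only: card.empty of_nat_0)
    then have "\<exists>i\<in>{..<2}. real (card (eigenspace r c A)) - real q ^ i = 0"
      by (rule prod_zero_iff[OF finite_lessThan, THEN iffD1])
    then obtain i where i: "i < 2" "real q ^ j = real q ^ i" using j by auto
    then have "i < j" using j2 by simp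
    then have "real q ^ i < real q ^ j" using q_ge_2 by (intro power_strict_increasing) auto
    then show False using i by simp
  qed
  ultimately have "j = 1" by simp
  then show ?thesis using j by simp
qed

text \<open>The kernel is the eigenspace, which is a line at a simple root. The result gives the
  probability 1/q of hitting the image.\<close>

lemma card_row_span_simple:
  assumes c: "c \<in> carrier F" and A: "A \<in> K r r" and s: "simple_root c (cp r A)" and r: "1 \<le> r"
  shows "card (row_span (scalar_matrix F r c \<boxminus> A)) = q ^ (r - 1)"
proof -
  let ?M = "scalar_matrix F r c \<boxminus> A"
  have M: "?M \<in> K r r" using c A by simp
  have "v \<star> ?M = Z 1 r \<longleftrightarrow> v \<star> A = sc c v" if v: "v \<in> K 1 r" for v
  proof -
    have "v \<star> ?M = sc c v \<boxminus> v \<star> A"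
      using mul_minus[OF v scalar_K[OF c] A] scalar_mul(2)[OF c v] by simp
    then show ?thesis using minus_eq_Z_iff[OF sc_K[OF c v] mul_K[OF v A]] by auto
  qed
  then have "{v \<in> K 1 r. v \<star> ?M = Z 1 r} = eigenspace r c A" by (auto simp: eigenspace_def)
  then have "card (row_span ?M) * q = q ^ r" using card_image_kernel[OF M] card_eigenspace_simple[OF c A s] by simp
  moreover have "q ^ r = q ^ (r - 1) * q" using r by (cases r) auto
  ultimately show ?thesis using q_ge_2 by (metis mult_right_cancel not_numeral_le_zero)
qed

lemma card_rows:
  assumes "\<And>i. i < k \<Longrightarrow> S i \<subseteq> K 1 n"
  shows "card {G \<in> K k n. \<forall>i<k. row_mat G i \<in> S i} = (\<Prod>i<k. card (S i))"
  using assms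
proof (induction k)
  case 0
  have "{G \<in> K 0 n. \<forall>i<0. row_mat G i \<in> S i} = {Z 0 n}" using Z_0(1) by auto
  then show ?case by simp
next
  case (Suc k)
  let ?A = "{G \<in> K k n. \<forall>i<k. row_mat G i \<in> S i}"
  have rv: "row_mat (vcat A v) i = (if i < k then row_mat A i else v)"
    if "A \<in> K k n" "v \<in> K 1 n" "i < Suc k" for A v i
    using that by (intro eq_matI) (auto simp: row_mat_def vcat_def M_dim)
  have "{G \<in> K (Suc k) n. \<forall>i<Suc k. row_mat G i \<in> S i} = {vcat A v | A v. A \<in> ?A \<and> v \<in> S k}"
  proof (intro equalityI subsetI)
    fix B assume B: "B \<in> {G \<in> K (Suc k) n. \<forall>i<Suc k. row_mat G i \<in> S i}"
    then have "B \<in> K (k + 1) n" by (simp flip: Suc_eq_plus1)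
    then obtain A v where Av: "A \<in> K k n" "v \<in> K 1 n" "B = vcat A v" by (rule vcat_cases)
    then show "B \<in> {vcat A v | A v. A \<in> ?A \<and> v \<in> S k}"
      using B rv[OF Av(1,2)] by (auto simp: less_Suc_eq)
  next
    fix B assume "B \<in> {vcat A v | A v. A \<in> ?A \<and> v \<in> S k}"
    then obtain A v where Av: "A \<in> ?A" "v \<in> S k" "B = vcat A v" by blast
    have v: "v \<in> K 1 n" using Suc.prems[of k] Av by blast
    have "vcat A v \<in> K (k + 1) n" using Av v by (intro vcat_M) auto
    then show "B \<in> {G \<in> K (Suc k) n. \<forall>i<Suc k. row_mat G i \<in> S i}"
      using Av rv[of A v] v by (auto simp: less_Suc_eq simp flip: Suc_eq_plus1)
  qed
  moreover have "card {vcat A v | A v. A \<in> ?A \<and> v \<in> S k} = (\<Sum>A\<in>?A. card (S k))"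
    using Suc.prems[of k] by (intro card_vcat_Sigma[of _ k n _ 1]) auto
  ultimately show ?case using Suc by simp
qed

text \<open>Complete Y to an invertible matrix P. Passing from B to P B permutes all matrices and
  turns the conditions into separate ones on the first k rows.\<close>

lemma card_mult_rows:
  assumes Y: "Y \<in> full_rank k m" and S: "\<And>i. i < k \<Longrightarrow> S i \<subseteq> K 1 r"
  shows "card {B \<in> K m r. \<forall>i<k. row_mat (Y \<star> B) i \<in> S i} = (\<Prod>i<k. card (S i)) * q ^ ((m - k) * r)"
proof -
  define e where "e = m - k"
  have m: "m = k + e" using full_rank_le[OF Y] by (simp add: e_def)
  obtain W where W: "W \<in> K e m" "vcat Y W \<in> full_rank m m" using full_rank_complete[OF Y] by (auto simp: e_def)
  let ?P = "vcat Y W"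
  obtain Q where Q: "Q \<in> full_rank m m" "Q \<star> ?P = I m" "?P \<star> Q = I m" using full_rank_square_inverse[OF W(2)] .
  note k = full_rank_K[OF Y] full_rank_K[OF W(2)] full_rank_K[OF Q(1)]
  let ?S = "\<lambda>i. if i < k then S i else K 1 r"
  let ?G = "{G \<in> K m r. \<forall>i<m. row_mat G i \<in> ?S i}"
  have rw: "row_mat (?P \<star> B) i = row_mat (Y \<star> B) i" if "B \<in> K m r" "i < k" for B i
    using that vcat_mul[OF k(1) W(1) that(1)] mul_K[OF k(1) that(1)]
    by (intro eq_matI) (auto simp: row_mat_def vcat_def M_dim)
  have iff: "?P \<star> B \<in> ?G \<longleftrightarrow> (\<forall>i<k. row_mat (Y \<star> B) i \<in> S i)" if B: "B \<in> K m r" for B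
    using rw[OF B] row_mat_K[OF mul_K[OF k(2) B]] mul_K[OF k(2) B] m by auto
  have "bij_betw (\<lambda>B. ?P \<star> B) {B \<in> K m r. \<forall>i<k. row_mat (Y \<star> B) i \<in> S i} ?G"
  proof (rule bij_betw_byWitness[where f' = "\<lambda>G. Q \<star> G"])
    have inv: "Q \<star> (?P \<star> B) = B" "?P \<star> (Q \<star> B) = B" if "B \<in> K m r" for B
      using mul_assoc[OF k(3,2) that] mul_assoc[OF k(2,3) that] Q that by simp_all
    show "\<forall>B\<in>{B \<in> K m r. \<forall>i<k. row_mat (Y \<star> B) i \<in> S i}. Q \<star> (?P \<star> B) = B" "\<forall>G\<in>?G. ?P \<star> (Q \<star> G) = G"
      using inv by auto
    show "(\<lambda>B. ?P \<star> B) ` {B \<in> K m r. \<forall>i<k. row_mat (Y \<star> B) i \<in> S i} \<subseteq> ?G" using iff by blast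
    show "(\<lambda>G. Q \<star> G) ` ?G \<subseteq> {B \<in> K m r. \<forall>i<k. row_mat (Y \<star> B) i \<in> S i}"
    proof (rule image_subsetI)
      fix G assume G: "G \<in> ?G"
      then have QG: "Q \<star> G \<in> K m r" using mul_K[OF k(3)] by blast
      have "?P \<star> (Q \<star> G) = G" using inv(2) G by blast
      then show "Q \<star> G \<in> {B \<in> K m r. \<forall>i<k. row_mat (Y \<star> B) i \<in> S i}" using iff[OF QG] QG G by simp
    qed
  qed
  from bij_betw_same_card[OF this] have "card {B \<in> K m r. \<forall>i<k. row_mat (Y \<star> B) i \<in> S i} = (\<Prod>i<m. card (?S i))"
    using card_rows[of m ?S r] S by simp
  also have "\<dots> = (\<Prod>i<k. card (S i)) * q ^ (e * r)"
  proof -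
    have "(\<Prod>i<k + j. card (?S i)) = (\<Prod>i<k. card (S i)) * q ^ (j * r)" for j
      by (induction j) (auto simp: card_K power_add mult.assoc mult.left_commute)
    then show ?thesis using m by simp
  qed
  finally show ?thesis by (simp add: e_def)
qed

definition simple_eigs :: "nat \<Rightarrow> nat \<Rightarrow> 'a mat \<Rightarrow> 'a set" where
  "simple_eigs m t T = {c \<in> carrier F - {\<zero>}. simple_root c (cp m T) \<and> (\<exists>y\<in>K 1 m. y $$ (0, t) = \<one> \<and> y \<star> T = sc c y)}"

text \<open>Membership in \<open>T_set\<close> expressed by the blocks of T, see
  \<open>T_set_iff\<close>. The last conjunct says that (x, y) is an eigenvector of the block matrix
  with last coordinate \<one>.\<close>

definition good :: "nat \<Rightarrow> nat \<Rightarrow> 'a \<Rightarrow> 'a mat \<Rightarrow> 'a mat \<Rightarrow> 'a mat \<Rightarrow> bool" where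
  "good r m c A B C \<longleftrightarrow> c \<in> simple_eigs r 0 A \<and> c \<in> simple_eigs m (m - 1) C \<and>
     (\<exists>x\<in>K 1 r. \<exists>y\<in>K 1 m. y $$ (0, m - 1) = \<one> \<and> y \<star> C = sc c y \<and> x \<star> A \<boxplus> y \<star> B = sc c x)"

lemma finite_simple_eigs: "finite (simple_eigs m t T)"
  by (rule finite_subset[OF _ fin]) (auto simp: simple_eigs_def)

lemma simple_mats_iff_simple_eigs: "S \<subseteq> carrier F - {\<zero>} \<Longrightarrow> T \<in> simple_mats m t S \<longleftrightarrow> T \<in> full_rank m m \<and> S \<subseteq> simple_eigs m t T"
  unfolding simple_mats_def simple_eigs_def by blast

text \<open>Let the rows of \<open>Y\<close> be the eigenvectors of \<open>C\<close> for the common eigenvalues. As \<open>Y\<close> has full rank, the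
  rows of \<open>Y B\<close> are independent and uniform for uniform \<open>B\<close>. An eigenvalue \<open>c\<close> fails to be good if the
  corresponding row misses the image of \<open>c - A\<close>, which is a hyperplane because \<open>c\<close> is a simple root.\<close>

lemma card_good:
  assumes r: "1 \<le> r" and m: "1 \<le> m" and A: "A \<in> K r r" and C: "C \<in> K m m"
  shows "real (card {B \<in> K m r. \<exists>c. good r m c A B C})
    = real q ^ (r * m) * (1 - (1 - 1 / real q) ^ card (simple_eigs r 0 A \<inter> simple_eigs m (m - 1) C))"
proof -
  define \<Lambda> where "\<Lambda> = simple_eigs r 0 A \<inter> simple_eigs m (m - 1) C"
  define k where "k = card \<Lambda>"
  have "finite \<Lambda>" using finite_simple_eigs by (simp add: \<Lambda>_def)
  then obtain l where l: "bij_betw l {..<k} \<Lambda>"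
    using ex_bij_betw_nat_finite[of \<Lambda>] by (auto simp: atLeast0LessThan k_def)
  have lL: "l i \<in> \<Lambda>" if "i < k" for i using bij_betwE[OF l] that by blast
  have lF: "l i \<in> carrier F" "simple_root (l i) (cp r A)" "simple_root (l i) (cp m C)" if "i < k" for i
    using lL[OF that] by (auto simp: \<Lambda>_def simple_eigs_def)
  have "\<forall>i<k. \<exists>y\<in>K 1 m. y $$ (0, m - 1) = \<one> \<and> y \<star> C = sc (l i) y"
    using lL by (auto simp: \<Lambda>_def simple_eigs_def)
  then obtain y where y: "\<And>i. i < k \<Longrightarrow> y i \<in> K 1 m" "\<And>i. i < k \<Longrightarrow> y i $$ (0, m - 1) = \<one>"
      "\<And>i. i < k \<Longrightarrow> y i \<star> C = sc (l i) (y i)" by metis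
  obtain Y where Y: "Y \<in> K k m" "\<And>i. i < k \<Longrightarrow> row_mat Y i = y i" using ex_of_rows[of k y m] y(1) by metis
  have nz: "row_mat Y i \<noteq> Z 1 m" if "i < k" for i
    using y(2)[OF that] Y(2)[OF that] m by (auto simp: mat_zero_def)
  have YF: "Y \<in> full_rank k m"
    by (rule eigenvectors_full_rank[OF lF(1) bij_betw_imp_inj_on[OF l] C Y(1)]) (use y Y nz in auto)
  let ?M = "\<lambda>i. scalar_matrix F r (l i) \<boxminus> A"
  let ?S = "\<lambda>i. K 1 r - row_span (?M i)"
  have MK: "?M i \<in> K r r" if "i < k" for i using lF(1)[OF that] A by simp
  have good_iff: "(\<exists>c. good r m c A B C) \<longleftrightarrow> (\<exists>i<k. row_mat (Y \<star> B) i \<in> row_span (?M i))" if B: "B \<in> K m r" for B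
  proof -
    have main: "good r m (l i) A B C \<longleftrightarrow> row_mat (Y \<star> B) i \<in> row_span (?M i)" if i: "i < k" for i
    proof -
      have rw: "row_mat (Y \<star> B) i = y i \<star> B" "y i \<star> B \<in> K 1 r"
        using row_mat_mul[OF Y(1) B i] Y(2)[OF i] mul_K[OF y(1)[OF i] B] by auto
      \<comment> \<open>Solving the eigenvector equation for y B exhibits it as an element of the
        image of c - A.\<close>
      have x: "x \<star> A \<boxplus> y i \<star> B = sc (l i) x \<longleftrightarrow> y i \<star> B = x \<star> ?M i" if x: "x \<in> K 1 r" for x
      proof -
        have xM: "x \<star> ?M i = sc (l i) x \<boxminus> x \<star> A"
          using mul_minus[OF x scalar_K[OF lF(1)[OF i]] A] scalar_mul(2)[OF lF(1)[OF i] x] by simp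
        have xA: "x \<star> A \<in> K 1 r" "sc (l i) x \<in> K 1 r" using mul_K[OF x A] sc_K[OF lF(1)[OF i] x] by auto
        show ?thesis unfolding xM
          using plus_comm[OF xA(1) rw(2)] plus_minus_cancel[OF rw(2) xA(1)] minus_plus_cancel[OF xA(2,1)] by metis
      qed
      \<comment> \<open>The normalized eigenvector at a simple root is unique, so the quantifier
        over z reduces to the chosen vector.\<close>
      have un: "z = y i" if "z \<in> K 1 m" "z $$ (0, m - 1) = \<one>" "z \<star> C = sc (l i) z" for z
        using normalized_eigenvector_unique[OF lF(1)[OF i] C lF(3)[OF i] _ that y(1)[OF i] y(2)[OF i] y(3)[OF i]] m
        by simp
      have "good r m (l i) A B C \<longleftrightarrow> (\<exists>x\<in>K 1 r. \<exists>z\<in>K 1 m. z $$ (0, m - 1) = \<one> \<and> z \<star> C = sc (l i) z \<and> x \<star> A \<boxplus> z \<star> B = sc (l i) x)"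
        using lL[OF i] by (auto simp: good_def \<Lambda>_def)
      also have "\<dots> \<longleftrightarrow> (\<exists>x\<in>K 1 r. x \<star> A \<boxplus> y i \<star> B = sc (l i) x)"
        using un y[OF i] by blast
      also have "\<dots> \<longleftrightarrow> y i \<star> B \<in> row_span (?M i)"
        using x M_dim(1)[OF MK[OF i]] by (auto simp: row_span_def)
      finally show ?thesis using rw by simp
    qed
    show ?thesis
    proof
      assume "\<exists>c. good r m c A B C"
      then obtain c where c: "good r m c A B C" ..
      then have "c \<in> \<Lambda>" by (simp add: good_def \<Lambda>_def)
      then obtain i where "i < k" "c = l i" using l by (auto simp: bij_betw_def)
      then show "\<exists>i<k. row_mat (Y \<star> B) i \<in> row_span (?M i)" using main c by blast
    qed (use main in blast)
  qed
  have SK: "card (?S i) = q ^ r - q ^ (r - 1)" if "i < k" for i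
    using card_Diff_subset[OF finite_subset[OF row_span_sub[OF MK[OF that]] card_K(1)] row_span_sub[OF MK[OF that]]]
      card_row_span_simple[OF lF(1)[OF that] A lF(2)[OF that] r] card_K(2)[of 1 r] by simp
  have bad: "card {B \<in> K m r. \<forall>i<k. row_mat (Y \<star> B) i \<in> ?S i} = (q ^ r - q ^ (r - 1)) ^ k * q ^ ((m - k) * r)"
    using card_mult_rows[OF YF, of ?S r] SK by simp
  have "{B \<in> K m r. \<exists>c. good r m c A B C} = K m r - {B \<in> K m r. \<forall>i<k. row_mat (Y \<star> B) i \<in> ?S i}"
    using good_iff row_mat_K[OF mul_K[OF Y(1)]] by blast
  then have "real (card {B \<in> K m r. \<exists>c. good r m c A B C})
      = real (card (K m r)) - real (card {B \<in> K m r. \<forall>i<k. row_mat (Y \<star> B) i \<in> ?S i})"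
    using card_K(1)[of m r] by (simp add: card_Diff_subset of_nat_diff card_mono)
  also have "\<dots> = real q ^ (m * r) - (real q ^ r - real q ^ (r - 1)) ^ k * real q ^ ((m - k) * r)"
  proof -
    have "q ^ (r - 1) \<le> q ^ r" using q_ge_2 by (intro power_increasing) auto
    then show ?thesis unfolding bad card_K(2) by (simp add: of_nat_diff)
  qed
  also have "real q ^ r - real q ^ (r - 1) = real q ^ r * (1 - 1 / real q)"
  proof -
    have "real q ^ r = real q * real q ^ (r - 1)" using r by (cases r) auto
    then show ?thesis using q_ge_2 by (simp add: field_simps)
  qed
  also have "(real q ^ r * (1 - 1 / real q)) ^ k * real q ^ ((m - k) * r) = real q ^ (m * r) * (1 - 1 / real q) ^ k"
  proof -
    \<comment> \<open>The exponents add up to m r because the independence of the eigenvectors gives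
      k \<le> m.\<close>
    have "r * k + (m - k) * r = m * r" using full_rank_le[OF YF] by (metis add_mult_distrib le_add_diff_inverse mult.commute)
    then have "(real q ^ r) ^ k * real q ^ ((m - k) * r) = real q ^ (m * r)"
      by (simp flip: power_mult power_add)
    then show ?thesis by (simp add: power_mult_distrib mult.assoc mult.left_commute)
  qed
  finally show ?thesis by (simp add: k_def \<Lambda>_def algebra_simps)
qed

definition good_triples :: "nat \<Rightarrow> nat \<Rightarrow> ('a mat \<times> 'a mat \<times> 'a mat) set" where
  "good_triples r m = {(A, C, B). A \<in> full_rank r r \<and> C \<in> full_rank m m \<and> B \<in> K m r \<and> (\<exists>c. good r m c A B C)}"

text \<open>By \<open>ratio_eq\<close> this is the proportion in the theorem for n = r + m; neither
  U nor the basis occurs in it.\<close>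

definition good_prop :: "nat \<Rightarrow> nat \<Rightarrow> real" where
  "good_prop r m = real (card (good_triples r m)) / (real (card (full_rank r r)) * real (card (full_rank m m)) * real q ^ (r * m))"

abbreviation common_eigs :: "nat \<Rightarrow> nat \<Rightarrow> 'a mat \<Rightarrow> 'a mat \<Rightarrow> nat" where
  "common_eigs r m A C \<equiv> card (simple_eigs r 0 A \<inter> simple_eigs m (m - 1) C)"

lemma good_prop_eq:
  assumes r: "1 \<le> r" and m: "1 \<le> m"
  shows "good_prop r m = (\<Sum>A\<in>full_rank r r. \<Sum>C\<in>full_rank m m. 1 - (1 - 1 / real q) ^ common_eigs r m A C)
    / (real (card (full_rank r r)) * real (card (full_rank m m)))"
proof -
  have "good_triples r m = Sigma (full_rank r r) (\<lambda>A. Sigma (full_rank m m) (\<lambda>C. {B \<in> K m r. \<exists>c. good r m c A B C}))"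
    by (auto simp: good_triples_def)
  moreover have "finite {B \<in> K m r. \<exists>c. good r m c A B C}" for A C
    by (rule finite_subset[OF _ card_K(1)[of m r]]) auto
  ultimately have "real (card (good_triples r m)) = (\<Sum>A\<in>full_rank r r. \<Sum>C\<in>full_rank m m. real (card {B \<in> K m r. \<exists>c. good r m c A B C}))"
    using finite_full_rank by (simp add: card_SigmaI)
  also have "\<dots> = (\<Sum>A\<in>full_rank r r. \<Sum>C\<in>full_rank m m. real q ^ (r * m) * (1 - (1 - 1 / real q) ^ common_eigs r m A C))"
    using card_good[OF r m] full_rank_K by (intro sum.cong refl) blast
  also have "\<dots> = real q ^ (r * m) * (\<Sum>A\<in>full_rank r r. \<Sum>C\<in>full_rank m m. 1 - (1 - 1 / real q) ^ common_eigs r m A C)"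
    by (simp add: sum_distrib_left)
  finally show ?thesis unfolding good_prop_def using q_ge_2 by simp
qed

text \<open>A and C range independently, so the double sum is a product of two counts of
  \<open>simple_mats\<close>.\<close>

lemma sum_simple_mats_pairs:
  assumes S: "S \<subseteq> carrier F - {\<zero>}"
  shows "(\<Sum>A\<in>full_rank r r. \<Sum>C\<in>full_rank m m. if S \<subseteq> simple_eigs r 0 A \<inter> simple_eigs m (m - 1) C then x else 0)
    = x * (simple_prop r 0 S * simple_prop m (m - 1) S) * (real (card (full_rank r r)) * real (card (full_rank m m)))"
proof -
  have "(\<Sum>A\<in>full_rank r r. \<Sum>C\<in>full_rank m m. if S \<subseteq> simple_eigs r 0 A \<inter> simple_eigs m (m - 1) C then x else 0)
      = (\<Sum>A\<in>full_rank r r. \<Sum>C\<in>full_rank m m. x * ((if S \<subseteq> simple_eigs r 0 A then 1 else 0) * (if S \<subseteq> simple_eigs m (m - 1) C then 1 else 0)))"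
    by (intro sum.cong) auto
  also have "\<dots> = x * ((\<Sum>A\<in>full_rank r r. if S \<subseteq> simple_eigs r 0 A then 1 else 0) * (\<Sum>C\<in>full_rank m m. if S \<subseteq> simple_eigs m (m - 1) C then 1 else 0))"
    unfolding sum_product by (simp only: sum_distrib_left)
  also have "(\<Sum>A\<in>full_rank r r. if S \<subseteq> simple_eigs r 0 A then 1 else 0 :: real) = real (card (simple_mats r 0 S))"
    using finite_full_rank simple_mats_iff_simple_eigs[OF S, of _ r 0] by (simp add: sum.If_cases Int_def)
      (metis (no_types, lifting) Collect_cong Collect_mem_eq)
  also have "(\<Sum>C\<in>full_rank m m. if S \<subseteq> simple_eigs m (m - 1) C then 1 else 0 :: real) = real (card (simple_mats m (m - 1) S))"
    using finite_full_rank simple_mats_iff_simple_eigs[OF S, of _ m "m - 1"] by (simp add: sum.If_cases Int_def)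
      (metis (no_types, lifting) Collect_cong Collect_mem_eq)
  finally show ?thesis
    using card_full_rank_pos[of r r] card_full_rank_pos[of m m] by (simp add: simple_prop_def)
qed

end

text \<open>The binomial theorem indexed by subsets, which is the form that inclusion-exclusion
  uses.\<close>

lemma sum_Pow_power:
  fixes x :: real
  assumes "finite A"
  shows "(\<Sum>S\<in>Pow A. x ^ card S) = (1 + x) ^ card A"
  using assms
proof (induction A rule: finite_induct)
  case (insert a A)
  have fp: "finite (Pow A)" using insert by simp
  have "(\<Sum>S\<in>insert a ` Pow A. x ^ card S) = (\<Sum>S\<in>Pow A. x ^ card (insert a S))"
    using insert by (intro sum.reindex_cong[of "insert a"]) (auto simp: inj_on_def dest!: insert_eq_iff[THEN iffD1, rotated 2] )
  also have "\<dots> = (\<Sum>S\<in>Pow A. x * x ^ card S)"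
  proof (rule sum.cong[OF refl])
    fix S assume "S \<in> Pow A"
    then have "a \<notin> S" "finite S" using insert finite_subset by auto
    then show "x ^ card (insert a S) = x * x ^ card S" by simp
  qed
  also have "\<dots> = x * (1 + x) ^ card A" using insert by (simp flip: sum_distrib_left)
  finally have "(\<Sum>S\<in>insert a ` Pow A. x ^ card S) = x * (1 + x) ^ card A" .
  moreover have "Pow A \<inter> insert a ` Pow A = {}" using insert by auto
  ultimately show ?case
    using insert fp by (simp add: Pow_insert sum.union_disjoint algebra_simps)
qed simp

text \<open>Bonferroni's inequalities for k independent events of probability x, truncated after the
  single events and after the pairs.\<close>

lemma one_minus_power_bounds:
  fixes x :: real
  assumes "0 \<le> x" "x \<le> 1"
  shows "1 - real k * x \<le> (1 - x) ^ k" "(1 - x) ^ k \<le> 1 - real k * x + real k * (real k - 1) / 2 * x ^ 2"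
proof -
  show b: "1 - real k * x \<le> (1 - x) ^ k" for k
    using Bernoulli_inequality[of "- x" k] assms by simp
  show "(1 - x) ^ k \<le> 1 - real k * x + real k * (real k - 1) / 2 * x ^ 2"
  proof (induction k)
    case (Suc k)
    have "(1 - x) ^ Suc k = (1 - x) ^ k - x * (1 - x) ^ k" by (simp add: algebra_simps)
    also have "\<dots> \<le> (1 - real k * x + real k * (real k - 1) / 2 * x ^ 2) - x * (1 - real k * x)"
      using Suc b[of k] assms by (intro diff_mono mult_left_mono) auto
    also have "\<dots> = 1 - real (Suc k) * x + real (Suc k) * (real (Suc k) - 1) / 2 * x ^ 2"
      by (simp add: field_simps power2_eq_square)
    finally show ?case .
  qed simp
qed

section \<open>Inclusion-exclusion and two-sided bounds for the good triples\<close>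

context finite_field
begin

abbreviation F0 :: "'a set" where "F0 \<equiv> carrier F - {\<zero>}"

lemma finite_F0: "finite F0"
  using fin by simp

lemma card_F0: "real (card F0) = real q - 1"
  using fin q_ge_2 by (simp add: card_Diff_subset of_nat_diff)

lemma simple_eigs_F0: "simple_eigs m t T \<subseteq> F0"
  by (auto simp: simple_eigs_def)

text \<open>The power of 1 - 1/q is expanded over the subsets of the set of common eigenvalues.
  Letting S run through all subsets of \<open>F0\<close> makes the index set independent of A and C,
  so that the sums can be exchanged.\<close>

lemma good_prop_inclusion_exclusion:
  assumes r: "1 \<le> r" and m: "1 \<le> m"
  shows "good_prop r m = 1 - (\<Sum>S\<in>Pow F0. (- 1 / real q) ^ card S * (simple_prop r 0 S * simple_prop m (m - 1) S))"
proof -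
  let ?g = "real (card (full_rank r r)) * real (card (full_rank m m))"
  have g: "0 < ?g" using card_full_rank_pos[of r r] card_full_rank_pos[of m m] by simp
  have "(1 - 1 / real q) ^ common_eigs r m A C
      = (\<Sum>S\<in>Pow F0. if S \<subseteq> simple_eigs r 0 A \<inter> simple_eigs m (m - 1) C then (- 1 / real q) ^ card S else 0)" for A C
  proof -
    let ?L = "simple_eigs r 0 A \<inter> simple_eigs m (m - 1) C"
    have "(1 - 1 / real q) ^ card ?L = (\<Sum>S\<in>Pow ?L. (- 1 / real q) ^ card S)"
      using sum_Pow_power[of ?L "- 1 / real q"] finite_simple_eigs by simp
    also have "\<dots> = (\<Sum>S\<in>Pow F0. if S \<subseteq> ?L then (- 1 / real q) ^ card S else 0)"
      using simple_eigs_F0[of r 0 A] finite_F0 by (intro sum.mono_neutral_cong_left) auto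
    finally show ?thesis .
  qed
  then have "(\<Sum>A\<in>full_rank r r. \<Sum>C\<in>full_rank m m. (1 - 1 / real q) ^ common_eigs r m A C)
      = (\<Sum>A\<in>full_rank r r. \<Sum>C\<in>full_rank m m. \<Sum>S\<in>Pow F0. if S \<subseteq> simple_eigs r 0 A \<inter> simple_eigs m (m - 1) C then (- 1 / real q) ^ card S else 0)"
    by simp
  also have "\<dots> = (\<Sum>A\<in>full_rank r r. \<Sum>S\<in>Pow F0. \<Sum>C\<in>full_rank m m. if S \<subseteq> simple_eigs r 0 A \<inter> simple_eigs m (m - 1) C then (- 1 / real q) ^ card S else 0)"
    by (intro sum.cong refl sum.swap)
  also have "\<dots> = (\<Sum>S\<in>Pow F0. \<Sum>A\<in>full_rank r r. \<Sum>C\<in>full_rank m m. if S \<subseteq> simple_eigs r 0 A \<inter> simple_eigs m (m - 1) C then (- 1 / real q) ^ card S else 0)"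
    by (rule sum.swap)
  also have "\<dots> = (\<Sum>S\<in>Pow F0. (- 1 / real q) ^ card S * (simple_prop r 0 S * simple_prop m (m - 1) S) * ?g)"
    by (intro sum.cong refl) (simp only: sum_simple_mats_pairs Pow_iff)
  also have "\<dots> = (\<Sum>S\<in>Pow F0. (- 1 / real q) ^ card S * (simple_prop r 0 S * simple_prop m (m - 1) S)) * ?g"
    by (rule sum_distrib_right[symmetric])
  finally have e: "(\<Sum>A\<in>full_rank r r. \<Sum>C\<in>full_rank m m. (1 - 1 / real q) ^ common_eigs r m A C)
      = (\<Sum>S\<in>Pow F0. (- 1 / real q) ^ card S * (simple_prop r 0 S * simple_prop m (m - 1) S)) * ?g" .
  have s1: "(\<Sum>A\<in>full_rank r r. \<Sum>C\<in>full_rank m m. 1) = ?g" by simp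
  have h: "(x - y * x) / x = 1 - y" if "x \<noteq> 0" for x y :: real using that by (simp add: field_simps)
  show ?thesis
    unfolding good_prop_eq[OF r m] sum_subtractf e s1 by (rule h[OF less_imp_neq[OF g, THEN not_sym]])
qed

text \<open>Averages of \<open>one_minus_power_bounds\<close> over A and C. The mean of the number k
  of common eigenvalues is a sum over c, and the mean of k (k - 1) is a sum over ordered pairs of
  distinct elements.\<close>

lemma good_prop_bounds:
  assumes r: "1 \<le> r" and m: "1 \<le> m"
  shows "good_prop r m \<le> 1 / real q * (\<Sum>c\<in>F0. simple_prop r 0 {c} * simple_prop m (m - 1) {c})"
    "1 / real q * (\<Sum>c\<in>F0. simple_prop r 0 {c} * simple_prop m (m - 1) {c})
      - 1 / (2 * real q ^ 2) * (\<Sum>(c, d)\<in>{(c, d). c \<in> F0 \<and> d \<in> F0 \<and> c \<noteq> d}. simple_prop r 0 {c, d} * simple_prop m (m - 1) {c, d}) \<le> good_prop r m"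
proof -
  let ?g = "real (card (full_rank r r)) * real (card (full_rank m m))"
  let ?D = "{(c, d). c \<in> F0 \<and> d \<in> F0 \<and> c \<noteq> d}"
  let ?k = "\<lambda>A C. real (common_eigs r m A C)"
  have g: "0 < ?g" using card_full_rank_pos[of r r] card_full_rank_pos[of m m] by simp
  have finD: "finite ?D" by (rule finite_subset[of _ "F0 \<times> F0"]) (use finite_F0 in auto)
  have k1: "?k A C = (\<Sum>c\<in>F0. if {c} \<subseteq> simple_eigs r 0 A \<inter> simple_eigs m (m - 1) C then 1 else 0)" for A C
  proof -
    have "F0 \<inter> {c. {c} \<subseteq> simple_eigs r 0 A \<inter> simple_eigs m (m - 1) C} = simple_eigs r 0 A \<inter> simple_eigs m (m - 1) C"
      using simple_eigs_F0[of r 0 A] by auto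
    then show ?thesis using finite_F0 by (simp add: sum.If_cases)
  qed
  have k2: "?k A C * (?k A C - 1) = (\<Sum>p\<in>?D. if {fst p, snd p} \<subseteq> simple_eigs r 0 A \<inter> simple_eigs m (m - 1) C then 1 else 0)" for A C
  proof -
    let ?L = "simple_eigs r 0 A \<inter> simple_eigs m (m - 1) C"
    have fL: "finite ?L" using finite_simple_eigs by simp
    have "?D \<inter> {p. {fst p, snd p} \<subseteq> ?L} = ?L \<times> ?L - (\<lambda>c. (c, c)) ` ?L"
      using simple_eigs_F0[of r 0 A] by auto
    moreover have "real (card (?L \<times> ?L - (\<lambda>c. (c, c)) ` ?L)) = real (card (?L \<times> ?L)) - real (card ((\<lambda>c. (c, c)) ` ?L))"
    proof -
      have sub: "(\<lambda>c. (c, c)) ` ?L \<subseteq> ?L \<times> ?L" by auto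
      show ?thesis
        unfolding card_Diff_subset[OF finite_imageI[OF fL] sub]
        by (rule of_nat_diff[OF card_mono[OF finite_cartesian_product[OF fL fL] sub]])
    qed
    moreover have "card ((\<lambda>c. (c, c)) ` ?L) = card ?L" by (intro card_image inj_onI) auto
    ultimately have "real (card (?D \<inter> {p. {fst p, snd p} \<subseteq> ?L})) = ?k A C * (?k A C - 1)"
      using fL by (simp add: card_cartesian_product algebra_simps)
    then show ?thesis using finD by (simp add: sum.If_cases)
  qed
  have s1: "(\<Sum>A\<in>full_rank r r. \<Sum>C\<in>full_rank m m. ?k A C) = (\<Sum>c\<in>F0. simple_prop r 0 {c} * simple_prop m (m - 1) {c}) * ?g"
  proof -
    have "(\<Sum>A\<in>full_rank r r. \<Sum>C\<in>full_rank m m. ?k A C)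
        = (\<Sum>A\<in>full_rank r r. \<Sum>c\<in>F0. \<Sum>C\<in>full_rank m m. if {c} \<subseteq> simple_eigs r 0 A \<inter> simple_eigs m (m - 1) C then 1 else 0)"
      unfolding k1 by (intro sum.cong refl sum.swap)
    also have "\<dots> = (\<Sum>c\<in>F0. \<Sum>A\<in>full_rank r r. \<Sum>C\<in>full_rank m m. if {c} \<subseteq> simple_eigs r 0 A \<inter> simple_eigs m (m - 1) C then 1 else 0)"
      by (rule sum.swap)
    also have "\<dots> = (\<Sum>c\<in>F0. 1 * (simple_prop r 0 {c} * simple_prop m (m - 1) {c}) * ?g)"
      by (intro sum.cong refl sum_simple_mats_pairs) auto
    finally show ?thesis by (simp add: sum_distrib_right)
  qed
  have s2: "(\<Sum>A\<in>full_rank r r. \<Sum>C\<in>full_rank m m. ?k A C * (?k A C - 1))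
      = (\<Sum>p\<in>?D. simple_prop r 0 {fst p, snd p} * simple_prop m (m - 1) {fst p, snd p}) * ?g"
  proof -
    have "(\<Sum>A\<in>full_rank r r. \<Sum>C\<in>full_rank m m. ?k A C * (?k A C - 1))
        = (\<Sum>A\<in>full_rank r r. \<Sum>p\<in>?D. \<Sum>C\<in>full_rank m m. if {fst p, snd p} \<subseteq> simple_eigs r 0 A \<inter> simple_eigs m (m - 1) C then 1 else 0)"
      unfolding k2 by (intro sum.cong refl sum.swap)
    also have "\<dots> = (\<Sum>p\<in>?D. \<Sum>A\<in>full_rank r r. \<Sum>C\<in>full_rank m m. if {fst p, snd p} \<subseteq> simple_eigs r 0 A \<inter> simple_eigs m (m - 1) C then 1 else 0)"
      by (rule sum.swap)
    also have "\<dots> = (\<Sum>p\<in>?D. 1 * (simple_prop r 0 {fst p, snd p} * simple_prop m (m - 1) {fst p, snd p}) * ?g)"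
      by (intro sum.cong refl sum_simple_mats_pairs) auto
    finally show ?thesis by (simp add: sum_distrib_right)
  qed
  have x: "0 \<le> 1 / real q" "1 / real q \<le> 1" using q_ge_2 by auto
  have "(\<Sum>A\<in>full_rank r r. \<Sum>C\<in>full_rank m m. 1 - (1 - 1 / real q) ^ common_eigs r m A C)
      \<le> (\<Sum>A\<in>full_rank r r. \<Sum>C\<in>full_rank m m. 1 / real q * ?k A C)"
  proof (intro sum_mono)
    fix A C show "1 - (1 - 1 / real q) ^ common_eigs r m A C \<le> 1 / real q * ?k A C"
      using one_minus_power_bounds(1)[OF x, of "common_eigs r m A C"] by (simp add: mult.commute)
  qed
  also have "\<dots> = 1 / real q * (\<Sum>c\<in>F0. simple_prop r 0 {c} * simple_prop m (m - 1) {c}) * ?g"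
    unfolding sum_distrib_left[symmetric] s1 by (simp only: mult.assoc)
  finally show "good_prop r m \<le> 1 / real q * (\<Sum>c\<in>F0. simple_prop r 0 {c} * simple_prop m (m - 1) {c})"
    unfolding good_prop_eq[OF r m] using g by (simp only: pos_divide_le_eq)
  have "(\<Sum>A\<in>full_rank r r. \<Sum>C\<in>full_rank m m. 1 / real q * ?k A C - 1 / (2 * real q ^ 2) * (?k A C * (?k A C - 1)))
      \<le> (\<Sum>A\<in>full_rank r r. \<Sum>C\<in>full_rank m m. 1 - (1 - 1 / real q) ^ common_eigs r m A C)"
  proof (intro sum_mono)
    fix A C
    have "(1 - 1 / real q) ^ common_eigs r m A C \<le> 1 - ?k A C * (1 / real q) + ?k A C * (?k A C - 1) / 2 * (1 / real q) ^ 2"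
      by (rule one_minus_power_bounds(2)[OF x])
    also have "?k A C * (?k A C - 1) / 2 * (1 / real q) ^ 2 = 1 / (2 * real q ^ 2) * (?k A C * (?k A C - 1))"
      by (simp add: power_one_over)
    finally show "1 / real q * ?k A C - 1 / (2 * real q ^ 2) * (?k A C * (?k A C - 1)) \<le> 1 - (1 - 1 / real q) ^ common_eigs r m A C"
      by (simp add: mult.commute)
  qed
  moreover have "(\<Sum>A\<in>full_rank r r. \<Sum>C\<in>full_rank m m. 1 / real q * ?k A C - 1 / (2 * real q ^ 2) * (?k A C * (?k A C - 1)))
      = (1 / real q * (\<Sum>c\<in>F0. simple_prop r 0 {c} * simple_prop m (m - 1) {c})
        - 1 / (2 * real q ^ 2) * (\<Sum>p\<in>?D. simple_prop r 0 {fst p, snd p} * simple_prop m (m - 1) {fst p, snd p})) * ?g"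
    unfolding sum_subtractf sum_distrib_left[symmetric] s1 s2 by (simp only: left_diff_distrib mult.assoc)
  ultimately show "1 / real q * (\<Sum>c\<in>F0. simple_prop r 0 {c} * simple_prop m (m - 1) {c})
      - 1 / (2 * real q ^ 2) * (\<Sum>(c, d)\<in>?D. simple_prop r 0 {c, d} * simple_prop m (m - 1) {c, d}) \<le> good_prop r m"
    unfolding good_prop_eq[OF r m] case_prod_beta using g by (simp only: pos_le_divide_eq)
qed

text \<open>With a = 1/(q - 1) the upper bound is a / q. The lower bound is at least (q - 3) / q^3
  minus a pair term of at most 1 / q^3, and the constant 4 is the sum of this 3 and 1.\<close>

lemma good_prop_close:
  assumes r: "1 \<le> r" and m: "1 \<le> m"
  shows "\<bar>good_prop r m - 1 / real q ^ 2\<bar> \<le> 4 / real q ^ 3"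
proof -
  let ?D = "{(c, d). c \<in> F0 \<and> d \<in> F0 \<and> c \<noteq> d}"
  have Q: "2 \<le> real q" using q_ge_2 by simp
  have t: "0 < r" "m - 1 < m" using r m by auto
  define a where "a = 1 / (real q - 1)"
  have a: "0 < a" "a \<le> 1" "(real q - 1) * a = 1" using Q by (auto simp: a_def)
  have nn: "0 \<le> 1 / real q * (1 - a)" using a Q by simp
  have up: "simple_prop r 0 {c} * simple_prop m (m - 1) {c} \<le> a * a"
    and lo: "(1 / real q * (1 - a)) * (1 / real q * (1 - a)) \<le> simple_prop r 0 {c} * simple_prop m (m - 1) {c}"
    if "c \<in> F0" for c
  proof -
    have c: "c \<in> carrier F" "c \<noteq> \<zero>" using that by auto
    note b = simple_prop_single_bounds[OF t(1) c, folded a_def] simple_prop_single_bounds[OF t(2) c, folded a_def]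
    show "simple_prop r 0 {c} * simple_prop m (m - 1) {c} \<le> a * a"
      using a by (intro mult_mono b(2,4) simple_prop_nonneg) auto
    show "(1 / real q * (1 - a)) * (1 / real q * (1 - a)) \<le> simple_prop r 0 {c} * simple_prop m (m - 1) {c}"
      by (intro mult_mono b(1,3) simple_prop_nonneg nn)
  qed
  have "(\<Sum>c\<in>F0. simple_prop r 0 {c} * simple_prop m (m - 1) {c}) \<le> (\<Sum>c\<in>F0. a * a)" by (rule sum_mono) (rule up)
  then have "(\<Sum>c\<in>F0. simple_prop r 0 {c} * simple_prop m (m - 1) {c}) \<le> (real q - 1) * (a * a)"
    by (simp only: sum_constant card_F0)
  also have "\<dots> = a" using a by (simp flip: mult.assoc)
  finally have u: "(\<Sum>c\<in>F0. simple_prop r 0 {c} * simple_prop m (m - 1) {c}) \<le> a" .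
  have "good_prop r m \<le> 1 / real q * (\<Sum>c\<in>F0. simple_prop r 0 {c} * simple_prop m (m - 1) {c})" by (rule good_prop_bounds(1)[OF r m])
  also have "\<dots> \<le> 1 / real q * a" using u Q by (intro mult_left_mono) auto
  finally have upper: "good_prop r m \<le> 1 / real q * a" .
  have "(\<Sum>c\<in>F0. (1 / real q * (1 - a)) * (1 / real q * (1 - a))) \<le> (\<Sum>c\<in>F0. simple_prop r 0 {c} * simple_prop m (m - 1) {c})"
    by (rule sum_mono) (rule lo)
  then have l: "(real q - 1) * ((1 / real q * (1 - a)) * (1 / real q * (1 - a))) \<le> (\<Sum>c\<in>F0. simple_prop r 0 {c} * simple_prop m (m - 1) {c})"
    by (simp only: sum_constant card_F0)
  have "(\<Sum>(c, d)\<in>?D. simple_prop r 0 {c, d} * simple_prop m (m - 1) {c, d}) \<le> (\<Sum>(c, d)\<in>?D. a ^ 2 * a ^ 2)"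
  proof (rule sum_mono)
    fix p assume "p \<in> ?D"
    then obtain c d where p: "p = (c, d)" "c \<in> F0" "d \<in> F0" "c \<noteq> d" by blast
    have a2: "1 / (real q - 1) ^ 2 = a ^ 2" by (simp add: a_def power_one_over)
    have "simple_prop r 0 {c, d} * simple_prop m (m - 1) {c, d} \<le> a ^ 2 * a ^ 2"
      using simple_prop_pair_le[OF t(1) p(2-4)] simple_prop_pair_le[OF t(2) p(2-4)] simple_prop_nonneg unfolding a2
      by (intro mult_mono) auto
    then show "(case p of (c, d) \<Rightarrow> simple_prop r 0 {c, d} * simple_prop m (m - 1) {c, d}) \<le> (case p of (c, d) \<Rightarrow> a ^ 2 * a ^ 2)"
      using p by simp
  qed
  also have "\<dots> = real (card ?D) * (a ^ 2 * a ^ 2)" by (simp add: case_prod_beta)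
  also have "\<dots> \<le> (real q - 1) ^ 2 * (a ^ 2 * a ^ 2)"
  proof -
    have "card ?D \<le> card (F0 \<times> F0)" using finite_F0 by (intro card_mono) auto
    then have "real (card ?D) \<le> real (card F0) * real (card F0)"
      unfolding card_cartesian_product of_nat_mult[symmetric] by (rule of_nat_mono)
    then have "real (card ?D) \<le> (real q - 1) ^ 2" unfolding card_F0 power2_eq_square .
    then show ?thesis by (rule mult_right_mono) simp
  qed
  also have "\<dots> = a ^ 2" using a by (simp add: power_mult_distrib[symmetric] mult.assoc[symmetric])
  finally have d: "(\<Sum>(c, d)\<in>?D. simple_prop r 0 {c, d} * simple_prop m (m - 1) {c, d}) \<le> a ^ 2" .
  have "1 / real q * ((real q - 1) * ((1 / real q * (1 - a)) * (1 / real q * (1 - a)))) - 1 / (2 * real q ^ 2) * a ^ 2 \<le> good_prop r m"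
    using good_prop_bounds(2)[OF r m] mult_left_mono[OF l, of "1 / real q"] mult_left_mono[OF d, of "1 / (2 * real q ^ 2)"] Q
    by simp
  moreover have "1 / real q ^ 2 - 4 / real q ^ 3
      \<le> 1 / real q * ((real q - 1) * ((1 / real q * (1 - a)) * (1 / real q * (1 - a)))) - 1 / (2 * real q ^ 2) * a ^ 2"
  proof -
    have e: "1 / real q * ((real q - 1) * ((1 / real q * (1 - a)) * (1 / real q * (1 - a))))
        = (real q - 3 + a) / real q ^ 3"
    proof -
      have "(real q - 1) * ((1 - a) * (1 - a)) = real q - 3 + a"
      proof -
        have "(real q - 1) * ((1 - a) * (1 - a)) = (real q - 1) - 2 * ((real q - 1) * a) + ((real q - 1) * a) * a"
          by (simp add: algebra_simps)
        then show ?thesis using a by simp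
      qed
      then show ?thesis using Q by (simp add: field_simps power3_eq_cube)
    qed
    \<comment> \<open>Equality holds for q = 2, where a = 1; this estimate is what bounds the pair
      term by 1 / q^3.\<close>
    have "real q * a ^ 2 \<le> 2"
    proof -
      have "real q * a = 1 + a" using a(3) unfolding left_diff_distrib by linarith
      then have "real q * a ^ 2 = (1 + a) * a" by (simp add: power2_eq_square)
      also have "\<dots> \<le> 2 * 1" using a by (intro mult_mono) auto
      finally show ?thesis by simp
    qed
    then have "1 / (2 * real q ^ 2) * a ^ 2 \<le> 1 / real q ^ 3"
      using Q by (simp add: field_simps power3_eq_cube power2_eq_square)
    moreover have "1 / real q ^ 2 - 4 / real q ^ 3 = (real q - 4) / real q ^ 3"
      using Q by (simp add: field_simps power3_eq_cube power2_eq_square)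
    moreover have "(real q - 3) / real q ^ 3 \<le> (real q - 3 + a) / real q ^ 3"
      using a Q by (intro divide_right_mono) auto
    moreover have "(real q - 4) / real q ^ 3 + 1 / real q ^ 3 = (real q - 3) / real q ^ 3"
      by (simp flip: add_divide_distrib)
    ultimately show ?thesis unfolding e by linarith
  qed
  moreover have "1 / real q * a \<le> 1 / real q ^ 2 + 4 / real q ^ 3"
  proof -
    have qa: "real q * a = 1 + a" using a(3) unfolding left_diff_distrib by linarith
    have "real q * (real q * a) = real q + (1 + a)" by (simp add: qa distrib_left)
    then have "real q * (real q * a) \<le> real q + 4" using a(2) by linarith
    then show ?thesis using Q by (simp add: field_simps power3_eq_cube power2_eq_square)
  qed
  ultimately show ?thesis using upper by linarith
qed

text \<open>For a fixed field the expansion is a finite sum over the subsets of \<open>F0\<close>,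
  and with r fixed only the factor of the lower block varies with m.\<close>

lemma good_prop_convergent:
  assumes r: "1 \<le> r"
  shows "convergent (\<lambda>m. good_prop r m)"
proof -
  have "convergent (\<lambda>m. simple_prop m (m - 1) S)" if "S \<in> Pow F0" for S
    using convergent_simple_prop[of "\<lambda>m. m - 1" S] that by auto
  then have "\<forall>S\<in>Pow F0. \<exists>L. (\<lambda>m. simple_prop m (m - 1) S) \<longlonglongrightarrow> L" by (simp add: convergent_def)
  then obtain L where L: "\<And>S. S \<in> Pow F0 \<Longrightarrow> (\<lambda>m. simple_prop m (m - 1) S) \<longlonglongrightarrow> L S" by metis
  have "(\<lambda>m. 1 - (\<Sum>S\<in>Pow F0. (- 1 / real q) ^ card S * (simple_prop r 0 S * simple_prop m (m - 1) S)))
      \<longlonglongrightarrow> 1 - (\<Sum>S\<in>Pow F0. (- 1 / real q) ^ card S * (simple_prop r 0 S * L S))"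
    by (intro tendsto_intros L)
  moreover have "eventually (\<lambda>m. 1 - (\<Sum>S\<in>Pow F0. (- 1 / real q) ^ card S * (simple_prop r 0 S * simple_prop m (m - 1) S)) = good_prop r m) sequentially"
    using eventually_ge_at_top[of 1] by (rule eventually_mono) (simp add: good_prop_inclusion_exclusion[OF r])
  ultimately show ?thesis using Lim_transform_eventually convergentI by blast
qed

theorem good_prop_limit:
  assumes r: "1 \<le> r"
  obtains L where "(\<lambda>m. good_prop r m) \<longlonglongrightarrow> L" "\<bar>L - 1 / real q ^ 2\<bar> \<le> 4 / real q ^ 3"
proof -
  obtain L where L: "(\<lambda>m. good_prop r m) \<longlonglongrightarrow> L" using good_prop_convergent[OF r] by (auto simp: convergent_def)
  have "(\<lambda>m. \<bar>good_prop r m - 1 / real q ^ 2\<bar>) \<longlonglongrightarrow> \<bar>L - 1 / real q ^ 2\<bar>" by (intro tendsto_intros L)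
  moreover have "eventually (\<lambda>m. \<bar>good_prop r m - 1 / real q ^ 2\<bar> \<le> 4 / real q ^ 3) sequentially"
    using eventually_ge_at_top[of 1] by (rule eventually_mono) (rule good_prop_close[OF r])
  ultimately have "\<bar>L - 1 / real q ^ 2\<bar> \<le> 4 / real q ^ 3"
    by (intro tendsto_upperbound[of _ _ sequentially]) auto
  with L show thesis by (rule that)
qed

end

hide_const (open) Polynomial.order

section \<open>Row vectors and the stabilizer of a subspace\<close>

text \<open>Turns the vectors of the statement into one-row matrices, to which the matrix results
  apply.\<close>

definition rv :: "'a vec \<Rightarrow> 'a mat" where
  "rv v = mat 1 (dim_vec v) (\<lambda>(_, j). v $ j)"

context finite_field
begin

abbreviation V :: "nat \<Rightarrow> ('a, 'a vec) module" where "V \<equiv> row_space F"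

lemma carrier_V: "v \<in> carrier (V n) \<longleftrightarrow> v \<in> carrier_vec n \<and> (\<forall>i<n. v $ i \<in> carrier F)"
  by (simp add: row_space_def)

lemma add_V: "v \<oplus>\<^bsub>V n\<^esub> w = vec n (\<lambda>i. v $ i \<oplus> w $ i)"
  by (simp add: row_space_def)

lemma smult_V: "a \<odot>\<^bsub>V n\<^esub> w = vec n (\<lambda>i. a \<otimes> w $ i)"
  by (simp add: row_space_def)

lemma zero_V: "\<zero>\<^bsub>V n\<^esub> = vec n (\<lambda>_. \<zero>)"
  by (simp add: row_space_def)

lemma vectorspace_V: "vectorspace F (V n)"
proof -
  have "abelian_group (V n)"
  proof (rule abelian_groupI)
    fix v assume v: "v \<in> carrier (V n)"
    then show "\<exists>w\<in>carrier (V n). w \<oplus>\<^bsub>V n\<^esub> v = \<zero>\<^bsub>V n\<^esub>"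
      by (intro bexI[of _ "vec n (\<lambda>i. \<ominus> v $ i)"]) (auto simp: carrier_V add_V zero_V l_neg)
  qed (auto simp: carrier_V add_V zero_V a_ac intro!: eq_vecI)
  then have "module F (V n)"
    by (rule moduleI[OF is_cring])
      (auto simp: carrier_V add_V smult_V l_distr r_distr m_assoc intro!: eq_vecI)
  then show ?thesis using field_axioms by (simp add: vectorspace_def)
qed

lemma rv_inj: "v \<in> carrier (V n) \<Longrightarrow> w \<in> carrier (V n) \<Longrightarrow> rv v = rv w \<Longrightarrow> v = w"
proof (rule eq_vecI)
  fix i assume a: "v \<in> carrier (V n)" "w \<in> carrier (V n)" "rv v = rv w" "i < dim_vec w"
  then have "i < dim_vec v" by (auto simp: carrier_V)
  then have "rv v $$ (0, i) = v $ i" "rv w $$ (0, i) = w $ i" using a(4) by (auto simp: rv_def)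
  then show "v $ i = w $ i" using a(3) by simp
qed (auto simp: carrier_V)

lemma rv_surj:
  assumes "A \<in> K 1 n"
  obtains v where "v \<in> carrier (V n)" "rv v = A"
proof
  show "vec n (\<lambda>j. A $$ (0, j)) \<in> carrier (V n)" using M_entry[OF assms] by (simp add: carrier_V)
  show "rv (vec n (\<lambda>j. A $$ (0, j))) = A" using M_dim[OF assms] by (intro eq_matI) (auto simp: rv_def)
qed

lemma rv_zero: "rv (\<zero>\<^bsub>V n\<^esub>) = Z 1 n"
  by (intro eq_matI) (auto simp: rv_def zero_V mat_zero_def)

lemma rv_add: "v \<in> carrier (V n) \<Longrightarrow> w \<in> carrier (V n) \<Longrightarrow> rv (v \<oplus>\<^bsub>V n\<^esub> w) = rv v \<boxplus> rv w"
  by (intro eq_matI) (auto simp: rv_def add_V mat_plus_def carrier_V)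

lemma rv_smult: "v \<in> carrier (V n) \<Longrightarrow> rv (a \<odot>\<^bsub>V n\<^esub> v) = sc a (rv v)"
  by (intro eq_matI) (auto simp: rv_def smult_V mat_scale_def carrier_V)

lemma smult_V_closed: "a \<in> carrier F \<Longrightarrow> v \<in> carrier (V n) \<Longrightarrow> a \<odot>\<^bsub>V n\<^esub> v \<in> carrier (V n)"
  by (auto simp: carrier_V smult_V)

lemma rv_row_mult:
  assumes v: "v \<in> carrier (V n)" and T: "T \<in> K n n"
  shows "rv (row_mult F n v T) = rv v \<star> T" "row_mult F n v T \<in> carrier (V n)"
proof -
  show e: "rv (row_mult F n v T) = rv v \<star> T"
    using v M_dim[OF T] M_entry[OF T]
    by (intro eq_matI) (auto simp: rv_def row_mult_def mat_mul_def carrier_V intro!: finsum_cong')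
  show "row_mult F n v T \<in> carrier (V n)"
    using v M_entry[OF T] by (auto simp: row_mult_def carrier_V intro!: finsum_closed)
qed

lemma row_mult_eigen_iff:
  assumes v: "v \<in> carrier (V n)" and T: "T \<in> K n n" and c: "c \<in> carrier F"
  shows "row_mult F n v T = c \<odot>\<^bsub>V n\<^esub> v \<longleftrightarrow> rv v \<star> T = sc c (rv v)"
  using rv_inj[OF rv_row_mult(2)[OF v T] smult_V_closed[OF c v]] rv_row_mult(1)[OF v T] rv_smult[OF v, of c]
  by auto

section \<open>Coordinates with respect to an indexed basis\<close>

definition coords :: "nat \<Rightarrow> nat set \<Rightarrow> 'a mat set" where
  "coords n J = {c \<in> K 1 n. \<forall>k<n. k + 1 \<notin> J \<longrightarrow> c $$ (0, k) = \<zero>}"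

context
  fixes n :: nat and u :: "nat \<Rightarrow> 'a vec" and P :: "'a mat"
  assumes uV: "u ` {1..n} \<subseteq> carrier (V n)" and u_inj: "inj_on u {1..n}"
    and P: "P \<in> K n n" and rows: "\<And>k. k < n \<Longrightarrow> row_mat P k = rv (u (k + 1))"
begin

text \<open>\<open>lincomb\<close> takes its coefficients as a function on vectors; this is the
  corresponding row of coordinates. Basis vectors are numbered from 1 and matrix columns from 0,
  whence k + 1.\<close>

definition cv :: "nat set \<Rightarrow> ('a vec \<Rightarrow> 'a) \<Rightarrow> 'a mat" where
  "cv J a = mat 1 n (\<lambda>(_, k). if k + 1 \<in> J then a (u (k + 1)) else \<zero>)"

lemma rv_lincomb:
  assumes "finite J" "J \<subseteq> {1..n}" "a \<in> u ` J \<rightarrow> carrier F"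
  shows "rv (module.lincomb (V n) a (u ` J)) = cv J a \<star> P"
  using assms
proof (induction J rule: finite_induct)
  interpret VS: vectorspace F "V n" by (rule vectorspace_V)
  case empty
  have "cv {} a = Z 1 n" by (intro eq_matI) (auto simp: cv_def mat_zero_def)
  moreover have "VS.lincomb a {} = \<zero>\<^bsub>V n\<^esub>" by (simp add: VS.lincomb_def)
  ultimately show ?case using P rv_zero by simp
next
  interpret VS: vectorspace F "V n" by (rule vectorspace_V)
  case (insert i J)
  have i: "1 \<le> i" "i \<le> n" "u i \<in> carrier (V n)" "a (u i) \<in> carrier F"
    using insert.prems uV by auto
  have J: "u ` J \<subseteq> carrier (V n)" "a \<in> u ` J \<rightarrow> carrier F" using insert.prems uV by auto
  have "insert i J \<subseteq> {1..n}" by (rule insert.prems(1))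
  then have ni: "u i \<notin> u ` J"
    using inj_on_image_mem_iff[OF u_inj, of i J] insert.hyps(2) by simp
  have "VS.lincomb a (u ` J \<union> {u i}) = a (u i) \<odot>\<^bsub>V n\<^esub> u i \<oplus>\<^bsub>V n\<^esub> VS.lincomb a (u ` J)"
    by (rule VS.lincomb_insert) (use insert J i ni in auto)
  then have "rv (VS.lincomb a (u ` insert i J)) = sc (a (u i)) (rv (u i)) \<boxplus> cv J a \<star> P"
    using rv_add[OF smult_V_closed[OF i(4,3)] VS.lincomb_closed[OF J]] rv_smult[OF i(3)] insert by simp
  moreover have cK: "cv J a \<in> K 1 n" using J by (intro M_I) (auto simp: cv_def)
  moreover have "cv (insert i J) a = sc (a (u i)) (row_mat (I n) (i - 1)) \<boxplus> cv J a"
    using i insert.hyps J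
    by (intro eq_matI) (auto simp: cv_def mat_plus_def mat_scale_def row_mat_def scalar_matrix_def Pi_iff)
  moreover have "row_mat (I n) (i - 1) \<star> P = rv (u i)"
    using row_mat_mul[of "I n" n n P n "i - 1"] P rows[of "i - 1"] i by simp
  moreover have "row_mat (I n) (i - 1) \<in> K 1 n" using i by (intro row_mat_K[of _ n]) auto
  ultimately show ?case
    using plus_mul[OF sc_K[OF i(4)] cK P] mul_sc(2)[OF i(4) _ P] by simp
qed

text \<open>Since u is injective, a vector determines its index, so a row of coordinates defines a
  coefficient function on vectors.\<close>

lemma ex_coeff:
  assumes c: "c \<in> coords n J" and J: "J \<subseteq> {1..n}"
  obtains a where "a \<in> u ` J \<rightarrow> carrier F" "cv J a = c" "\<And>k. k < n \<Longrightarrow> k + 1 \<in> J \<Longrightarrow> a (u (k + 1)) = c $$ (0, k)"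
proof
  let ?a = "\<lambda>w. c $$ (0, inv_into {1..n} u w - 1)"
  have cK: "c \<in> K 1 n" using c by (simp add: coords_def)
  have au: "?a (u i) = c $$ (0, i - 1)" if "i \<in> {1..n}" for i
    using inv_into_f_f[OF u_inj that] by simp
  show "?a \<in> u ` J \<rightarrow> carrier F"
  proof
    fix w assume "w \<in> u ` J"
    then obtain i where i: "i \<in> J" "w = u i" by blast
    then have "i \<in> {1..n}" using J by blast
    then show "?a w \<in> carrier F" using i au[of i] M_entry[OF cK, of 0 "i - 1"] by auto
  qed
  show a: "?a (u (k + 1)) = c $$ (0, k)" if "k < n" "k + 1 \<in> J" for k using au[of "k + 1"] that by simp
  show "cv J ?a = c"
    using c a M_dim[OF cK] by (intro eq_matI) (auto simp: cv_def coords_def)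
qed

lemma cv_coords: "a \<in> u ` J \<rightarrow> carrier F \<Longrightarrow> cv J a \<in> coords n J"
  by (auto simp: coords_def cv_def Pi_iff intro!: M_I)

lemma span_eq:
  assumes J: "J \<subseteq> {1..n}"
  shows "module.span F (V n) (u ` J) = {v \<in> carrier (V n). \<exists>c\<in>coords n J. rv v = c \<star> P}"
proof -
  interpret VS: vectorspace F "V n" by (rule vectorspace_V)
  have fin: "finite J" using J finite_subset by auto
  have sub: "u ` J \<subseteq> carrier (V n)" using J uV by blast
  have sp: "VS.span (u ` J) = {VS.lincomb a (u ` J) | a. a \<in> u ` J \<rightarrow> carrier F}"
    by (rule VS.finite_span) (use fin sub in auto)
  show ?thesis
  proof (intro equalityI subsetI)
    fix v assume "v \<in> VS.span (u ` J)"
    then obtain a where a: "a \<in> u ` J \<rightarrow> carrier F" "v = VS.lincomb a (u ` J)" using sp by blast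
    then show "v \<in> {v \<in> carrier (V n). \<exists>c\<in>coords n J. rv v = c \<star> P}"
      using rv_lincomb[OF fin J a(1)] cv_coords[OF a(1)] VS.lincomb_closed[OF sub a(1)] by blast
  next
    fix v assume "v \<in> {v \<in> carrier (V n). \<exists>c\<in>coords n J. rv v = c \<star> P}"
    then obtain c where c: "v \<in> carrier (V n)" "c \<in> coords n J" "rv v = c \<star> P" by blast
    obtain a where a: "a \<in> u ` J \<rightarrow> carrier F" "cv J a = c" using ex_coeff[OF c(2) J] by metis
    have "rv (VS.lincomb a (u ` J)) = rv v" using rv_lincomb[OF fin J a(1)] a c by simp
    then have "v = VS.lincomb a (u ` J)" using rv_inj c(1) VS.lincomb_closed[OF sub a(1)] by metis
    then show "v \<in> VS.span (u ` J)" using sp a by blast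
  qed
qed

lemma basis_full_rank:
  assumes "vectorspace.basis F (V n) (u ` {1..n})"
  shows "P \<in> full_rank n n"
proof (rule full_rank_I[OF P])
  interpret VS: vectorspace F "V n" by (rule vectorspace_V)
  have ind: "VS.lin_indpt (u ` {1..n})" using assms by (simp add: VS.basis_def)
  fix c assume c: "c \<in> K 1 n" "c \<star> P = Z 1 n"
  have "c \<in> coords n {1..n}" using c by (auto simp: coords_def)
  then obtain a where a: "a \<in> u ` {1..n} \<rightarrow> carrier F" "cv {1..n} a = c"
      "\<And>k. k < n \<Longrightarrow> k + 1 \<in> {1..n} \<Longrightarrow> a (u (k + 1)) = c $$ (0, k)" using ex_coeff by blast
  have "rv (VS.lincomb a (u ` {1..n})) = rv (\<zero>\<^bsub>V n\<^esub>)"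
    using rv_lincomb[OF _ _ a(1)] a c rv_zero by simp
  then have "VS.lincomb a (u ` {1..n}) = \<zero>\<^bsub>V n\<^esub>"
    using rv_inj[OF VS.lincomb_closed[OF uV a(1)] VS.zero_closed] by simp
  then have z: "a \<in> u ` {1..n} \<rightarrow> {\<zero>}"
    using VS.not_lindepD[OF ind _ subset_refl a(1)] by simp
  show "c = Z 1 n"
  proof (rule M_eqI[OF c(1) Z_K])
    fix i k assume "i < (1::nat)" "k < n"
    moreover have "a (u (k + 1)) = \<zero>" using z \<open>k < n\<close> by auto
    ultimately show "c $$ (i, k) = Z 1 n $$ (i, k)" using a(3)[of k] by (simp add: mat_zero_def)
  qed
qed

end

section \<open>Block form of the stabilizer in an adapted basis\<close>

context
  fixes r n m :: nat and U :: "'a vec set" and u :: "nat \<Rightarrow> 'a vec"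
  assumes r: "1 \<le> r" and n: "n = r + m" and m: "1 \<le> m" and ab: "adapted_basis F r n U u"
begin

definition basis_mat :: "'a mat" where
  "basis_mat = mat n n (\<lambda>(k, j). u (k + 1) $ j)"

lemma uV: "u ` {1..n} \<subseteq> carrier (V n)" and u_inj: "inj_on u {1..n}"
  using ab by (auto simp: adapted_basis_def vectorspace.basis_def[OF vectorspace_V])

lemma uV1: "1 \<le> i \<Longrightarrow> i \<le> n \<Longrightarrow> u i \<in> carrier (V n)"
  using uV by auto

lemma basis_mat_K: "basis_mat \<in> K n n"
  using uV1 by (intro M_I) (auto simp: basis_mat_def carrier_V)

lemma basis_mat_rows: "k < n \<Longrightarrow> row_mat basis_mat k = rv (u (k + 1))"
  using uV1[of "k + 1"] by (intro eq_matI) (auto simp: basis_mat_def row_mat_def rv_def carrier_V)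

lemma basis_mat_span:
  "J \<subseteq> {1..n} \<Longrightarrow> module.span F (V n) (u ` J) = {v \<in> carrier (V n). \<exists>c\<in>coords n J. rv v = c \<star> basis_mat}"
  by (rule span_eq[OF uV u_inj basis_mat_K basis_mat_rows])

lemma basis_mat_full_rank: "basis_mat \<in> full_rank n n"
  using basis_full_rank[OF uV u_inj basis_mat_K basis_mat_rows] ab by (auto simp: adapted_basis_def)

lemma ex_UW: "\<exists>A B. A \<in> K r n \<and> B \<in> K m n \<and> basis_mat = vcat A B"
proof -
  have "basis_mat \<in> K (r + m) n" using basis_mat_K n by simp
  then show ?thesis by (rule vcat_cases) blast
qed

definition top_rows :: "'a mat" where "top_rows = (SOME A. \<exists>B. A \<in> K r n \<and> B \<in> K m n \<and> basis_mat = vcat A B)"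
definition bot_rows :: "'a mat" where "bot_rows = (SOME B. top_rows \<in> K r n \<and> B \<in> K m n \<and> basis_mat = vcat top_rows B)"

lemma top_bot: "top_rows \<in> K r n" "bot_rows \<in> K m n" "basis_mat = vcat top_rows bot_rows"
proof -
  have "\<exists>B. top_rows \<in> K r n \<and> B \<in> K m n \<and> basis_mat = vcat top_rows B"
    unfolding top_rows_def by (rule someI_ex[OF ex_UW])
  then have "top_rows \<in> K r n \<and> bot_rows \<in> K m n \<and> basis_mat = vcat top_rows bot_rows"
    unfolding bot_rows_def by (rule someI_ex)
  then show "top_rows \<in> K r n" "bot_rows \<in> K m n" "basis_mat = vcat top_rows bot_rows" by auto
qed

text \<open>The basis property is stated inside the module with carrier U; a span does not change on
  passing to the ambient module.\<close>

lemma U_span: "U = module.span F (V n) (u ` {1..r})"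
proof -
  interpret VS: vectorspace F "V n" by (rule vectorspace_V)
  have sub: "VectorSpace.subspace F U (V n)" using ab by (simp add: adapted_basis_def)
  then have sm: "LinearCombinations.submodule F U (V n)" by (rule VectorSpace.subspace.submod)
  have "vectorspace F (V n\<lparr>carrier := U\<rparr>)" using VS.subspace_is_vs[OF sub] .
  then have b: "module.span F (V n\<lparr>carrier := U\<rparr>) (u ` {1..r}) = U" "u ` {1..r} \<subseteq> U"
    using ab by (auto simp: adapted_basis_def vectorspace.basis_def)
  then show ?thesis
    using VS.span_li_not_depend(1)[OF b(2) sm] by simp
qed

lemma coords_top: "c \<in> coords n {1..r} \<longleftrightarrow> (\<exists>a\<in>K 1 r. c = hcat a (Z 1 m))"
proof
  assume c: "c \<in> coords n {1..r}"
  then have "c \<in> K 1 (r + m)" using n by (simp add: coords_def)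
  then obtain a b where ab: "a \<in> K 1 r" "b \<in> K 1 m" "c = hcat a b" by (rule hcat_cases)
  have "b = Z 1 m"
  proof (rule M_eqI[OF ab(2) Z_K])
    fix i j assume ij: "i < (1::nat)" "j < m"
    have "c $$ (0, j + r) = \<zero>" using c ij n by (auto simp: coords_def)
    then show "b $$ (i, j) = Z 1 m $$ (i, j)" using ab ij by (simp add: hcat_def mat_zero_def M_dim)
  qed
  then show "\<exists>a\<in>K 1 r. c = hcat a (Z 1 m)" using ab by blast
next
  assume "\<exists>a\<in>K 1 r. c = hcat a (Z 1 m)"
  then obtain a where a: "a \<in> K 1 r" "c = hcat a (Z 1 m)" by blast
  then have "c \<in> K 1 n" using n by simp
  moreover have "c $$ (0, k) = \<zero>" if "k < n" "k + 1 \<notin> {1..r}" for k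
    using a that n M_dim[OF a(1)] by (auto simp: hcat_def mat_zero_def)
  ultimately show "c \<in> coords n {1..r}" by (simp add: coords_def)
qed

lemma hcat_basis_mat: "a \<in> K 1 r \<Longrightarrow> b \<in> K 1 m \<Longrightarrow> hcat a b \<star> basis_mat = a \<star> top_rows \<boxplus> b \<star> bot_rows"
  using top_bot hcat_mul_vcat[of a 1 r b m top_rows n bot_rows] by simp

lemma hcat_bm0: "a \<in> K 1 r \<Longrightarrow> hcat a (Z 1 m) \<star> basis_mat = a \<star> top_rows"
  using hcat_basis_mat[of a "Z 1 m"] top_bot Z_mul(1)[OF top_bot(2), of 1] mul_K[OF _ top_bot(1), of a 1] by simp

lemma U_iff: "v \<in> U \<longleftrightarrow> v \<in> carrier (V n) \<and> rv v \<in> row_span top_rows"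
proof -
  have "{1..r} \<subseteq> {1..n}" using n by auto
  then have "v \<in> U \<longleftrightarrow> v \<in> carrier (V n) \<and> (\<exists>c\<in>coords n {1..r}. rv v = c \<star> basis_mat)"
    using U_span basis_mat_span[of "{1..r}"] by blast
  moreover have "(\<exists>c\<in>coords n {1..r}. w = c \<star> basis_mat) \<longleftrightarrow> w \<in> row_span top_rows" for w
    using coords_top hcat_bm0 M_dim(1)[OF top_bot(1)] by (auto simp: row_span_def image_iff) metis+
  ultimately show ?thesis by simp
qed

lemma GL_eq: "GL F n = full_rank n n"
  by (simp add: GL_def Units_MR)

text \<open>Invariance of U expresses the rows of \<open>top_rows\<close> times T by
  \<open>top_rows\<close> again, which gives A. Conversely, U is mapped onto itself and not merely
  into itself because A has an inverse.\<close>

lemma stabilizer_iff: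
  "T \<in> GL_stabilizer F n U \<longleftrightarrow> T \<in> K n n \<and> (\<exists>A\<in>full_rank r r. \<exists>C\<in>full_rank m m. \<exists>B\<in>K m r. basis_mat \<star> T = blk A B C \<star> basis_mat)"
proof
  assume T: "T \<in> GL_stabilizer F n U"
  then have TF: "T \<in> full_rank n n" and TU: "(\<lambda>v. row_mult F n v T) ` U = U"
    by (auto simp: GL_stabilizer_def GL_eq)
  note TK = full_rank_K[OF TF]
  have "\<exists>a\<in>K 1 r. row_mat (top_rows \<star> T) i = a \<star> top_rows" if i: "i < r" for i
  proof -
    obtain v where v: "v \<in> carrier (V n)" "rv v = row_mat top_rows i" using rv_surj[OF row_mat_K[OF top_bot(1) i]] .
    have "row_mat top_rows i = row_mat (I r) i \<star> top_rows" using row_mat_mul[of "I r" r r top_rows n i] top_bot i by simp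
    then have "row_mat top_rows i \<in> row_span top_rows"
      using row_mat_K[OF scalar_K[OF one_closed] i] M_dim(1)[OF top_bot(1)] by (auto simp: row_span_def)
    then have "v \<in> U" using U_iff v by simp
    then have "row_mult F n v T \<in> U" using TU by blast
    then have "row_mat top_rows i \<star> T \<in> row_span top_rows" using U_iff rv_row_mult(1)[OF v(1) TK] v by simp
    then show ?thesis using row_mat_mul[OF top_bot(1) TK i] M_dim(1)[OF top_bot(1)] by (auto simp: row_span_def)
  qed
  then obtain a where a: "\<And>i. i < r \<Longrightarrow> a i \<in> K 1 r" "\<And>i. i < r \<Longrightarrow> row_mat (top_rows \<star> T) i = a i \<star> top_rows" by metis
  obtain A where A: "A \<in> K r r" "\<And>i. i < r \<Longrightarrow> row_mat A i = a i" using ex_of_rows[of r a r] a(1) by metis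
  have "top_rows \<star> T = A \<star> top_rows"
    by (rule row_mat_eqI[OF mul_K[OF top_bot(1) TK] mul_K[OF A(1) top_bot(1)]])
      (use a A row_mat_mul[OF A(1) top_bot(1)] in simp)
  then obtain B C where BC: "B \<in> K m r" "C \<in> K m m" "basis_mat \<star> T = blk A B C \<star> basis_mat"
    using block_of_invariant[OF top_bot(1,2) _ n A(1) TK] basis_mat_full_rank top_bot(3) by metis
  have "blk A B C \<in> full_rank n n"
    using full_rank_conj_iff[OF basis_mat_full_rank TK _ BC(3)] TF blk_K[OF A(1) BC(1,2)] n by simp
  then have "A \<in> full_rank r r" "C \<in> full_rank m m" using blk_full_rank_iff[OF A(1) BC(1,2)] n by auto
  then show "T \<in> K n n \<and> (\<exists>A\<in>full_rank r r. \<exists>C\<in>full_rank m m. \<exists>B\<in>K m r. basis_mat \<star> T = blk A B C \<star> basis_mat)"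
    using BC TK by blast
next
  assume "T \<in> K n n \<and> (\<exists>A\<in>full_rank r r. \<exists>C\<in>full_rank m m. \<exists>B\<in>K m r. basis_mat \<star> T = blk A B C \<star> basis_mat)"
  then obtain A B C where T: "T \<in> K n n" and A: "A \<in> full_rank r r" and C: "C \<in> full_rank m m" and B: "B \<in> K m r"
    and e: "basis_mat \<star> T = blk A B C \<star> basis_mat" by blast
  note k = full_rank_K[OF A] full_rank_K[OF C]
  have bk: "blk A B C \<in> full_rank n n" using blk_full_rank_iff[OF k(1) B k(2)] A C n by simp
  then have TF: "T \<in> full_rank n n" using full_rank_conj_iff[OF basis_mat_full_rank T full_rank_K[OF bk] e] by simp
  have "vcat (top_rows \<star> T) (bot_rows \<star> T) = vcat (A \<star> top_rows) (B \<star> top_rows \<boxplus> C \<star> bot_rows)"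
    using e vcat_mul[OF top_bot(1,2) T] blk_vcat[OF k(1) B k(2) top_bot(1,2)] top_bot(3) by simp
  then have tT: "top_rows \<star> T = A \<star> top_rows"
    using vcat_inj[OF mul_K[OF top_bot(1) T] mul_K[OF top_bot(2) T] mul_K[OF k(1) top_bot(1)]
        plus_K[OF mul_K[OF B top_bot(1)] mul_K[OF k(2) top_bot(2)]]] by simp
  obtain A' where A': "A' \<in> full_rank r r" "A' \<star> A = I r" using full_rank_square_inverse[OF A] by metis
  have "(\<lambda>v. row_mult F n v T) ` U = U"
  proof (intro equalityI subsetI)
    fix w assume "w \<in> (\<lambda>v. row_mult F n v T) ` U"
    then obtain v where v: "v \<in> U" "w = row_mult F n v T" by blast
    then obtain a where a: "v \<in> carrier (V n)" "a \<in> K 1 r" "rv v = a \<star> top_rows"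
      using U_iff M_dim(1)[OF top_bot(1)] by (auto simp: row_span_def)
    have "rv w = (a \<star> A) \<star> top_rows"
      using rv_row_mult(1)[OF a(1) T] v a mul_assoc[OF a(2) top_bot(1) T] mul_assoc[OF a(2) k(1) top_bot(1)] tT by simp
    then show "w \<in> U"
      using U_iff rv_row_mult(2)[OF a(1) T] v mul_K[OF a(2) k(1)] M_dim(1)[OF top_bot(1)] by (auto simp: row_span_def)
  next
    fix w assume w: "w \<in> U"
    then obtain a where a: "w \<in> carrier (V n)" "a \<in> K 1 r" "rv w = a \<star> top_rows"
      using U_iff M_dim(1)[OF top_bot(1)] by (auto simp: row_span_def)
    have a': "a \<star> A' \<in> K 1 r" using mul_K[OF a(2) full_rank_K[OF A'(1)]] .
    obtain v where v: "v \<in> carrier (V n)" "rv v = (a \<star> A') \<star> top_rows" using rv_surj[OF mul_K[OF a' top_bot(1)]] .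
    have "v \<in> U" using U_iff v a' M_dim(1)[OF top_bot(1)] by (auto simp: row_span_def)
    moreover have "rv (row_mult F n v T) = rv w"
      using rv_row_mult(1)[OF v(1) T] v mul_assoc[OF a' top_bot(1) T] tT mul_assoc[OF a' k(1) top_bot(1)]
        mul_assoc[OF a(2) full_rank_K[OF A'(1)] k(1)] A' a by simp
    then have "row_mult F n v T = w" using rv_inj[OF rv_row_mult(2)[OF v(1) T] a(1)] by simp
    ultimately show "w \<in> (\<lambda>v. row_mult F n v T) ` U" by blast
  qed
  then show "T \<in> GL_stabilizer F n U" using TF by (simp add: GL_stabilizer_def GL_eq)
qed

text \<open>Adding u_i fixes the coordinate i to \<one>, while the coordinates in J stay free. The
  normalization of eigenvectors originates here.\<close>

lemma coset_iff:
  assumes i: "1 \<le> i" "i \<le> n" and J: "J \<subseteq> {1..n}" "i \<notin> J"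
  shows "v \<in> u i <+\<^bsub>V n\<^esub> module.span F (V n) (u ` J) \<longleftrightarrow>
    v \<in> carrier (V n) \<and> (\<exists>c\<in>coords n (insert i J). c $$ (0, i - 1) = \<one> \<and> rv v = c \<star> basis_mat)"
proof -
  interpret VS: vectorspace F "V n" by (rule vectorspace_V)
  let ?e = "row_mat (I n) (i - 1)"
  have eK: "?e \<in> K 1 n" using i by (intro row_mat_K[of _ n]) auto
  have eb: "?e \<star> basis_mat = rv (u i)"
    using row_mat_mul[of "I n" n n basis_mat n "i - 1"] basis_mat_K basis_mat_rows[of "i - 1"] i by simp
  have e1: "?e $$ (0, k) = (if k = i - 1 then \<one> else \<zero>)" if "k < n" for k
    using that i by (auto simp: row_mat_def scalar_matrix_def)
  have "v \<in> u i <+\<^bsub>V n\<^esub> module.span F (V n) (u ` J) \<longleftrightarrow> (\<exists>w\<in>module.span F (V n) (u ` J). v = u i \<oplus>\<^bsub>V n\<^esub> w)"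
    by (auto simp: a_l_coset_def')
  also have "\<dots> \<longleftrightarrow> v \<in> carrier (V n) \<and> (\<exists>c\<in>coords n (insert i J). c $$ (0, i - 1) = \<one> \<and> rv v = c \<star> basis_mat)"
  proof
    assume "\<exists>w\<in>module.span F (V n) (u ` J). v = u i \<oplus>\<^bsub>V n\<^esub> w"
    then obtain w c where w: "w \<in> carrier (V n)" "c \<in> coords n J" "rv w = c \<star> basis_mat" "v = u i \<oplus>\<^bsub>V n\<^esub> w"
      using basis_mat_span[OF J(1)] by blast
    have cK: "c \<in> K 1 n" using w by (simp add: coords_def)
    have "rv v = (?e \<boxplus> c) \<star> basis_mat" using rv_add[OF uV1[OF i] w(1)] w eb plus_mul[OF eK cK basis_mat_K] by simp
    moreover have "?e \<boxplus> c \<in> coords n (insert i J)" "(?e \<boxplus> c) $$ (0, i - 1) = \<one>"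
      using w J i e1 M_dim[OF eK] M_entry[OF cK] plus_K[OF eK cK] by (auto simp: coords_def mat_plus_def)
    moreover have "v \<in> carrier (V n)" using w uV1[OF i] by simp
    ultimately show "v \<in> carrier (V n) \<and> (\<exists>c\<in>coords n (insert i J). c $$ (0, i - 1) = \<one> \<and> rv v = c \<star> basis_mat)" by blast
  next
    assume "v \<in> carrier (V n) \<and> (\<exists>c\<in>coords n (insert i J). c $$ (0, i - 1) = \<one> \<and> rv v = c \<star> basis_mat)"
    then obtain c where c: "v \<in> carrier (V n)" "c \<in> coords n (insert i J)" "c $$ (0, i - 1) = \<one>" "rv v = c \<star> basis_mat" by blast
    have cK: "c \<in> K 1 n" using c by (simp add: coords_def)
    have d: "c \<boxminus> ?e \<in> coords n J"
      using c J i e1 M_dim[OF cK] M_entry[OF cK] minus_K[OF cK eK] by (auto simp: coords_def mat_minus_def a_minus_def r_neg)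
    have dK: "c \<boxminus> ?e \<in> K 1 n" using minus_K[OF cK eK] .
    obtain w where w: "w \<in> carrier (V n)" "rv w = (c \<boxminus> ?e) \<star> basis_mat" using rv_surj[OF mul_K[OF dK basis_mat_K]] .
    have "w \<in> module.span F (V n) (u ` J)" using basis_mat_span[OF J(1)] w d by blast
    moreover have "rv (u i \<oplus>\<^bsub>V n\<^esub> w) = rv v"
      using rv_add[OF uV1[OF i] w(1)] w eb plus_mul[OF eK dK basis_mat_K] plus_comm[OF eK dK] minus_plus_cancel[OF cK eK] c by simp
    then have "v = u i \<oplus>\<^bsub>V n\<^esub> w" using rv_inj[OF c(1), of "u i \<oplus>\<^bsub>V n\<^esub> w"] w uV1[OF i] by simp
    ultimately show "\<exists>w\<in>module.span F (V n) (u ` J). v = u i \<oplus>\<^bsub>V n\<^esub> w" by blast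
  qed
  finally show ?thesis .
qed

lemma eigen_basis_mat_iff:
  assumes T: "T \<in> K n n" and S: "S \<in> K n n" and e: "basis_mat \<star> T = S \<star> basis_mat" and c: "c \<in> K 1 n" and l: "l \<in> carrier F"
  shows "(c \<star> basis_mat) \<star> T = sc l (c \<star> basis_mat) \<longleftrightarrow> c \<star> S = sc l c"
proof -
  have "(c \<star> basis_mat) \<star> T = (c \<star> S) \<star> basis_mat"
    using mul_assoc[OF c basis_mat_K T] mul_assoc[OF c S basis_mat_K] e by simp
  moreover have "sc l (c \<star> basis_mat) = sc l c \<star> basis_mat" using mul_sc(2)[OF l c basis_mat_K] by simp
  ultimately show ?thesis using full_rank_cancel[OF basis_mat_full_rank mul_K[OF c S] sc_K[OF l c]] by auto
qed

section \<open>The conditions on T read off its blocks\<close>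

context
  fixes T A B C
  assumes T: "T \<in> K n n" and A: "A \<in> full_rank r r" and C: "C \<in> full_rank m m" and B: "B \<in> K m r"
    and e: "basis_mat \<star> T = blk A B C \<star> basis_mat"
begin

lemma AC_K: "A \<in> K r r" "C \<in> K m m" "blk A B C \<in> K n n"
  using A C B full_rank_K blk_K[OF full_rank_K[OF A] B full_rank_K[OF C]] n by auto

lemma T_stab: "T \<in> GL_stabilizer F n U"
  using stabilizer_iff T A B C e by blast

text \<open>A vector of the coset of u_1 lies in U and has coordinates (a, 0), so only the upper
  block acts on it.\<close>

lemma w1_iff:
  assumes l: "l \<in> carrier F"
  shows "(\<exists>w\<in>u 1 <+\<^bsub>V n\<^esub> module.span F (V n) (u ` {2..r}). row_mult F n w T = l \<odot>\<^bsub>V n\<^esub> w)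
    \<longleftrightarrow> (\<exists>a\<in>K 1 r. a $$ (0, 0) = \<one> \<and> a \<star> A = sc l a)"
proof -
  have ins: "insert 1 {2..r} = {1..r}" using r by auto
  have "(\<exists>w\<in>u 1 <+\<^bsub>V n\<^esub> module.span F (V n) (u ` {2..r}). row_mult F n w T = l \<odot>\<^bsub>V n\<^esub> w)
      \<longleftrightarrow> (\<exists>c\<in>coords n {1..r}. c $$ (0, 0) = \<one> \<and> (c \<star> basis_mat) \<star> T = sc l (c \<star> basis_mat))"
  proof -
    have co: "w \<in> u 1 <+\<^bsub>V n\<^esub> module.span F (V n) (u ` {2..r}) \<longleftrightarrow>
        w \<in> carrier (V n) \<and> (\<exists>c\<in>coords n {1..r}. c $$ (0, 0) = \<one> \<and> rv w = c \<star> basis_mat)" for w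
      using coset_iff[of 1 "{2..r}" w] n r ins by auto
    show ?thesis
    proof
      assume "\<exists>w\<in>u 1 <+\<^bsub>V n\<^esub> module.span F (V n) (u ` {2..r}). row_mult F n w T = l \<odot>\<^bsub>V n\<^esub> w"
      then show "\<exists>c\<in>coords n {1..r}. c $$ (0, 0) = \<one> \<and> (c \<star> basis_mat) \<star> T = sc l (c \<star> basis_mat)"
        using co row_mult_eigen_iff[OF _ T l] by metis
    next
      assume "\<exists>c\<in>coords n {1..r}. c $$ (0, 0) = \<one> \<and> (c \<star> basis_mat) \<star> T = sc l (c \<star> basis_mat)"
      then obtain c where c: "c \<in> coords n {1..r}" "c $$ (0, 0) = \<one>" "(c \<star> basis_mat) \<star> T = sc l (c \<star> basis_mat)" by blast
      have cK: "c \<in> K 1 n" using c by (simp add: coords_def)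
      obtain w where w: "w \<in> carrier (V n)" "rv w = c \<star> basis_mat" using rv_surj[OF mul_K[OF cK basis_mat_K]] .
      then show "\<exists>w\<in>u 1 <+\<^bsub>V n\<^esub> module.span F (V n) (u ` {2..r}). row_mult F n w T = l \<odot>\<^bsub>V n\<^esub> w"
        using co row_mult_eigen_iff[OF w(1) T l] c by metis
    qed
  qed
  also have "\<dots> \<longleftrightarrow> (\<exists>a\<in>K 1 r. hcat a (Z 1 m) $$ (0, 0) = \<one> \<and> (hcat a (Z 1 m) \<star> basis_mat) \<star> T = sc l (hcat a (Z 1 m) \<star> basis_mat))"
  proof -
    have "coords n {1..r} = (\<lambda>a. hcat a (Z 1 m)) ` K 1 r" using coords_top by blast
    then show ?thesis by simp
  qed
  also have "\<dots> \<longleftrightarrow> (\<exists>a\<in>K 1 r. a $$ (0, 0) = \<one> \<and> a \<star> A = sc l a)"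
  proof (rule bex_cong[OF refl])
    fix a assume a: "a \<in> K 1 r"
    have h: "hcat a (Z 1 m) \<in> K 1 n" using a n by simp
    have "hcat a (Z 1 m) $$ (0, 0) = a $$ (0, 0)" using a r by (simp add: hcat_def M_dim)
    moreover have "hcat a (Z 1 m) \<star> blk A B C = hcat (a \<star> A) (Z 1 m)"
      using hcat_blk[OF AC_K(1) B AC_K(2) a Z_K] B AC_K mul_K[OF a AC_K(1)] by simp
    moreover have "sc l (hcat a (Z 1 m)) = hcat (sc l a) (Z 1 m)" using hcat_sc[OF a Z_K] l by simp
    ultimately show "(hcat a (Z 1 m) $$ (0, 0) = \<one> \<and> (hcat a (Z 1 m) \<star> basis_mat) \<star> T = sc l (hcat a (Z 1 m) \<star> basis_mat))
        \<longleftrightarrow> (a $$ (0, 0) = \<one> \<and> a \<star> A = sc l a)"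
      using eigen_basis_mat_iff[OF T AC_K(3) e h l] hcat_inj[OF mul_K[OF a AC_K(1)] Z_K sc_K[OF l a] Z_K] by simp
  qed
  finally show ?thesis .
qed

text \<open>The coset of u_n consists of all vectors whose last coordinate is \<one>. Splitting such
  a vector as (x, y) makes this the last coordinate of y, at index m - 1.\<close>

lemma w2_iff:
  assumes l: "l \<in> carrier F"
  shows "(\<exists>w\<in>u n <+\<^bsub>V n\<^esub> module.span F (V n) (u ` {1..n - 1}). row_mult F n w T = l \<odot>\<^bsub>V n\<^esub> w)
    \<longleftrightarrow> (\<exists>x\<in>K 1 r. \<exists>y\<in>K 1 m. y $$ (0, m - 1) = \<one> \<and> y \<star> C = sc l y \<and> x \<star> A \<boxplus> y \<star> B = sc l x)"
proof -
  have n1: "1 \<le> n" using n m by simp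
  have ins: "insert n {1..n - 1} = {1..n}" using n1 by auto
  have cn: "coords n {1..n} = K 1 n" by (auto simp: coords_def)
  have co: "w \<in> u n <+\<^bsub>V n\<^esub> module.span F (V n) (u ` {1..n - 1}) \<longleftrightarrow>
      w \<in> carrier (V n) \<and> (\<exists>c\<in>K 1 n. c $$ (0, n - 1) = \<one> \<and> rv w = c \<star> basis_mat)" for w
    using coset_iff[of n "{1..n - 1}" w] n1 unfolding ins cn by force
  have "(\<exists>w\<in>u n <+\<^bsub>V n\<^esub> module.span F (V n) (u ` {1..n - 1}). row_mult F n w T = l \<odot>\<^bsub>V n\<^esub> w)
      \<longleftrightarrow> (\<exists>c\<in>K 1 n. c $$ (0, n - 1) = \<one> \<and> (c \<star> basis_mat) \<star> T = sc l (c \<star> basis_mat))"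
  proof
    assume "\<exists>w\<in>u n <+\<^bsub>V n\<^esub> module.span F (V n) (u ` {1..n - 1}). row_mult F n w T = l \<odot>\<^bsub>V n\<^esub> w"
    then show "\<exists>c\<in>K 1 n. c $$ (0, n - 1) = \<one> \<and> (c \<star> basis_mat) \<star> T = sc l (c \<star> basis_mat)"
      using co row_mult_eigen_iff[OF _ T l] by metis
  next
    assume "\<exists>c\<in>K 1 n. c $$ (0, n - 1) = \<one> \<and> (c \<star> basis_mat) \<star> T = sc l (c \<star> basis_mat)"
    then obtain c where c: "c \<in> K 1 n" "c $$ (0, n - 1) = \<one>" "(c \<star> basis_mat) \<star> T = sc l (c \<star> basis_mat)" by blast
    obtain w where w: "w \<in> carrier (V n)" "rv w = c \<star> basis_mat" using rv_surj[OF mul_K[OF c(1) basis_mat_K]] .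
    then show "\<exists>w\<in>u n <+\<^bsub>V n\<^esub> module.span F (V n) (u ` {1..n - 1}). row_mult F n w T = l \<odot>\<^bsub>V n\<^esub> w"
      using co row_mult_eigen_iff[OF w(1) T l] c by metis
  qed
  also have "\<dots> \<longleftrightarrow> (\<exists>c\<in>K 1 n. c $$ (0, n - 1) = \<one> \<and> c \<star> blk A B C = sc l c)"
    using eigen_basis_mat_iff[OF T AC_K(3) e _ l] by blast
  also have "\<dots> \<longleftrightarrow> (\<exists>x\<in>K 1 r. \<exists>y\<in>K 1 m. hcat x y $$ (0, n - 1) = \<one> \<and> hcat x y \<star> blk A B C = sc l (hcat x y))"
    unfolding n using hcat_cases[of _ F 1 r m] hcat_M[of _ F 1 r _ m] by metis
  also have "\<dots> \<longleftrightarrow> (\<exists>x\<in>K 1 r. \<exists>y\<in>K 1 m. y $$ (0, m - 1) = \<one> \<and> y \<star> C = sc l y \<and> x \<star> A \<boxplus> y \<star> B = sc l x)"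
  proof (intro bex_cong refl)
    fix x y assume xy: "x \<in> K 1 r" "y \<in> K 1 m"
    have "n - 1 - r = m - 1" "\<not> n - 1 < r" "n - 1 < r + m" using n m by auto
    then have "hcat x y $$ (0, n - 1) = y $$ (0, m - 1)" using xy by (simp add: hcat_def M_dim)
    then show "(hcat x y $$ (0, n - 1) = \<one> \<and> hcat x y \<star> blk A B C = sc l (hcat x y))
        \<longleftrightarrow> (y $$ (0, m - 1) = \<one> \<and> y \<star> C = sc l y \<and> x \<star> A \<boxplus> y \<star> B = sc l x)"
      using hcat_blk[OF AC_K(1) B AC_K(2) xy] hcat_sc[OF xy, of l]
        hcat_inj[OF plus_K[OF mul_K[OF xy(1) AC_K(1)] mul_K[OF xy(2) B]] mul_K[OF xy(2) AC_K(2)] sc_K[OF l xy(1)] sc_K[OF l xy(2)]]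
      by auto
  qed
  finally show ?thesis .
qed

text \<open>The eigenvectors a and y give each of the two characteristic polynomials a factor t - l;
  by \<open>cube_not_pdivides_iff\<close> neither may have a second one.\<close>

lemma cube_iff:
  assumes l: "l \<in> carrier F" and a: "a \<in> K 1 r" "a $$ (0, 0) = \<one>" "a \<star> A = sc l a"
    and y: "y \<in> K 1 m" "y $$ (0, m - 1) = \<one>" "y \<star> C = sc l y"
  shows "\<not> ([\<one>, \<ominus> l] [^]\<^bsub>R\<^esub> (3::nat)) pdivides cp n T \<longleftrightarrow> simple_root l (cp r A) \<and> simple_root l (cp m C)"
proof -
  have cT: "cp n T = cp r A \<otimes>\<^bsub>R\<^esub> cp m C"
    using cp_similar[OF basis_mat_full_rank T AC_K(3) e] cp_blk[OF AC_K(1) B AC_K(2)] n by simp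
  have "a \<noteq> Z 1 r" "y \<noteq> Z 1 m" using a y r m by (auto simp: mat_zero_def)
  then have F: "a \<in> full_rank 1 r" "y \<in> full_rank 1 m" using full_rank_1_iff a y by auto
  obtain h where h: "h \<in> carrier R" "cp r A = [\<one>, \<ominus> l] \<otimes>\<^bsub>R\<^esub> h"
    using cp_eigenvector[OF l AC_K(1) F(1) a(3)] cp_closed by metis
  obtain h' where h': "h' \<in> carrier R" "cp m C = [\<one>, \<ominus> l] \<otimes>\<^bsub>R\<^esub> h'"
    using cp_eigenvector[OF l AC_K(2) F(2) y(3)] cp_closed by metis
  show ?thesis
    using cube_not_pdivides_iff[OF l h(1) h'(1)] simple_root_iff[OF l h] simple_root_iff[OF l h'] cT h h' by simp
qed

lemma T_set_iff:
  assumes l: "l \<in> carrier F - {\<zero>}"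
  shows "T \<in> T_set F r n U u l \<longleftrightarrow> good r m l A B C"
proof -
  have lF: "l \<in> carrier F" using l by simp
  have "T \<in> T_set F r n U u l \<longleftrightarrow> \<not> ([\<one>, \<ominus> l] [^]\<^bsub>R\<^esub> (3::nat)) pdivides cp n T \<and>
      (\<exists>a\<in>K 1 r. a $$ (0, 0) = \<one> \<and> a \<star> A = sc l a) \<and>
      (\<exists>x\<in>K 1 r. \<exists>y\<in>K 1 m. y $$ (0, m - 1) = \<one> \<and> y \<star> C = sc l y \<and> x \<star> A \<boxplus> y \<star> B = sc l x)"
    unfolding T_set_def Let_def mem_Collect_eq w1_iff[OF lF] w2_iff[OF lF] using T_stab by simp
  also have "\<dots> \<longleftrightarrow> good r m l A B C"
    using cube_iff[OF lF] l unfolding good_def simple_eigs_def by blast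
  finally show ?thesis .
qed

text \<open>The eigenvectors (a, 0) and (x, y) of the block matrix are independent because a and y
  are nonzero; multiplying by the basis matrix gives an eigenplane of T.\<close>

lemma T_set_not_cyclic:
  assumes l: "l \<in> carrier F - {\<zero>}" and TT: "T \<in> T_set F r n U u l"
  shows "\<not> cyclic_matrix F n T"
proof -
  have lF: "l \<in> carrier F" using l by simp
  have g: "good r m l A B C" using T_set_iff[OF l] TT by simp
  then obtain a where a: "a \<in> K 1 r" "a $$ (0, 0) = \<one>" "a \<star> A = sc l a" by (auto simp: good_def simple_eigs_def)
  obtain x y where xy: "x \<in> K 1 r" "y \<in> K 1 m" "y $$ (0, m - 1) = \<one>" "y \<star> C = sc l y" "x \<star> A \<boxplus> y \<star> B = sc l x"
    using g by (auto simp: good_def)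
  let ?a = "hcat a (Z 1 m)" and ?x = "hcat x y"
  have k: "?a \<in> K 1 n" "?x \<in> K 1 n" using a xy n by auto
  have ea: "?a \<star> blk A B C = sc l ?a"
    using hcat_blk[OF AC_K(1) B AC_K(2) a(1) Z_K] B AC_K mul_K[OF a(1) AC_K(1)] hcat_sc[OF a(1) Z_K] a lF by simp
  have ex: "?x \<star> blk A B C = sc l ?x"
    using hcat_blk[OF AC_K(1) B AC_K(2) xy(1,2)] hcat_sc[OF xy(1,2)] xy by simp
  have "?a \<noteq> Z 1 n"
  proof
    assume "?a = Z 1 n"
    then have "?a $$ (0, 0) = Z 1 n $$ (0, 0)" by simp
    then show False using a r n by (simp add: hcat_def mat_zero_def M_dim)
  qed
  then have aF: "?a \<in> full_rank 1 n" using full_rank_1_iff[OF k(1)] by simp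
  have "?x \<notin> row_span ?a"
  proof
    assume "?x \<in> row_span ?a"
    then obtain w where w: "w \<in> K 1 1" "?x = w \<star> ?a" using M_dim(1)[OF k(1)] by (auto simp: row_span_def)
    have "w \<star> ?a = hcat (w \<star> a) (Z 1 m)" using mul_hcat[OF w(1) a(1) Z_K] Z_mul(2)[OF w(1)] by simp
    then have "y = Z 1 m" using w hcat_inj[OF xy(1,2) mul_K[OF w(1) a(1)] Z_K] by simp
    then show False using xy m by (simp add: mat_zero_def)
  qed
  then have S: "vcat ?a ?x \<in> full_rank 2 n" using full_rank_vcat_iff[OF k] aF by simp
  have eS: "vcat ?a ?x \<star> blk A B C = sc l (vcat ?a ?x)"
  proof -
    have "vcat (sc l ?a) (sc l ?x) = sc l (vcat ?a ?x)"
      using M_dim[OF k(1)] M_dim[OF k(2)] by (intro eq_matI) (auto simp: vcat_def mat_scale_def)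
    then show ?thesis using vcat_mul[OF k AC_K(3)] ea ex by simp
  qed
  have Sb: "vcat ?a ?x \<star> basis_mat \<in> full_rank 2 n" using full_rank_mul_right[OF S basis_mat_full_rank] .
  have "(vcat ?a ?x \<star> basis_mat) \<star> T = sc l (vcat ?a ?x \<star> basis_mat)"
    using mul_assoc[OF full_rank_K[OF S] basis_mat_K T] mul_assoc[OF full_rank_K[OF S] AC_K(3) basis_mat_K] e eS mul_sc(2)[OF lF full_rank_K[OF S] basis_mat_K] by simp
  then show ?thesis using not_cyclic_of_eigenplane[OF lF T Sb] by simp
qed

end

section \<open>The union of the sets and its proportion\<close>

lemma T_union_noncyclic: "T_union F r n U u \<subseteq> {T \<in> GL_stabilizer F n U. \<not> cyclic_matrix F n T}"
proof
  fix T assume "T \<in> T_union F r n U u"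
  then obtain l where l: "l \<in> carrier F - {\<zero>}" "T \<in> T_set F r n U u l" by (auto simp: T_union_def)
  then have st: "T \<in> GL_stabilizer F n U" by (auto simp: T_set_def Let_def)
  then obtain A B C where "T \<in> K n n" "A \<in> full_rank r r" "C \<in> full_rank m m" "B \<in> K m r" "basis_mat \<star> T = blk A B C \<star> basis_mat"
    using stabilizer_iff by blast
  then show "T \<in> {T \<in> GL_stabilizer F n U. \<not> cyclic_matrix F n T}" using T_set_not_cyclic l st by blast
qed

text \<open>Conjugation by the basis matrix is a bijection from the triples of blocks to the
  stabilizer, and it carries \<open>good_triples\<close> to the union. Over a given field the
  proportion therefore depends on r and m alone.\<close>

lemma ratio_eq: "real (card (T_union F r n U u)) / real (card (GL_stabilizer F n U)) = good_prop r m"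
proof -
  obtain Q where Q: "Q \<in> full_rank n n" "Q \<star> basis_mat = I n" "basis_mat \<star> Q = I n" using full_rank_square_inverse[OF basis_mat_full_rank] .
  note QK = full_rank_K[OF Q(1)]
  let ?D = "{(A, C, B). A \<in> full_rank r r \<and> C \<in> full_rank m m \<and> B \<in> K m r}"
  define f where "f = (\<lambda>(A, C, B). Q \<star> (blk A B C \<star> basis_mat))"
  have bk: "blk A B C \<in> K n n" if "A \<in> full_rank r r" "C \<in> full_rank m m" "B \<in> K m r" for A B C
    using blk_K[OF full_rank_K[OF that(1)] that(3) full_rank_K[OF that(2)]] n by simp
  have fK: "f (A, C, B) \<in> K n n" if "A \<in> full_rank r r" "C \<in> full_rank m m" "B \<in> K m r" for A B C
    using mul_K[OF QK mul_K[OF bk[OF that] basis_mat_K]] by (simp add: f_def)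
  have fe: "basis_mat \<star> f (A, C, B) = blk A B C \<star> basis_mat" if "A \<in> full_rank r r" "C \<in> full_rank m m" "B \<in> K m r" for A B C
    using mul_assoc[OF basis_mat_K QK mul_K[OF bk[OF that] basis_mat_K]] Q mul_K[OF bk[OF that] basis_mat_K] by (simp add: f_def)
  have inj: "inj_on f ?D"
  proof (rule inj_onI)
    fix p p' assume p: "p \<in> ?D" "p' \<in> ?D" "f p = f p'"
    obtain A C B A' C' B' where d: "p = (A, C, B)" "p' = (A', C', B')" by (cases p; cases p') auto
    have c: "A \<in> full_rank r r" "C \<in> full_rank m m" "B \<in> K m r" "A' \<in> full_rank r r" "C' \<in> full_rank m m" "B' \<in> K m r" using p d by auto
    note k = full_rank_K[OF c(1)] full_rank_K[OF c(2)] full_rank_K[OF c(4)] full_rank_K[OF c(5)]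
    have "blk A B C \<star> basis_mat = blk A' B' C' \<star> basis_mat" using fe[OF c(1-3)] fe[OF c(4-6)] p d by simp
    then have "blk A B C = blk A' B' C'" using full_rank_cancel[OF basis_mat_full_rank] bk c by blast
    then have "vcat (hcat A (Z r m)) (hcat B C) = vcat (hcat A' (Z r m)) (hcat B' C')"
      using k by (simp add: blk_def M_dim)
    then have "hcat A (Z r m) = hcat A' (Z r m)" "hcat B C = hcat B' C'"
      using vcat_inj[OF hcat_M[OF k(1) Z_K] hcat_M[OF c(3) k(2)] hcat_M[OF k(3) Z_K] hcat_M[OF c(6) k(4)]] by auto
    then show "p = p'"
      using hcat_inj[OF k(1) Z_K k(3) Z_K] hcat_inj[OF c(3) k(2) c(6) k(4)] d by simp
  qed
  have img: "f ` ?D = GL_stabilizer F n U"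
  proof (intro equalityI subsetI)
    fix T assume "T \<in> f ` ?D"
    then obtain A B C where c: "A \<in> full_rank r r" "C \<in> full_rank m m" "B \<in> K m r" "T = f (A, C, B)" by auto
    then show "T \<in> GL_stabilizer F n U" using stabilizer_iff fK[OF c(1-3)] fe[OF c(1-3)] by blast
  next
    fix T assume "T \<in> GL_stabilizer F n U"
    then obtain A B C where c: "T \<in> K n n" "A \<in> full_rank r r" "C \<in> full_rank m m" "B \<in> K m r" "basis_mat \<star> T = blk A B C \<star> basis_mat"
      using stabilizer_iff by blast
    have "Q \<star> (basis_mat \<star> T) = T" using mul_assoc[OF QK basis_mat_K c(1)] Q c by simp
    then have "T = f (A, C, B)" using c by (simp add: f_def)
    then show "T \<in> f ` ?D" using c by blast
  qed
  have TBD: "good_triples r m \<subseteq> ?D" by (auto simp: good_triples_def)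
  have Tiff: "f (A, C, B) \<in> T_union F r n U u \<longleftrightarrow> (\<exists>l. good r m l A B C)"
    if "A \<in> full_rank r r" "C \<in> full_rank m m" "B \<in> K m r" for A B C
  proof -
    have "f (A, C, B) \<in> T_union F r n U u \<longleftrightarrow> (\<exists>l\<in>carrier F - {\<zero>}. good r m l A B C)"
      using T_set_iff[OF fK[OF that] that fe[OF that]] by (auto simp: T_union_def)
    moreover have "l \<in> carrier F - {\<zero>}" if "good r m l A B C" for l using that by (auto simp: good_def simple_eigs_def)
    ultimately show ?thesis by blast
  qed
  have "T_union F r n U u \<subseteq> GL_stabilizer F n U" by (auto simp: T_union_def T_set_def Let_def)
  then have "f ` good_triples r m = T_union F r n U u"
    using img Tiff by (fastforce simp: good_triples_def)
  then have 1: "card (T_union F r n U u) = card (good_triples r m)"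
    using card_image[OF inj_on_subset[OF inj TBD]] by simp
  have "?D = full_rank r r \<times> full_rank m m \<times> K m r" by auto
  then have 2: "card (GL_stabilizer F n U) = card (full_rank r r) * (card (full_rank m m) * q ^ (m * r))"
    using card_image[OF inj] img by (simp add: card_cartesian_product card_K)
  show ?thesis unfolding 1 2 good_prop_def by (simp add: mult.assoc mult.commute[of m r])
qed

end

end

lemma ex_finite_field:
  fixes F :: "'b ring"
  assumes "Ring.field F" "finite (carrier F)"
  obtains phi where "finite_field F phi"
proof -
  interpret fd: Ring.field F by (rule assms(1))
  obtain f :: "int poly \<Rightarrow> 'b" where f: "type_hom F f" "range f = carrier F"
    using fd.ex_surj_hom_int_poly[OF assms(2)] by blast
  have "finite_field F f"
    using f assms fd.field_axioms by (simp add: finite_field_def finite_field_axioms_def)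
  then show thesis by (rule that)
qed

theorem theorem4p38:
  shows
    "(\<forall>(F :: 'a ring) r n U u.
        field F \<and> finite (carrier F) \<and> 1 \<le> r \<and> r < n \<and> adapted_basis F r n U u \<longrightarrow>
        T_union F r n U u \<subseteq> {T \<in> GL_stabilizer F n U. \<not> cyclic_matrix F n T})
     \<and>
     (\<exists>C::real. \<forall>(F :: 'a ring) r U u.
        field F \<and> finite (carrier F) \<and> 1 \<le> r \<and>
        (\<forall>n>r. adapted_basis F r n (U n) (u n)) \<longrightarrow>
        (\<exists>L::real.
           (\<lambda>n. real (card (T_union F r n (U n) (u n))) / real (card (GL_stabilizer F n (U n))))
             \<longlonglongrightarrow> L \<and>
           \<bar>L - 1 / real (order F) ^ 2\<bar> \<le> C / real (order F) ^ 3))"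
\<comment> \<open>The witness is the constant 4 of \<open>good_prop_close\<close>, chosen before the
  field.\<close>
proof (rule conjI; (rule exI[of _ 4])?; intro allI impI)
  fix F :: "'a ring" and r n U u
  assume as: "field F \<and> finite (carrier F) \<and> 1 \<le> r \<and> r < n \<and> adapted_basis F r n U u"
  then obtain phi where "finite_field F phi" using ex_finite_field by blast
  then interpret finite_field F phi .
  show "T_union F r n U u \<subseteq> {T \<in> GL_stabilizer F n U. \<not> cyclic_matrix F n T}"
    using T_union_noncyclic[of r n "n - r" U u] as by (simp add: Suc_le_eq One_nat_def)
next
  fix F :: "'a ring" and r and U :: "nat \<Rightarrow> 'a vec set" and u
  assume as: "field F \<and> finite (carrier F) \<and> 1 \<le> r \<and> (\<forall>n>r. adapted_basis F r n (U n) (u n))"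
  then obtain phi where "finite_field F phi" using ex_finite_field by blast
  then interpret finite_field F phi .
  obtain L where L: "(\<lambda>m. good_prop r m) \<longlonglongrightarrow> L" "\<bar>L - 1 / real (card (carrier F)) ^ 2\<bar> \<le> 4 / real (card (carrier F)) ^ 3"
    using good_prop_limit[of r] as by blast
  \<comment> \<open>\<open>good_prop\<close> is indexed by the codimension n - r. The spaces U n and
    the bases u n may change with n in any way, since \<open>ratio_eq\<close> removes them.\<close>
  have "(\<lambda>n. good_prop r (n - r)) \<longlonglongrightarrow> L"
    by (rule LIMSEQ_offset[of _ r]) (simp add: L)
  moreover have "eventually (\<lambda>n. good_prop r (n - r)
      = real (card (T_union F r n (U n) (u n))) / real (card (GL_stabilizer F n (U n)))) sequentially"
  proof (rule eventually_mono[OF eventually_gt_at_top[of r]])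
    fix n assume "r < n"
    then show "good_prop r (n - r) = real (card (T_union F r n (U n) (u n))) / real (card (GL_stabilizer F n (U n)))"
      using ratio_eq[of r n "n - r" "U n" "u n"] as by (simp add: Suc_le_eq One_nat_def)
  qed
  ultimately have "(\<lambda>n. real (card (T_union F r n (U n) (u n))) / real (card (GL_stabilizer F n (U n)))) \<longlonglongrightarrow> L"
    by (rule Lim_transform_eventually)
  then show "\<exists>L::real. (\<lambda>n. real (card (T_union F r n (U n) (u n))) / real (card (GL_stabilizer F n (U n)))) \<longlonglongrightarrow> L \<and>
      \<bar>L - 1 / real (order F) ^ 2\<bar> \<le> 4 / real (order F) ^ 3"
    using L(2) unfolding Coset.order_def by blast
qed

end
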